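(* Let $k\ge 2$ be a fixed integer, and let $p\ge 1$ and $n_1,\dots,n_k\ge 3$ be integers, where $p$ may depend on (and grow with) the sample sizes, such that $n_i\ge p+2$ for all $i\in\{1,\dots,k\}$. Let $y_{i1},\dots,y_{in_i}$, $i\in\{1,\dots,k\}$, be mutually independent random vectors with $y_{ij}\sim N_p(\mu_i,\Lambda_i^{-1})$, where $\mu_i\in\mathbb{R}^p$ and the symmetric positive definite concentration matrices $\Lambda_i$ are all unknown. Under the null hypothesis $$H_\psi:\ \Lambda_1=\dots=\Lambda_k$$ (i.e. for every choice of $\mu_1,\dots,\mu_k$ and every common positive definite value of $\Lambda_1=\dots=\Lambda_k$), the directional $p$-value $p(\psi)$ for $H_\psi$ (defined in the context) is exactly uniformly distributed on $(0,1)$.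
   Context: Notation. $y_i$ is the $n_i\times p$ data matrix of group $i$ (rows $y_{ij}^T$), $n=\sum_{i=1}^k n_i$, $\bar y_i=y_i^T 1_{n_i}/n_i$ with $1_{n_i}$ the vector of ones, and $A_i=y_i^Ty_i-n_i\bar y_i\bar y_i^T$. The unconstrained maximum likelihood estimates are $\hat\mu_i=\bar y_i$, $\hat\Lambda_i^{-1}=A_i/n_i$; under $H_\psi$ the constrained ones are $\hat\mu_{0i}=\bar y_i$ and $\hat\Lambda_0^{-1}=\sum_{i=1}^k A_i/n$ (common to all groups). The number of constraints imposed by $H_\psi$ is $d=p(p+1)(k-1)/2$. Directional $p$-value (general definition in a linear exponential family). Let $\varphi$ be the canonical parameter, $u$ the canonical sufficient statistic, $u^0$ its observed value, $s=u-u^0$, and $\ell(\varphi;s)=\varphi^Ts+\ell^0(\varphi)$, where $\ell^0(\varphi)$ is the observed log-likelihood. Let $\hat\varphi^0_\psi$ be the constrained maximum likelihood estimate under $H_\psi$ from the observed data, $s_\psi=-\partial\ell^0(\varphi)/\partial\varphi|_{\varphi=\hat\varphi^0_\psi}$, and $s(t)=(1-t)s_\psi$, $t\in\mathbb{R}$ (so $s(1)=0$ is the observed value and $s(0)=s_\psi$). Let $\hat\varphi(s)$ be the maximizer of $\ell(\varphi;s)$, let $J_{\varphi\varphi}(\varphi;s)=-\partial^2\ell(\varphi;s)/\partial\varphi\,\partial\varphi^T$, and let the saddlepoint approximation be $$h(s;\psi)=c\,\exp\left[\ell(\hat\varphi^0_\psi;s)-\ell\{\hat\varphi(s);s\}\right]\,|J_{\varphi\varphi}\{\hat\varphi(s);s\}|^{-1/2},$$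 with $c$ a constant. Then $$p(\psi)=\frac{\int_1^{t_{sup}}t^{d-1}h\{s(t);\psi\}\,dt}{\int_0^{t_{sup}}t^{d-1}h\{s(t);\psi\}\,dt},$$ where $t_{sup}$ is the largest value (supremum) of $t$ for which the maximum likelihood estimate $\hat\varphi\{s(t)\}$ exists. In the present model, $\varphi$ has components $\xi_i=\Lambda_i\mu_i$ and the distinct entries of $\Lambda_i$, $i\in\{1,\dots,k\}$, and $\ell\{\varphi;s(t)\}=\sum_{i=1}^k\ell_i(\varphi_i;t)$ with $$\ell_i(\varphi_i;t)=n_i\xi_i^T\bar y_i-\frac{n_i}{2}\mathrm{tr}\left[\Lambda_i\left\{\frac{y_i^Ty_i}{n_i}+(1-t)(\hat\Lambda_0^{-1}-\hat\Lambda_i^{-1})\right\}\right]+\frac{n_i}{2}\log|\Lambda_i|-\frac{n_i}{2}\xi_i^T\Lambda_i^{-1}\xi_i .$$ Its maximizer corresponds to $\hat\mu_i(t)=\bar y_i$ and $\hat\Lambda_i(t)^{-1}=(1-t)\hat\Lambda_0^{-1}+t\hat\Lambda_i^{-1}$, and explicitly $$h\{s(t);\psi\}=c\,\exp\left\{\sum_{i=1}^k\frac{n_i-p-2}{2}\log|\hat\Lambda_i(t)^{-1}|\right\},$$ with $c$ not depending on $t$ (it cancels in $p(\psi)$); $t_{sup}$ is the largest $t$ for which all $\hat\Lambda_i(t)^{-1}$ are positive definite. *)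

theory Defs
  imports "HOL-Probability.Probability" "HOL-Library.Uprod"
begin

text \<open>
  A model is given by the parameter space \<open>\<Phi>\<close> of the canonical parameter \<open>\<phi>\<close>, the part \<open>\<Phi>0\<close> of it
  on which the hypothesis holds, and the observed log-likelihood \<open>l0\<close> (which is irrelevant
  outside \<open>\<Phi>\<close>). Additive constants in \<open>l0\<close> and the constant \<open>c\<close> cancel in the p-value.
\<close>

definition tilted_loglik :: "(real^'m \<Rightarrow> real) \<Rightarrow> real^'m \<Rightarrow> real^'m \<Rightarrow> real" where
  "tilted_loglik l0 s \<phi> = \<phi> \<bullet> s + l0 \<phi>"

definition grad :: "(real^'m \<Rightarrow> real) \<Rightarrow> real^'m \<Rightarrow> real^'m" where
  "grad f x = (\<chi> i. frechet_derivative f (at x) (axis i 1))"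

definition hessian :: "(real^'m \<Rightarrow> real) \<Rightarrow> real^'m \<Rightarrow> real^'m^'m" where
  "hessian f x = jacobian (grad f) (at x)"

definition mle_exists :: "(real^'m) set \<Rightarrow> (real^'m \<Rightarrow> real) \<Rightarrow> bool" where
  "mle_exists \<Phi> l \<longleftrightarrow> (\<exists>\<phi>. is_arg_max l (\<lambda>x. x \<in> \<Phi>) \<phi>)"

definition mle :: "(real^'m) set \<Rightarrow> (real^'m \<Rightarrow> real) \<Rightarrow> real^'m" where
  "mle \<Phi> l = arg_max_on l \<Phi>"

definition saddlepoint ::
    "real \<Rightarrow> (real^'m) set \<Rightarrow> (real^'m) set \<Rightarrow> (real^'m \<Rightarrow> real) \<Rightarrow> real^'m \<Rightarrow> real" where
  "saddlepoint c \<Phi> \<Phi>0 l0 s =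
     (let l = tilted_loglik l0 s; \<phi>hat0 = mle \<Phi>0 l0; \<phi>hat = mle \<Phi> l
      in c * exp (l \<phi>hat0 - l \<phi>hat) * det (- hessian l \<phi>hat) powr (- 1 / 2))"

definition s_line :: "(real^'m) set \<Rightarrow> (real^'m \<Rightarrow> real) \<Rightarrow> real \<Rightarrow> real^'m" where
  "s_line \<Phi>0 l0 t = (1 - t) *\<^sub>R (- grad l0 (mle \<Phi>0 l0))"

text \<open>Extended real, since in exceptional samples the estimate exists for all large \<open>t\<close>.\<close>

definition t_sup :: "(real^'m) set \<Rightarrow> (real^'m) set \<Rightarrow> (real^'m \<Rightarrow> real) \<Rightarrow> ereal" where
  "t_sup \<Phi> \<Phi>0 l0 = (SUP t \<in> {t. mle_exists \<Phi> (tilted_loglik l0 (s_line \<Phi>0 l0 t))}. ereal t)"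

definition directional_p_value ::
    "real \<Rightarrow> nat \<Rightarrow> (real^'m) set \<Rightarrow> (real^'m) set \<Rightarrow> (real^'m \<Rightarrow> real) \<Rightarrow> real" where
  "directional_p_value c d \<Phi> \<Phi>0 l0 =
     (LBINT t=1..t_sup \<Phi> \<Phi>0 l0. t ^ (d - 1) * saddlepoint c \<Phi> \<Phi>0 l0 (s_line \<Phi>0 l0 t)) /
     (LBINT t=0..t_sup \<Phi> \<Phi>0 l0. t ^ (d - 1) * saddlepoint c \<Phi> \<Phi>0 l0 (s_line \<Phi>0 l0 t))"

definition pos_def_matrix :: "real^'p^'p \<Rightarrow> bool" where
  "pos_def_matrix A \<longleftrightarrow> transpose A = A \<and> (\<forall>v. v \<noteq> 0 \<longrightarrow> v \<bullet> (A *v v) > 0)"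

definition mvnormal_density :: "real^'p \<Rightarrow> real^'p^'p \<Rightarrow> real^'p \<Rightarrow> real" where
  "mvnormal_density \<mu> \<Sigma> x =
     exp (- ((x - \<mu>) \<bullet> (matrix_inv \<Sigma> *v (x - \<mu>))) / 2) / sqrt ((2 * pi) ^ CARD('p) * det \<Sigma>)"

text \<open>
  Groups are indexed by \<open>'k\<close> and coordinates by \<open>'p\<close>; the observations of group \<open>i\<close> are
  \<open>y i j\<close> with \<open>j < n i\<close>. The distinct entries of a symmetric matrix are indexed by unordered pairs
  (with \<open>Upair a a\<close> for the diagonal), so that the canonical parameter is a vector over
  \<open>'k \<times> ('p + 'p uprod)\<close>: the entries \<open>(i, Inl a)\<close> form \<open>\<xi>\<close> of group \<open>i\<close>, i.e. \<open>\<Lambda> \<mu>\<close>, and the entries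
  \<open>(i, Inr (Upair a b))\<close> form the concentration matrix \<open>\<Lambda>\<close> of group \<open>i\<close>.
\<close>

instance uprod :: (finite) finite
  by standard simp

definition xi_of :: "real^('k \<times> ('p::finite + 'p uprod)) \<Rightarrow> 'k::finite \<Rightarrow> real^'p" where
  "xi_of \<phi> i = (\<chi> a. \<phi> $ (i, Inl a))"

definition conc_of :: "real^('k \<times> ('p::finite + 'p uprod)) \<Rightarrow> 'k::finite \<Rightarrow> real^'p^'p" where
  "conc_of \<phi> i = (\<chi> a b. \<phi> $ (i, Inr (Upair a b)))"

definition normal_params :: "(real^('k::finite \<times> ('p::finite + 'p uprod))) set" where
  "normal_params = {\<phi>. \<forall>i. pos_def_matrix (conc_of \<phi> i)}"

definition equal_conc_params :: "(real^('k::finite \<times> ('p::finite + 'p uprod))) set" where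
  "equal_conc_params = {\<phi> \<in> normal_params. \<forall>i j. conc_of \<phi> i = conc_of \<phi> j}"

definition sample_mean :: "nat \<Rightarrow> (nat \<Rightarrow> real^'p) \<Rightarrow> real^'p" where
  "sample_mean m y = (\<Sum>j<m. y j) /\<^sub>R real m"

text \<open>\<open>gram m y\<close> is \<open>y\<^sup>T y\<close> for the \<open>m \<times> p\<close> matrix with rows \<open>y 0, \<dots>, y (m - 1)\<close>.\<close>

definition gram :: "nat \<Rightarrow> (nat \<Rightarrow> real^'p) \<Rightarrow> real^'p^'p" where
  "gram m y = (\<chi> a b. \<Sum>j<m. y j $ a * y j $ b)"

text \<open>The log-likelihood of the data, up to the additive constant with \<open>ln (2 * pi)\<close>.\<close>

definition normal_loglik ::
    "('k::finite \<Rightarrow> nat) \<Rightarrow> ('k \<Rightarrow> nat \<Rightarrow> real^'p) \<Rightarrow> real^('k \<times> ('p::finite + 'p uprod)) \<Rightarrow> real" where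
  "normal_loglik n y \<phi> =
     (\<Sum>i\<in>UNIV. real (n i) * (xi_of \<phi> i \<bullet> sample_mean (n i) (y i))
        - trace (conc_of \<phi> i ** gram (n i) (y i)) / 2
        + real (n i) / 2 * ln (det (conc_of \<phi> i))
        - real (n i) / 2 * (xi_of \<phi> i \<bullet> (matrix_inv (conc_of \<phi> i) *v xi_of \<phi> i)))"

text \<open>
  For normal samples the estimates below exist, and \<open>t_sup\<close> is finite, only almost surely; on the
  exceptional null set of samples the value is arbitrary (and so need only be measurable with
  respect to the completed probability space).
  The number of constraints imposed by the hypothesis is \<open>d = p (p + 1) (k - 1) / 2\<close>.
\<close>

definition equal_conc_p_value ::
    "real \<Rightarrow> ('k::finite \<Rightarrow> nat) \<Rightarrow> ('k \<Rightarrow> nat \<Rightarrow> real^'p::finite) \<Rightarrow> real" where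
  "equal_conc_p_value c n y =
     directional_p_value c (CARD('p) * (CARD('p) + 1) * (CARD('k) - 1) div 2)
       normal_params equal_conc_params (normal_loglik n y)"

end

theory Submission
  imports Defs
begin

text \<open>
  Under the hypothesis the scatter matrices \<open>A\<^sub>i\<close> are independent with density proportional to
  \<open>det A powr ((n\<^sub>i - p - 2) / 2) * exp (- trace (\<Lambda> A) / 2)\<close>; up to constants this follows from the uniqueness of
  the measure on positive definite matrices that is invariant under \<open>A \<mapsto> g A g\<^sup>T\<close>. The maps
  \<open>A\<^sub>i \<mapsto> t A\<^sub>i + (1 - t) (n\<^sub>i / n) (\<Sum>j. A\<^sub>j)\<close> preserve the exponential factor, since it depends only on
  the sum, and scale Lebesgue measure by \<open>t\<^sup>d\<close>. Hence, given the sum and the ray through the sample,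
  the position \<open>t\<close> on the ray has a density proportional to \<open>t\<^bsup>d - 1\<^esup>\<close> times the product of the powers of
  the determinants, which is exactly the integrand of the directional p-value: this is the tail
  probability of the observed position \<open>t = 1\<close>, and so uniform.
\<close>

section \<open>Positive definite matrices\<close>

text \<open>The test is exact, not merely asymptotic, because exponents coincide. In the saddlepoint
  density the likelihood ratio contributes \<open>det\<close> to the power n_i/2 and the information
  matrix the power -(p+2)/2; their sum (n_i - p - 2)/2 is the exponent of the Wishart density with
  n_i - 1 degrees of freedom. Likewise d is both the number of constraints and the dimension of the
  space on which the dilations multiply by t, so that \<open>t ^ (d - 1)\<close> is a polar
  Jacobian. No normalizing constant is ever computed: laws are stated as an unspecified
  \<open>K\<close> in \<open>ennreal\<close> times an unnormalized integral, and \<open>K\<close>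
  disappears when the total mass is compared with 1. The definition of the p-value needs care at two
  points. \<open>mle\<close> is a choice operator and \<open>t_sup\<close> a supremum over the
  parameters where a maximizer exists, so that uniqueness of maximizers is required, and also their
  nonexistence outside the positive definite cone. And the value is uncontrolled on samples with a
  singular scatter matrix, whence the completed measure in the conclusion.\<close>

lemma linear_le_quadratic_imp_zero:
  fixes a b :: real
  assumes "\<And>t. 2 * t * a \<le> t\<^sup>2 * b"
  shows "a = 0"
proof (rule ccontr)
  assume "a \<noteq> 0"
  \<comment> \<open>With this t the bound \<open>t^2 * (|b| + 1)\<close> equals
    \<open>t * a\<close>, so the assumption becomes \<open>2 * t * a <= t * a\<close>; the summand 1
    keeps the denominator positive.\<close>
  define t where "t = a / (\<bar>b\<bar> + 1)"
  have "2 * t * a \<le> t\<^sup>2 * b" using assms .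
  also have "\<dots> \<le> t\<^sup>2 * (\<bar>b\<bar> + 1)" by (intro mult_left_mono) auto
  also have "\<dots> = t * a" by (simp add: t_def power2_eq_square)
  finally have "t * a \<le> 0" by (simp add: mult_ac)
  moreover have "t * a > 0"
    using \<open>a \<noteq> 0\<close> by (simp add: t_def zero_less_mult_iff zero_less_divide_iff) linarith
  ultimately show False by simp
qed

text \<open>Spectral theorem by induction on the dimension of an invariant subspace. A maximizer b
  of the quadratic form on the unit sphere of \<open>S\<close> is an eigenvector: comparing b with b
  + t y for y orthogonal to b bounds a linear term in t by a quadratic one, so f b has no component
  along y. Self-adjointness makes the part of \<open>S\<close> orthogonal to b invariant again.
  Working with subspaces keeps the induction inside one type.\<close>

lemma self_adjoint_eigenbasis:
  fixes f :: "'a::euclidean_space \<Rightarrow> 'a"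
  assumes f: "linear f" and sa: "\<And>x y. f x \<bullet> y = x \<bullet> f y"
    and S: "subspace S" and inv: "f ` S \<subseteq> S"
  shows "\<exists>B. B \<subseteq> S \<and> pairwise orthogonal B \<and> (\<forall>b\<in>B. norm b = 1 \<and> (\<exists>c. f b = c *\<^sub>R b)) \<and> span B = S"
  using S inv
proof (induction "dim S" arbitrary: S rule: less_induct)
  case less
  interpret f: linear f by fact
  show ?case
  proof (cases "S = {0}")
    case True
    then show ?thesis by (intro exI[of _ "{}"]) auto
  next
    case False
    with less.prems obtain z where z: "z \<in> S" "z \<noteq> 0"
      using subspace_0 by blast
    let ?K = "sphere 0 1 \<inter> S"
    have "compact ?K" by (intro compact_Int_closed compact_sphere closed_subspace less.prems)
    moreover have "z /\<^sub>R norm z \<in> ?K" using z less.prems by (auto simp: subspace_scale)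
    moreover have "continuous_on ?K (\<lambda>x. x \<bullet> f x)"
      by (intro continuous_intros linear_continuous_on linear_conv_bounded_linear[THEN iffD1] f)
    ultimately obtain b where b: "b \<in> ?K" and bmax: "\<And>y. y \<in> ?K \<Longrightarrow> y \<bullet> f y \<le> b \<bullet> f b"
      using continuous_attains_sup[of ?K "\<lambda>x. x \<bullet> f x"] by blast
    define c where "c = b \<bullet> f b"
    have nb: "norm b = 1" and bS: "b \<in> S" using b by auto
    have bb: "b \<bullet> b = 1" using nb by (simp add: norm_eq_1)
    have max': "y \<bullet> f y \<le> c * (y \<bullet> y)" if "y \<in> S" for y
    proof (cases "y = 0")
      case False
      have "y /\<^sub>R norm y \<in> ?K" using that False less.prems by (auto simp: subspace_scale)
      from bmax[OF this] have "(y \<bullet> f y) / (norm y)\<^sup>2 \<le> c"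
        by (simp add: c_def f.scaleR power2_eq_square field_simps)
      then show ?thesis using False by (simp add: field_simps power2_norm_eq_inner)
    qed (simp add: f.zero)
    have orth: "y \<bullet> f b = 0" if y: "y \<in> S" "b \<bullet> y = 0" for y
    proof (rule linear_le_quadratic_imp_zero)
      fix t :: real
      have "b + t *\<^sub>R y \<in> S" using y bS less.prems by (simp add: subspace_add subspace_scale)
      from max'[OF this]
      have "c + 2 * t * (y \<bullet> f b) + t\<^sup>2 * (y \<bullet> f y) \<le> c * (1 + t\<^sup>2 * (y \<bullet> y))"
        using sa[of b y] y(2) bb
        by (simp add: f.add f.scaleR inner_add_left inner_add_right c_def[symmetric] inner_commute
            power2_eq_square algebra_simps)
      then show "2 * t * (y \<bullet> f b) \<le> t\<^sup>2 * (c * (y \<bullet> y) - y \<bullet> f y)"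
        by (simp add: algebra_simps)
    qed
    have fbS: "f b \<in> S" using less.prems bS by auto
    have eig: "f b = c *\<^sub>R b"
    proof -
      \<comment> \<open>The residual lies in \<open>S\<close> and is orthogonal to b, hence also to
        f b, and therefore to itself.\<close>
      let ?r = "f b - c *\<^sub>R b"
      have rS: "?r \<in> S" using fbS bS less.prems by (simp add: subspace_diff subspace_scale)
      have br: "b \<bullet> ?r = 0" using bb by (simp add: inner_diff_right c_def)
      have "?r \<bullet> f b = 0" using orth[OF rS br] .
      then have "?r \<bullet> ?r = 0" using br by (simp add: inner_diff_right inner_commute)
      then show ?thesis by simp
    qed
    let ?S' = "S \<inter> {y. b \<bullet> y = 0}"
    have S': "subspace ?S'" by (intro subspace_inter less.prems subspace_hyperplane)
    have inv': "f ` ?S' \<subseteq> ?S'"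
    proof
      fix y assume "y \<in> f ` ?S'"
      then obtain x where x: "x \<in> S" "b \<bullet> x = 0" "y = f x" by auto
      then have "b \<bullet> f x = 0" using sa[of b x] eig by simp
      then show "y \<in> ?S'" using x less.prems by auto
    qed
    have "dim ?S' < dim S"
    proof (rule ccontr)
      assume "\<not> dim ?S' < dim S"
      then have "?S' = S" using S' less.prems by (intro subspace_dim_equal) auto
      then have "b \<in> ?S'" using bS by blast
      then show False using bb by simp
    qed
    from less.hyps[OF this S' inv'] obtain B where B: "B \<subseteq> ?S'" "pairwise orthogonal B"
      "\<forall>b\<in>B. norm b = 1 \<and> (\<exists>c. f b = c *\<^sub>R b)" "span B = ?S'" by blast
    have "span (insert b B) = S"
    proof
      show "span (insert b B) \<subseteq> S"
        using bS B(1) less.prems by (intro span_minimal) auto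
      show "S \<subseteq> span (insert b B)"
      proof
        fix y assume y: "y \<in> S"
        have "y - (b \<bullet> y) *\<^sub>R b \<in> ?S'"
          using y bS less.prems bb by (simp add: subspace_diff subspace_scale inner_diff_right)
        then have "y - (b \<bullet> y) *\<^sub>R b \<in> span B" using B by simp
        then show "y \<in> span (insert b B)" by (auto simp: span_insert)
      qed
    qed
    moreover have "pairwise orthogonal (insert b B)"
      using B by (auto simp: pairwise_insert orthogonal_def inner_commute)
    ultimately show ?thesis
      using B nb bS eig by (intro exI[of _ "insert b B"]) auto
  qed
qed

definition diag_matrix :: "('n \<Rightarrow> real) \<Rightarrow> real^'n^'n" where
  "diag_matrix d = (\<chi> i j. if i = j then d i else 0)"

lemma diag_matrix_nth: "diag_matrix d $ i $ j = (if i = j then d i else 0)"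
  by (simp add: diag_matrix_def)

lemma diag_matrix_mult: "diag_matrix d ** diag_matrix e = diag_matrix (\<lambda>i. d i * e i)"
  by (simp add: diag_matrix_def matrix_matrix_mult_def vec_eq_iff if_distrib[of "\<lambda>x. x * _"] cong: if_cong)

lemma transpose_diag_matrix [simp]: "transpose (diag_matrix d) = diag_matrix d"
  by (simp add: diag_matrix_def transpose_def vec_eq_iff)

lemma det_diag_matrix [simp]: "det (diag_matrix d :: real^'n::finite^'n) = (\<Prod>i\<in>UNIV. d i)"
  by (subst det_diagonal) (auto simp: diag_matrix_nth)

lemma diag_matrix_1: "diag_matrix (\<lambda>_. 1) = mat 1"
  by (simp add: diag_matrix_def mat_def)

lemma trace_diag_matrix [simp]: "trace (diag_matrix d) = sum d UNIV"
  by (simp add: trace_def diag_matrix_nth)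

lemma diag_matrix_mult_vec: "diag_matrix d *v x = (\<chi> i. d i * x $ i)"
  by (simp add: diag_matrix_def matrix_vector_mult_def vec_eq_iff if_distrib[of "\<lambda>x. x * _"] cong: if_cong)

lemma matrix_self_adjoint:
  fixes A :: "real^'n^'n"
  assumes "transpose A = A"
  shows "(A *v x) \<bullet> y = x \<bullet> (A *v y)"
  by (metis assms dot_lmul_matrix transpose_matrix_vector)

theorem symmetric_matrix_diagonalization:
  fixes A :: "real^'n^'n::finite"
  assumes "transpose A = A"
  obtains Q d where "orthogonal_matrix Q" "A = Q ** diag_matrix d ** transpose Q"
proof -
  have "\<exists>B. B \<subseteq> UNIV \<and> pairwise orthogonal B \<and> (\<forall>b\<in>B. norm b = 1 \<and> (\<exists>c. A *v b = c *\<^sub>R b)) \<and> span B = (UNIV::(real^'n) set)"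
    by (rule self_adjoint_eigenbasis) (use assms in \<open>auto simp: matrix_self_adjoint\<close>)
  then obtain B :: "(real^'n) set" where B: "pairwise orthogonal B" "\<And>b. b \<in> B \<Longrightarrow> norm b = 1"
    "\<And>b. b \<in> B \<Longrightarrow> \<exists>c. A *v b = c *\<^sub>R b" "span B = UNIV" by blast
  have "independent B"
    using B by (intro pairwise_orthogonal_independent) force+
  then have "card B = CARD('n)" "finite B"
    using B(4) dim_eq_card[of B UNIV] by (auto simp: independent_imp_finite)
  then obtain h :: "'n \<Rightarrow> real^'n" where h: "bij_betw h UNIV B"
    by (metis finite bij_betw_iff_card)
  have "\<forall>j. \<exists>c. A *v h j = c *\<^sub>R h j"
    using B(3) h by (auto simp: bij_betw_def)
  then obtain d where d: "\<And>j. A *v h j = d j *\<^sub>R h j"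
    by metis
  define Q where "Q = (\<chi> i j. h j $ i)"
  have "h i \<bullet> h j = (if i = j then 1 else 0)" for i j
  proof (cases "i = j")
    case True
    then show ?thesis using B(2)[of "h i"] h by (auto simp: bij_betw_def norm_eq_1)
  next
    case False
    then have "h i \<noteq> h j" using h by (auto simp: bij_betw_def inj_def)
    then show ?thesis using B(1) h False by (auto simp: bij_betw_def pairwise_def orthogonal_def)
  qed
  then have "transpose Q ** Q = mat 1"
    by (simp add: Q_def matrix_matrix_mult_def transpose_def mat_def vec_eq_iff inner_vec_def)
  then have Q: "orthogonal_matrix Q" by (simp add: orthogonal_matrix)
  have "A ** Q = Q ** diag_matrix d"
    using d by (simp add: vec_eq_iff matrix_matrix_mult_def matrix_vector_mult_def Q_def
        diag_matrix_def if_distrib[of "\<lambda>x. _ * x"] mult.commute cong: if_cong)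
  then have "A ** Q ** transpose Q = Q ** diag_matrix d ** transpose Q" by simp
  then have "A = Q ** diag_matrix d ** transpose Q"
    using Q by (simp add: matrix_mul_assoc[symmetric] orthogonal_matrix_def)
  with Q show ?thesis by (rule that)
qed

section \<open>Inverses, congruence and factorization of positive definite matrices\<close>

lemma matrix_inv_mult:
  fixes A :: "real^'n^'n::finite"
  assumes "det A \<noteq> 0"
  shows "matrix_inv A ** A = mat 1" "A ** matrix_inv A = mat 1"
proof -
  have "\<exists>B. A ** B = mat 1 \<and> B ** A = mat 1"
    using assms by (simp add: invertible_def[symmetric] invertible_det_nz)
  from someI_ex[OF this] show "matrix_inv A ** A = mat 1" "A ** matrix_inv A = mat 1"
    unfolding matrix_inv_def by auto
qed

lemma matrix_inv_unique:
  fixes A :: "real^'n^'n::finite"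
  assumes "A ** B = mat 1"
  shows "matrix_inv A = B"
proof -
  have "det A * det B = 1" using assms by (metis det_mul det_I)
  then have "det A \<noteq> 0" by auto
  then have "matrix_inv A ** (A ** B) = B" by (simp add: matrix_mul_assoc matrix_inv_mult)
  then show ?thesis using assms by simp
qed

lemma pos_def_transpose: "pos_def_matrix A \<Longrightarrow> transpose A = A"
  by (simp add: pos_def_matrix_def)

lemma pos_def_pos: "pos_def_matrix A \<Longrightarrow> v \<noteq> 0 \<Longrightarrow> v \<bullet> (A *v v) > 0"
  by (simp add: pos_def_matrix_def)

lemma inner_congruence:
  fixes g :: "real^'n^'m" and A :: "real^'n^'n"
  shows "v \<bullet> ((g ** A ** transpose g) *v v) = (transpose g *v v) \<bullet> (A *v (transpose g *v v))"
  by (simp add: matrix_vector_mul_assoc[symmetric] dot_lmul_matrix[symmetric] vector_transpose_matrix)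

lemma transpose_congruence:
  fixes g :: "real^'n^'m" and A :: "real^'n^'n"
  assumes "transpose A = A"
  shows "transpose (g ** A ** transpose g) = g ** A ** transpose g"
  by (simp add: matrix_transpose_mul assms matrix_mul_assoc)

lemma matrix_vector_mult_eq_0_iff:
  fixes g :: "real^'n^'n::finite"
  assumes "det g \<noteq> 0"
  shows "g *v v = 0 \<longleftrightarrow> v = 0"
proof
  assume "g *v v = 0"
  then have "matrix_inv g *v (g *v v) = 0" by simp
  then show "v = 0" using assms by (simp add: matrix_vector_mul_assoc matrix_inv_mult)
qed simp

lemma pos_def_congruence:
  fixes g A :: "real^'n^'n::finite"
  assumes "pos_def_matrix A" "det g \<noteq> 0"
  shows "pos_def_matrix (g ** A ** transpose g)"
proof -
  have "det (transpose g) \<noteq> 0" using assms by simp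
  then show ?thesis
    unfolding pos_def_matrix_def inner_congruence
    using assms matrix_vector_mult_eq_0_iff[of "transpose g"]
    by (simp add: transpose_congruence pos_def_transpose pos_def_pos del: transpose_matrix_vector)
qed

lemma pos_def_mat_1: "pos_def_matrix (mat 1)"
  by (simp add: pos_def_matrix_def)

lemma pos_def_diagonalization:
  fixes A :: "real^'n^'n::finite"
  assumes "pos_def_matrix A"
  obtains Q d where "orthogonal_matrix Q" "A = Q ** diag_matrix d ** transpose Q" "\<And>i. d i > 0"
proof -
  obtain Q d where Q: "orthogonal_matrix Q" and A: "A = Q ** diag_matrix d ** transpose Q"
    using symmetric_matrix_diagonalization[OF pos_def_transpose[OF assms]] .
  have "d i > 0" for i
  proof -
    have QQ: "transpose Q ** Q = mat 1" using Q by (simp add: orthogonal_matrix)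
    let ?v = "Q *v axis i 1"
    have t: "transpose Q *v ?v = axis i 1" by (simp add: matrix_vector_mul_assoc QQ)
    then have "?v \<noteq> 0" by (metis axis_eq_0_iff matrix_vector_mult_0_right zero_neq_one)
    then have "?v \<bullet> (A *v ?v) > 0" using assms by (rule pos_def_pos[rotated])
    then show ?thesis
      by (simp only: A inner_congruence t diag_matrix_mult_vec) (simp add: inner_axis')
  qed
  from Q A this show ?thesis by (rule that)
qed

text \<open>This is the transitivity of the action \<open>g ** A ** transpose g\<close> on the cone:
  every positive definite matrix lies in the orbit of the identity.\<close>

lemma pos_def_factorization:
  fixes A :: "real^'n^'n::finite"
  assumes "pos_def_matrix A"
  obtains S where "A = S ** transpose S" "det S \<noteq> 0"
proof -
  obtain Q d where Q: "orthogonal_matrix Q" and A: "A = Q ** diag_matrix d ** transpose Q"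
    and d: "\<And>i. d i > 0" using pos_def_diagonalization[OF assms] by blast
  have *: "diag_matrix d = diag_matrix (\<lambda>i. sqrt (d i)) ** diag_matrix (\<lambda>i. sqrt (d i))"
    using d by (simp add: diag_matrix_mult less_imp_le)
  let ?S = "Q ** diag_matrix (\<lambda>i. sqrt (d i))"
  have "A = ?S ** transpose ?S"
    by (simp add: A * matrix_transpose_mul matrix_mul_assoc)
  moreover have "det ?S \<noteq> 0"
    using det_orthogonal_matrix[OF Q] d by (auto simp: det_mul less_imp_neq[symmetric])
  ultimately show ?thesis by (rule that)
qed

lemma pos_def_det_pos:
  fixes A :: "real^'n^'n::finite"
  assumes "pos_def_matrix A"
  shows "det A > 0"
proof -
  obtain S where "A = S ** transpose S" "det S \<noteq> 0" using pos_def_factorization[OF assms] .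
  then show ?thesis by (simp add: det_mul zero_less_mult_iff) linarith
qed

lemma pos_def_matrix_inv:
  fixes A :: "real^'n^'n::finite"
  assumes A: "pos_def_matrix A"
  shows "pos_def_matrix (matrix_inv A)"
proof -
  have d: "det A \<noteq> 0" using pos_def_det_pos[OF A] by simp
  have "transpose (A ** matrix_inv A) = mat 1" using d by (simp add: matrix_inv_mult transpose_mat)
  then have "transpose (matrix_inv A) ** A = mat 1"
    using pos_def_transpose[OF A] by (simp add: matrix_transpose_mul)
  then have "A ** transpose (matrix_inv A) = mat 1" by (simp add: matrix_left_right_inverse)
  then have t: "transpose (matrix_inv A) = matrix_inv A" using matrix_inv_unique by metis
  have di: "det (matrix_inv A) \<noteq> 0"
    using d matrix_inv_mult(1)[OF d] by (metis det_I det_mul mult_zero_left zero_neq_one)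
  have "matrix_inv A = matrix_inv A ** A ** transpose (matrix_inv A)"
    by (simp add: t matrix_inv_mult d)
  then show ?thesis using pos_def_congruence[OF A di] by simp
qed

lemma matrix_inv_inv_pos_def:
  fixes A :: "real^'n^'n::finite"
  assumes "pos_def_matrix A"
  shows "matrix_inv (matrix_inv A) = A"
  using pos_def_det_pos[OF assms] by (intro matrix_inv_unique) (simp add: matrix_inv_mult)

lemma pos_def_add:
  assumes "pos_def_matrix A" "pos_def_matrix B"
  shows "pos_def_matrix (A + B)"
  using assms by (auto simp: pos_def_matrix_def transpose_def vec_eq_iff matrix_vector_mult_add_rdistrib
      inner_add_right add_pos_pos)

lemma pos_def_scaleR:
  fixes A :: "real^'n^'n"
  assumes "pos_def_matrix A" "c > 0"
  shows "pos_def_matrix (c *\<^sub>R A)"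
  using assms by (auto simp: pos_def_matrix_def transpose_def vec_eq_iff scaleR_matrix_vector_assoc[symmetric])

lemma pos_def_sum:
  fixes A :: "'i \<Rightarrow> real^'n^'n"
  assumes "finite I" "I \<noteq> {}" "\<And>i. i \<in> I \<Longrightarrow> pos_def_matrix (A i)"
  shows "pos_def_matrix (\<Sum>i\<in>I. A i)"
  using assms by (induction rule: finite_ne_induct) (auto intro: pos_def_add)

lemma trace_cyclic:
  fixes A B C :: "real^'n^'n::finite"
  shows "trace (A ** B ** C) = trace (B ** C ** A)"
  by (metis matrix_mul_assoc trace_mul_sym)

text \<open>The concave function \<open>ln det \<Lambda> - trace (\<Lambda> B)\<close> has its unique maximum at \<open>B\<^sup>-\<^sup>1\<close>:
  in terms of the eigenvalues of \<open>S\<^sup>T B S\<close> with \<open>\<Lambda> = S S\<^sup>T\<close> this is \<open>ln x \<le> x - 1\<close>.\<close>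

lemma ln_det_minus_trace:
  fixes L B :: "real^'n^'n::finite"
  assumes L: "pos_def_matrix L" and B: "pos_def_matrix B"
  shows "ln (det L) - trace (L ** B) \<le> - ln (det B) - real CARD('n)"
    and "ln (det L) - trace (L ** B) = - ln (det B) - real CARD('n) \<longleftrightarrow> L = matrix_inv B"
proof -
  obtain S where S: "L = S ** transpose S" "det S \<noteq> 0" using pos_def_factorization[OF L] .
  define M where "M = transpose S ** B ** transpose (transpose S)"
  have "pos_def_matrix M" unfolding M_def using B S by (intro pos_def_congruence) auto
  then obtain Q d where Q: "orthogonal_matrix Q" and M: "M = Q ** diag_matrix d ** transpose Q"
    and d: "\<And>i. d i > 0" using pos_def_diagonalization by blast
  have QQ: "transpose Q ** Q = mat 1" "Q ** transpose Q = mat 1" using Q by (auto simp: orthogonal_matrix_def)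
  have dQ: "det Q * det Q = 1" using arg_cong[OF QQ(1), of det] by (simp add: det_mul)
  have "trace (L ** B) = trace M"
    by (simp add: S M_def) (metis trace_cyclic matrix_mul_assoc)
  also have "\<dots> = (\<Sum>i\<in>UNIV. d i)"
    unfolding M trace_cyclic[of Q] using trace_cyclic[of "mat 1" "diag_matrix d" "mat 1"]
    by (simp add: matrix_mul_assoc[symmetric] QQ)
  finally have tr: "trace (L ** B) = (\<Sum>i\<in>UNIV. d i)" .
  have "det L * det B = det M" by (simp add: S M_def det_mul)
  also have "\<dots> = (\<Prod>i\<in>UNIV. d i)" using dQ by (simp add: M det_mul)
  finally have "ln (det L) + ln (det B) = ln (\<Prod>i\<in>UNIV. d i)"
    using ln_mult_pos[OF pos_def_det_pos[OF L] pos_def_det_pos[OF B]] by simp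
  also have "\<dots> = (\<Sum>i\<in>UNIV. ln (d i))" using d by (intro ln_prod) (auto simp: less_imp_neq[OF d, symmetric])
  finally have "ln (det L) + ln (det B) = (\<Sum>i\<in>UNIV. ln (d i))" .
  then have eq: "ln (det L) - trace (L ** B) - (- ln (det B) - real CARD('n)) = - (\<Sum>i\<in>UNIV. d i - 1 - ln (d i))"
    by (simp add: tr sum_subtractf)
  have nn: "d i - 1 - ln (d i) \<ge> 0" for i using ln_le_minus_one[OF d[of i]] by simp
  then have "(\<Sum>i\<in>UNIV. d i - 1 - ln (d i)) \<ge> 0" by (intro sum_nonneg) auto
  with eq show "ln (det L) - trace (L ** B) \<le> - ln (det B) - real CARD('n)" by linarith
  show "ln (det L) - trace (L ** B) = - ln (det B) - real CARD('n) \<longleftrightarrow> L = matrix_inv B"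
  proof
    assume "ln (det L) - trace (L ** B) = - ln (det B) - real CARD('n)"
    with eq have "(\<Sum>i\<in>UNIV. d i - 1 - ln (d i)) = 0" by linarith
    then have "d i - 1 - ln (d i) = 0" for i using nn by (subst (asm) sum_nonneg_eq_0_iff) auto
    then have "d i = 1" for i using ln_eq_minus_one[OF d[of i]] by simp
    then have "d = (\<lambda>_. 1)" by auto
    then have "M = mat 1" using QQ by (simp add: M diag_matrix_1)
    then have "transpose S ** (B ** S) = mat 1" by (simp add: M_def matrix_mul_assoc)
    then have "(B ** S) ** transpose S = mat 1" by (simp add: matrix_left_right_inverse)
    then have "B ** L = mat 1" by (simp add: S matrix_mul_assoc)
    then show "L = matrix_inv B" using matrix_inv_unique by metis
  next
    have dB: "det B \<noteq> 0" using pos_def_det_pos[OF B] by simp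
    assume L: "L = matrix_inv B"
    have "det L * det B = 1" using matrix_inv_mult[OF dB] by (metis L det_I det_mul)
    then have "ln (det L) + ln (det B) = 0" using pos_def_det_pos[OF \<open>pos_def_matrix L\<close>] pos_def_det_pos[OF B]
      by (metis ln_mult_pos ln_one)
    then show "ln (det L) - trace (L ** B) = - ln (det B) - real CARD('n)"
      using L dB by (simp add: matrix_inv_mult trace_I)
  qed
qed

text \<open>An elementary matrix \<open>E\<close> with a unit off the diagonal is handled by \<open>D E D = E\<^sup>-\<^sup>1\<close> for
  a diagonal matrix \<open>D\<close> of signs.\<close>

lemma multiplicative_eq_abs_det_power:
  fixes F :: "real^'n^'n::finite \<Rightarrow> real"
  assumes nonneg: "\<And>A. F A \<ge> 0"
    and mult: "\<And>A B. F (A ** B) = F A * F B"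
    and diag: "\<And>d. F (diag_matrix d) = \<bar>\<Prod>i\<in>UNIV. d i\<bar> ^ e"
    and e: "e > 0"
  shows "F A = \<bar>det A\<bar> ^ e"
proof (induction A rule: induct_matrix_elementary_alt)
  case (1 A B)
  then show ?case by (simp add: mult det_mul abs_mult power_mult_distrib)
next
  case (2 A i)
  \<comment> \<open>A matrix with a zero row is unchanged by the diagonal matrix with a zero in that
    place, and \<open>F\<close> vanishes on the latter because e > 0.\<close>
  let ?d = "\<lambda>j. if j = i then 0 else 1::real"
  have "A = diag_matrix ?d ** A"
    using 2 by (auto simp: vec_eq_iff row_def diag_matrix_def matrix_matrix_mult_def if_distrib[of "\<lambda>x. x * _"] cong: if_cong)
  then have "F A = F (diag_matrix ?d) * F A" using mult by metis
  moreover have "(\<Prod>j\<in>UNIV. ?d j) = 0" by (rule prod_zero) auto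
  ultimately have "F A = 0" using e by (simp only: diag) (simp add: power_0_left)
  moreover have "det A = 0" using det_zero_row(1)[OF 2] by simp
  ultimately show ?case using e by simp
next
  case (3 A)
  then have "A = diag_matrix (\<lambda>i. A $ i $ i)" by (auto simp: vec_eq_iff diag_matrix_def)
  then show ?case using diag det_diag_matrix by metis
next
  case (4 m n)
  let ?P = "(\<chi> i j. mat 1 $ i $ Transposition.transpose m n j) :: real^'n^'n"
  have "?P = (\<chi> i. mat 1 $ Transposition.transpose m n i)"
    by (auto simp: vec_eq_iff mat_def transpose_def Transposition.transpose_def)
  moreover have "?P ** A = (\<chi> i. A $ Transposition.transpose m n i)" for A :: "real^'n^'n"
  proof -
    have "(i = Transposition.transpose m n k) = (k = Transposition.transpose m n i)" for i k
      by (metis transpose_involutory)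
    then have "(\<Sum>k\<in>UNIV. if i = Transposition.transpose m n k then A $ k $ j else 0) =
        (\<Sum>k\<in>UNIV. if k = Transposition.transpose m n i then A $ k $ j else 0)" for i j
      by (intro sum.cong if_cong refl)
    then show ?thesis
      by (simp add: vec_eq_iff mat_def matrix_matrix_mult_def if_distrib[of "\<lambda>x. x * _"] cong: if_cong)
  qed
  ultimately have PP: "?P ** ?P = mat 1" by (simp add: vec_eq_iff)
  have F1: "F (mat 1) = 1" using diag[of "\<lambda>_. 1"] by (simp add: diag_matrix_1)
  \<comment> \<open>A transposition squares to the identity, so nonnegativity forces
    \<open>F\<close> to be 1 on it.\<close>
  have "F ?P * F ?P = 1" using PP mult F1 by metis
  then have "F ?P = 1" using nonneg[of ?P] by (simp add: square_eq_1_iff)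
  moreover have "det ?P * det ?P = 1" using PP by (metis det_mul det_I)
  then have "\<bar>det ?P\<bar> = 1" by (auto simp: square_eq_1_iff)
  ultimately show ?case by simp
next
  case (5 m n)
  let ?E = "(\<chi> i j. of_bool (i = m \<and> j = n \<or> i = j)) :: real^'n^'n"
  let ?s = "\<lambda>i. if i = m then - 1 else 1 :: real"
  let ?D = "diag_matrix ?s"
  have abss: "\<bar>\<Prod>j\<in>UNIV. ?s j\<bar> = 1" by (simp add: abs_prod)
  have DE: "?D ** A = (\<chi> i j. ?s i * A $ i $ j)" for A :: "real^'n^'n"
    by (simp add: vec_eq_iff diag_matrix_def matrix_matrix_mult_def if_distrib[of "\<lambda>x. x * _"] cong: if_cong)
  have ED: "A ** ?D = (\<chi> i j. ?s j * A $ i $ j)" for A :: "real^'n^'n"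
    by (simp add: vec_eq_iff diag_matrix_def matrix_matrix_mult_def if_distrib[of "\<lambda>x. _ * x"] mult.commute cong: if_cong)
  have EA: "?E ** A = (\<chi> i j. A $ i $ j + (if i = m then A $ n $ j else 0))" for A :: "real^'n^'n"
  proof -
    have "(\<Sum>k\<in>UNIV. of_bool (i = m \<and> k = n \<or> i = k) * A $ k $ j) =
      (\<Sum>k\<in>UNIV. (if k = i then A $ k $ j else 0) + (if k = n then (if i = m then A $ k $ j else 0) else 0))" for i j
      using 5 by (intro sum.cong) auto
    then show ?thesis by (simp add: vec_eq_iff matrix_matrix_mult_def sum.distrib)
  qed
  have "?E ** (?D ** ?E ** ?D) = mat 1"
    unfolding EA DE ED using 5 by (auto simp: vec_eq_iff mat_def)
  then have EE: "?E ** ?D ** ?E ** ?D = mat 1" by (simp add: matrix_mul_assoc)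
  have F1: "F (mat 1) = 1" using diag[of "\<lambda>_. 1"] by (simp add: diag_matrix_1)
  have FD: "F ?D = 1" by (simp only: diag abss power_one)
  have "F ?E * F ?D * F ?E * F ?D = 1" using EE mult F1 by metis
  then have "F ?E * F ?E = 1" unfolding FD by simp
  then have "F ?E = 1" using nonneg[of ?E] by (simp add: square_eq_1_iff)
  moreover have "det ?E * det ?D * det ?E * det ?D = 1"
    using arg_cong[OF EE, of det] by (simp only: det_mul det_I)
  then have "\<bar>det ?E\<bar> * \<bar>det ?D\<bar> * \<bar>det ?E\<bar> * \<bar>det ?D\<bar> = 1"
    by (simp only: abs_mult[symmetric] abs_one)
  then have "\<bar>det ?E\<bar> * \<bar>det ?E\<bar> = 1" unfolding det_diag_matrix abss by simp
  then have "\<bar>det ?E\<bar> = 1" by (auto simp: square_eq_1_iff)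
  ultimately show ?case by simp
qed

section \<open>Symmetric matrices as vectors over unordered pairs, and the Jacobian of a
  congruence\<close>

lemma Upair_swap: "Upair a b = Upair b a"
  by simp

text \<open>An unordered pair with distinct members comes from two ordered pairs and a diagonal one
  from a single ordered pair; adding the diagonal once more makes every fibre count twice. The
  doubled form avoids division and makes sense in every commutative monoid.\<close>

lemma sum_pairs_eq_sum_uprod:
  fixes f :: "'n::finite uprod \<Rightarrow> 'b::comm_monoid_add"
  shows "(\<Sum>a\<in>UNIV. \<Sum>b\<in>UNIV. f (Upair a b)) + (\<Sum>a\<in>UNIV. f (Upair a a)) = (\<Sum>u\<in>UNIV. f u) + (\<Sum>u\<in>UNIV. f u)"
proof -
  let ?D = "range (\<lambda>a::'n. Upair a a)"
  let ?g = "\<lambda>(a::'n, b). Upair a b"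
  have diag: "(\<Sum>a\<in>UNIV. f (Upair a a)) = (\<Sum>u\<in>?D. f u)"
    by (subst sum.reindex) (auto simp: inj_on_def)
  have fib: "(\<Sum>x\<in>{x\<in>UNIV. ?g x = u}. f (?g x)) = (if u \<in> ?D then f u else f u + f u)" for u
  proof (cases u)
    case (Upair a b)
    have "{x\<in>UNIV. ?g x = u} = {(a, b), (b, a)}" by (auto simp: Upair)
    moreover have "(\<Sum>x\<in>{(a, b), (b, a)}. f (?g x)) = (if a = b then f u else f u + f u)"
      by (cases "a = b") (auto simp: Upair Upair_swap)
    moreover have "u \<in> ?D \<longleftrightarrow> a = b" by (auto simp: Upair)
    ultimately show ?thesis by simp
  qed
  have "(\<Sum>a\<in>UNIV. \<Sum>b\<in>UNIV. f (Upair a b)) = (\<Sum>x\<in>UNIV. f (?g x))"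
    by (simp add: sum.cartesian_product split_def)
  also have "\<dots> = (\<Sum>u\<in>UNIV. \<Sum>x\<in>{x\<in>UNIV. ?g x = u}. f (?g x))"
    by (rule sum.group[symmetric]) auto
  also have "\<dots> = (\<Sum>u\<in>UNIV. if u \<in> ?D then f u else f u + f u)"
    by (simp only: fib)
  also have "\<dots> + (\<Sum>u\<in>?D. f u) = (\<Sum>u\<in>UNIV. (if u \<in> ?D then f u else f u + f u) + (if u \<in> ?D then f u else 0))"
    by (simp add: sum.distrib sum.If_cases)
  also have "\<dots> = (\<Sum>u\<in>UNIV. f u + f u)" by (intro sum.cong) auto
  finally show ?thesis by (simp add: diag sum.distrib)
qed

lemma card_uprod: "2 * CARD('n::finite uprod) = CARD('n) * (CARD('n) + 1)"
  using sum_pairs_eq_sum_uprod[of "\<lambda>_::'n uprod. 1::nat"] by simp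

definition sym_of :: "real^('p::finite uprod) \<Rightarrow> real^'p^'p" where
  "sym_of v = (\<chi> a b. v $ Upair a b)"

definition uprod_rep :: "'p uprod \<Rightarrow> 'p \<times> 'p" where
  "uprod_rep u = (SOME (a, b). u = Upair a b)"

text \<open>Entries are read at a chosen representative of each unordered pair, which makes the map
  total and measurable; the choice influences the result only for nonsymmetric matrices.\<close>

definition vec_of_sym :: "real^'p^'p \<Rightarrow> real^('p::finite uprod)" where
  "vec_of_sym A = (\<chi> u. A $ fst (uprod_rep u) $ snd (uprod_rep u))"

lemma sym_of_nth [simp]: "sym_of v $ a $ b = v $ Upair a b"
  by (simp add: sym_of_def)

lemma transpose_sym_of [simp]: "transpose (sym_of v) = sym_of v"
  by (simp add: transpose_def vec_eq_iff Upair_swap)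

lemma vec_of_sym_nth:
  assumes "transpose A = A"
  shows "vec_of_sym A $ Upair a b = A $ a $ b"
proof -
  have "A $ a $ b = A $ b $ a" using assms by (metis transpose_def vec_lambda_beta)
  moreover have "Upair a b = Upair (fst (uprod_rep (Upair a b))) (snd (uprod_rep (Upair a b)))"
    unfolding uprod_rep_def split_def by (rule someI[of _ "(a, b)"]) simp
  ultimately show ?thesis unfolding vec_of_sym_def by auto
qed

lemma sym_of_vec_of_sym: "transpose A = A \<Longrightarrow> sym_of (vec_of_sym A) = A"
  by (simp add: vec_eq_iff vec_of_sym_nth)

lemma vec_uprod_eqI:
  assumes "\<And>a b. v $ Upair a b = w $ Upair a b"
  shows "v = w"
  by (metis assms uprod_exhaust vec_eq_iff)

lemma sym_of_inject [simp]: "sym_of v = sym_of w \<longleftrightarrow> v = w"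
  by (metis sym_of_nth vec_uprod_eqI)

lemma vec_of_sym_sym_of [simp]: "vec_of_sym (sym_of v) = v"
  by (intro vec_uprod_eqI) (simp add: vec_of_sym_nth)

lemma sym_of_add: "sym_of (v + w) = sym_of v + sym_of w"
  by (simp add: vec_eq_iff)

lemma sym_of_scaleR: "sym_of (c *\<^sub>R v) = c *\<^sub>R sym_of v"
  by (simp add: vec_eq_iff)

lemma sym_of_diff: "sym_of (v - w) = sym_of v - sym_of w"
  by (simp add: vec_eq_iff)

lemma sym_of_zero [simp]: "sym_of 0 = 0"
  by (simp add: vec_eq_iff)

lemma sym_of_sum: "sym_of (\<Sum>i\<in>I. f i) = (\<Sum>i\<in>I. sym_of (f i))"
  by (simp add: vec_eq_iff)

definition sym_cong :: "real^'p^'p \<Rightarrow> real^('p uprod) \<Rightarrow> real^('p::finite uprod)" where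
  "sym_cong g v = vec_of_sym (g ** sym_of v ** transpose g)"

lemma sym_of_sym_cong: "sym_of (sym_cong g v) = g ** sym_of v ** transpose g"
  unfolding sym_cong_def by (intro sym_of_vec_of_sym transpose_congruence) simp

lemma matrix_add_rdistrib': "(A + B) ** C = A ** C + B ** (C::real^'n^'m)"
  by (simp add: matrix_matrix_mult_def vec_eq_iff sum.distrib algebra_simps)

lemma matrix_scaleR_right: "A ** (c *\<^sub>R B) = c *\<^sub>R (A ** (B::real^'n^'m))"
  by (simp add: matrix_matrix_mult_def vec_eq_iff sum_distrib_left mult_ac)

lemma matrix_scaleR_left: "(c *\<^sub>R A) ** B = c *\<^sub>R (A ** (B::real^'n^'m))"
  by (simp add: matrix_matrix_mult_def vec_eq_iff sum_distrib_left mult_ac)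

lemma linear_sym_cong: "linear (sym_cong g)"
proof (rule linearI)
  fix v w :: "real^'a uprod" and c :: real
  have "sym_of (sym_cong g (v + w)) = sym_of (sym_cong g v + sym_cong g w)"
    by (simp add: sym_of_sym_cong sym_of_add matrix_add_ldistrib matrix_add_rdistrib')
  then show "sym_cong g (v + w) = sym_cong g v + sym_cong g w" by simp
  have "sym_of (sym_cong g (c *\<^sub>R v)) = sym_of (c *\<^sub>R sym_cong g v)"
    by (simp add: sym_of_sym_cong sym_of_scaleR matrix_scaleR_right matrix_scaleR_left)
  then show "sym_cong g (c *\<^sub>R v) = c *\<^sub>R sym_cong g v" by simp
qed

lemma sym_cong_mult: "sym_cong (g ** h) v = sym_cong g (sym_cong h v)"
proof -
  have "sym_of (sym_cong (g ** h) v) = sym_of (sym_cong g (sym_cong h v))"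
    by (simp add: sym_of_sym_cong matrix_transpose_mul matrix_mul_assoc)
  then show ?thesis by simp
qed

lemma sym_cong_diag:
  "sym_cong (diag_matrix d) v $ Upair a b = d a * d b * v $ Upair a b"
proof -
  have "sym_of (sym_cong (diag_matrix d) v) $ a $ b = d a * d b * v $ Upair a b"
    by (simp add: sym_of_sym_cong matrix_matrix_mult_def diag_matrix_nth if_distrib[of "\<lambda>x. x * _"]
        if_distrib[of "\<lambda>x. _ * x"] cong: if_cong)
  then show ?thesis by simp
qed

lemma det_matrix_diag:
  fixes f :: "real^'m::finite \<Rightarrow> real^'m"
  assumes "\<And>v i. f v $ i = c i * v $ i"
  shows "det (matrix f) = (\<Prod>i\<in>UNIV. c i)"
proof -
  have "matrix f = diag_matrix c"
    by (auto simp: matrix_def vec_eq_iff assms diag_matrix_def axis_def)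
  then show ?thesis by simp
qed

lemma det_matrix_compose:
  fixes f g :: "real^'m::finite \<Rightarrow> real^'m"
  assumes "linear f" "linear g"
  shows "det (matrix (\<lambda>v. f (g v))) = det (matrix f) * det (matrix g)"
  using matrix_compose[OF assms(2,1)] by (simp add: comp_def det_mul)

text \<open>By multiplicativity only diagonal g have to be computed. There the entry at the pair {a,
  b} is scaled by \<open>d a * d b\<close>, and each \<open>d a\<close> occurs p + 1 times: once
  with each of the p - 1 other indices and twice on the diagonal.\<close>

lemma abs_det_sym_cong:
  fixes g :: "real^'p::finite^'p"
  shows "\<bar>det (matrix (sym_cong g))\<bar> = \<bar>det g\<bar> ^ (CARD('p) + 1)"
proof (rule multiplicative_eq_abs_det_power)
  fix A B :: "real^'p^'p"
  show "\<bar>det (matrix (sym_cong (A ** B)))\<bar> = \<bar>det (matrix (sym_cong A))\<bar> * \<bar>det (matrix (sym_cong B))\<bar>"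
    using det_matrix_compose[OF linear_sym_cong linear_sym_cong, of A B]
    by (simp add: sym_cong_mult[abs_def] abs_mult)
next
  fix d :: "'p \<Rightarrow> real"
  \<comment> \<open>Evaluation at the all-ones vector defines the scaling factor on unordered pairs
    without choosing representatives.\<close>
  define c where "c u = \<bar>sym_cong (diag_matrix d) 1 $ u\<bar>" for u
  have c: "c (Upair a b) = \<bar>d a\<bar> * \<bar>d b\<bar>" for a b by (simp add: c_def sym_cong_diag abs_mult)
  have "\<bar>det (matrix (sym_cong (diag_matrix d)))\<bar> = \<bar>\<Prod>u\<in>UNIV. sym_cong (diag_matrix d) 1 $ u\<bar>"
    by (subst det_matrix_diag[where c = "\<lambda>u. sym_cong (diag_matrix d) 1 $ u"])
      (metis sym_cong_diag uprod_exhaust one_index mult.right_neutral, simp)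
  also have "\<dots> = prod c UNIV" by (simp add: abs_prod c_def)
  finally have 1: "\<bar>det (matrix (sym_cong (diag_matrix d)))\<bar> = prod c UNIV" .
  show "\<bar>det (matrix (sym_cong (diag_matrix d)))\<bar> = \<bar>\<Prod>i\<in>UNIV. d i\<bar> ^ (CARD('p) + 1)"
  proof (cases "\<exists>i. d i = 0")
    case True
    then obtain i where "d i = 0" by auto
    then have "c (Upair i i) = 0" "d i = 0" by (auto simp: c)
    then have p: "prod c UNIV = 0" "prod d UNIV = 0" by (metis UNIV_I finite prod_zero)+
    show ?thesis unfolding 1 p by simp
  next
    case False
    then have pos: "\<bar>d i\<bar> > 0" for i by auto
    have cpos: "c u > 0" for u using pos by (cases u) (auto simp: c)
    \<comment> \<open>With all entries nonzero, logarithms turn the product over unordered pairs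
      into a sum to which the pair count applies.\<close>
    let ?s = "\<Sum>i\<in>UNIV. ln \<bar>d i\<bar>"
    have lnc: "ln (c (Upair a b)) = ln \<bar>d a\<bar> + ln \<bar>d b\<bar>" for a b
      using pos[of a] pos[of b] by (simp add: c ln_mult_pos)
    have "2 * ln (prod c UNIV) = 2 * (\<Sum>u\<in>UNIV. ln (c u))"
      using cpos by (subst ln_prod) (auto simp: less_le)
    also have "\<dots> = (\<Sum>a\<in>UNIV. \<Sum>b\<in>UNIV. ln (c (Upair a b))) + (\<Sum>a\<in>UNIV. ln (c (Upair a a)))"
      using sum_pairs_eq_sum_uprod[of "\<lambda>u. ln (c u)"] by simp
    also have "\<dots> = 2 * (real (CARD('p) + 1) * ?s)"
      by (simp add: lnc sum.distrib sum_distrib_left[symmetric] algebra_simps)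
    also have "?s = ln (\<Prod>i\<in>UNIV. \<bar>d i\<bar>)"
      using pos by (subst ln_prod) (auto simp: less_le)
    finally have "ln (prod c UNIV) = ln ((\<Prod>i\<in>UNIV. \<bar>d i\<bar>) ^ (CARD('p) + 1))"
      using pos by (simp add: ln_realpow prod_pos del: power_Suc)
    then have "prod c UNIV = (\<Prod>i\<in>UNIV. \<bar>d i\<bar>) ^ (CARD('p) + 1)"
      using cpos pos by (simp add: prod_pos)
    then show ?thesis by (simp add: 1 abs_prod)
  qed
qed auto

section \<open>Lebesgue measure on vectors and matrices\<close>

lemma borel_measurable_vec_nth [measurable (raw)]:
  fixes f :: "'a \<Rightarrow> 'b::euclidean_space^'n::finite"
  assumes "f \<in> borel_measurable M"
  shows "(\<lambda>x. f x $ i) \<in> borel_measurable M"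
proof -
  have "(\<lambda>v::'b^'n. v $ i) \<in> borel_measurable borel"
    by (intro borel_measurable_continuous_onI continuous_intros)
  from measurable_compose[OF assms this] show ?thesis .
qed

lemma borel_measurable_vec_lambda [measurable (raw)]:
  fixes f :: "'n::finite \<Rightarrow> 'a \<Rightarrow> 'b::euclidean_space"
  assumes "\<And>i. f i \<in> borel_measurable M"
  shows "(\<lambda>x. \<chi> i. f i x) \<in> borel_measurable M"
  unfolding borel_measurable_euclidean_space[where 'c = "'b^'n"]
  using assms by (auto simp: Basis_vec_def inner_axis)

lemma borel_measurable_transpose [measurable (raw)]:
  fixes f :: "'a \<Rightarrow> real^'n::finite^'m::finite"
  assumes [measurable]: "f \<in> borel_measurable M"
  shows "(\<lambda>x. transpose (f x)) \<in> borel_measurable M"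
  unfolding transpose_def by measurable

lemma borel_measurable_matrix_mult [measurable (raw)]:
  fixes f :: "'a \<Rightarrow> real^'n::finite^'m::finite" and g :: "'a \<Rightarrow> real^'k::finite^'n"
  assumes [measurable]: "f \<in> borel_measurable M" "g \<in> borel_measurable M"
  shows "(\<lambda>x. f x ** g x) \<in> borel_measurable M"
  unfolding matrix_matrix_mult_def by measurable

lemma borel_measurable_matrix_vector_mult [measurable (raw)]:
  fixes f :: "'a \<Rightarrow> real^'n::finite^'m::finite" and g :: "'a \<Rightarrow> real^'n"
  assumes [measurable]: "f \<in> borel_measurable M" "g \<in> borel_measurable M"
  shows "(\<lambda>x. f x *v g x) \<in> borel_measurable M"
  unfolding matrix_vector_mult_def by measurable

lemma borel_measurable_trace [measurable (raw)]:
  fixes f :: "'a \<Rightarrow> real^'n::finite^'n"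
  assumes [measurable]: "f \<in> borel_measurable M"
  shows "(\<lambda>x. trace (f x)) \<in> borel_measurable M"
  unfolding trace_def by measurable

lemma borel_measurable_det [measurable (raw)]:
  fixes f :: "'a \<Rightarrow> real^'n::finite^'n"
  assumes [measurable]: "f \<in> borel_measurable M"
  shows "(\<lambda>x. det (f x)) \<in> borel_measurable M"
  unfolding det_def by measurable

lemma borel_measurable_sym_of [measurable (raw)]:
  assumes [measurable]: "f \<in> borel_measurable M"
  shows "(\<lambda>x. sym_of (f x)) \<in> borel_measurable M"
  unfolding sym_of_def by measurable

lemma continuous_on_det [continuous_intros]:
  fixes f :: "'a::topological_space \<Rightarrow> real^'n::finite^'n"
  assumes "continuous_on S f"
  shows "continuous_on S (\<lambda>x. det (f x))"
  unfolding det_def by (intro continuous_intros assms)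

text \<open>A zero of a nonnegative quadratic form is a minimum, so the gradient
  \<open>2 * A v\<close> vanishes there.\<close>

lemma psd_kernel:
  fixes A :: "real^'n::finite^'n"
  assumes sym: "transpose A = A" and psd: "\<And>v. 0 \<le> v \<bullet> (A *v v)" and v0: "v \<bullet> (A *v v) = 0"
  shows "A *v v = 0"
proof -
  have "(- (w \<bullet> (A *v v))) = 0" for w
  proof (rule linear_le_quadratic_imp_zero)
    fix t
    have "0 \<le> (v + t *\<^sub>R w) \<bullet> (A *v (v + t *\<^sub>R w))" by (rule psd)
    also have "\<dots> = 2 * t * (w \<bullet> (A *v v)) + t\<^sup>2 * (w \<bullet> (A *v w))"
      using v0 matrix_self_adjoint[OF sym, of v w]
      by (simp add: matrix_vector_right_distrib matrix_vector_mult_scaleR inner_add_left inner_add_right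
          inner_commute power2_eq_square algebra_simps)
    finally show "2 * t * (- (w \<bullet> (A *v v))) \<le> t\<^sup>2 * (w \<bullet> (A *v w))" by simp
  qed
  from this[of "A *v v"] show ?thesis by simp
qed

text \<open>Strict positivity for uncountably many v is not visibly a Borel condition. This form
  splits it into closed conditions and the open condition that the determinant is nonzero.\<close>

lemma pos_def_matrix_iff:
  fixes A :: "real^'n::finite^'n"
  shows "pos_def_matrix A \<longleftrightarrow> transpose A = A \<and> (\<forall>v. 0 \<le> v \<bullet> (A *v v)) \<and> det A \<noteq> 0"
proof
  assume A: "pos_def_matrix A"
  then have "0 \<le> v \<bullet> (A *v v)" for v
    using pos_def_pos[OF A, of v] by (cases "v = 0") auto
  then show "transpose A = A \<and> (\<forall>v. 0 \<le> v \<bullet> (A *v v)) \<and> det A \<noteq> 0"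
    using pos_def_transpose[OF A] pos_def_det_pos[OF A] by auto
next
  assume A: "transpose A = A \<and> (\<forall>v. 0 \<le> v \<bullet> (A *v v)) \<and> det A \<noteq> 0"
  show "pos_def_matrix A"
    unfolding pos_def_matrix_def
  proof (intro conjI allI impI)
    fix v :: "real^'n" assume "v \<noteq> 0"
    show "0 < v \<bullet> (A *v v)"
    proof (rule ccontr)
      assume "\<not> 0 < v \<bullet> (A *v v)"
      with A have "v \<bullet> (A *v v) = 0" by (simp add: order.antisym)
      then have "A *v v = 0" using A by (intro psd_kernel) auto
      then show False using A \<open>v \<noteq> 0\<close> matrix_vector_mult_eq_0_iff[of A v] by simp
    qed
  qed (use A in auto)
qed

lemma sets_pos_def [measurable]: "{A :: real^'n::finite^'n. pos_def_matrix A} \<in> sets borel"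
proof -
  have "closed {A :: real^'n^'n. \<forall>i j. A $ i $ j = A $ j $ i}"
    by (intro closed_Collect_all closed_Collect_eq continuous_intros)
  moreover have "{A :: real^'n^'n. transpose A = A} = {A. \<forall>i j. A $ i $ j = A $ j $ i}"
    by (auto simp: transpose_def vec_eq_iff)
  moreover have "closed {A :: real^'n^'n. \<forall>v. 0 \<le> v \<bullet> (A *v v)}"
    unfolding matrix_vector_mult_def inner_vec_def
    by (intro closed_Collect_all closed_Collect_le continuous_intros)
  moreover have "open {A :: real^'n^'n. det A \<noteq> 0}"
    by (intro open_Collect_neq continuous_intros)
  ultimately have "{A :: real^'n^'n. transpose A = A} \<inter> {A. \<forall>v. 0 \<le> v \<bullet> (A *v v)} \<inter> {A. det A \<noteq> 0} \<in> sets borel"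
    by auto
  also have "{A :: real^'n^'n. transpose A = A} \<inter> {A. \<forall>v. 0 \<le> v \<bullet> (A *v v)} \<inter> {A. det A \<noteq> 0} = {A. pos_def_matrix A}"
    using pos_def_matrix_iff by auto
  finally show ?thesis .
qed

lemma pred_pos_def [measurable (raw)]:
  assumes "f \<in> borel_measurable M"
  shows "Measurable.pred M (\<lambda>x. pos_def_matrix (f x :: real^'n::finite^'n))"
  by (rule measurable_compose[OF assms]) (use sets_pos_def in \<open>simp add: pred_def\<close>)

section \<open>Lebesgue measure as a product measure, and linear changes of variables\<close>

lemma box_vec_eq: "box l u = {x :: real^'m::finite. \<forall>i. l $ i < x $ i \<and> x $ i < u $ i}"
  by (auto simp: mem_box Basis_vec_def inner_axis)

lemma prod_Basis_vec:
  fixes x :: "real^'m::finite"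
  shows "(\<Prod>b\<in>Basis. x \<bullet> b) = (\<Prod>i\<in>UNIV. x $ i)"
proof -
  have B: "(Basis :: (real^'m) set) = range (\<lambda>i. axis i 1)" by (auto simp: Basis_vec_def)
  have "inj (\<lambda>i::'m. axis i (1::real))" by (auto simp: inj_on_def axis_eq_axis)
  then show ?thesis unfolding B by (subst prod.reindex) (auto simp: inner_axis)
qed

lemma lborel_vec_eqI:
  fixes M :: "(real^'m::finite) measure"
  assumes "\<And>l u :: real^'m. (\<And>i. l $ i \<le> u $ i) \<Longrightarrow>
      emeasure M {x. \<forall>i. l $ i < x $ i \<and> x $ i < u $ i} = ennreal (\<Prod>i\<in>UNIV. u $ i - l $ i)"
    and "sets M = sets borel"
  shows "lborel = M"
proof (rule lborel_eqI)
  fix l u :: "real^'m" assume "\<And>b. b \<in> Basis \<Longrightarrow> l \<bullet> b \<le> u \<bullet> b"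
  then have "l $ i \<le> u $ i" for i by (metis axis_in_Basis_iff cart_eq_inner_axis Basis_real_def singletonI)
  then show "emeasure M (box l u) = (\<Prod>b\<in>Basis. (u - l) \<bullet> b)"
    using assms(1)[of l u] unfolding box_vec_eq prod_Basis_vec by simp
qed (rule assms)

lemma emeasure_lborel_vec_box:
  fixes l u :: "real^'m::finite"
  assumes "\<And>i. l $ i \<le> u $ i"
  shows "emeasure lborel {x. \<forall>i. l $ i < x $ i \<and> x $ i < u $ i} = ennreal (\<Prod>i\<in>UNIV. u $ i - l $ i)"
proof -
  have "l \<bullet> b \<le> u \<bullet> b" if "b \<in> Basis" for b
    using that assms by (auto simp: Basis_vec_def inner_axis)
  then have "emeasure lborel (box l u) = (\<Prod>b\<in>Basis. (u - l) \<bullet> b)" by (simp add: emeasure_lborel_box)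
  then show ?thesis unfolding box_vec_eq prod_Basis_vec by simp
qed

lemma product_sigma_finite_lborel: "product_sigma_finite (\<lambda>_. lborel :: 'b::euclidean_space measure)"
  by (simp add: product_sigma_finite_def sigma_finite_lborel)

lemma lborel_eq_distr_PiM:
  "(lborel :: (real^'k::finite) measure) = distr (PiM UNIV (\<lambda>_. lborel)) borel (\<lambda>f. \<chi> i. f i)"
proof (rule lborel_vec_eqI)
  interpret product_sigma_finite "\<lambda>_::'k. lborel :: real measure" by (rule product_sigma_finite_lborel)
  have [measurable]: "(\<lambda>f. \<chi> i. f i) \<in> borel_measurable (PiM UNIV (\<lambda>_::'k. lborel :: real measure))" by measurable
  fix l u :: "real^'k" assume lu: "\<And>i. l $ i \<le> u $ i"
  have "(\<lambda>f. \<chi> i. f i) -` {x. \<forall>i. l $ i < x $ i \<and> x $ i < u $ i} \<inter> space (PiM UNIV (\<lambda>_. lborel)) = (PiE UNIV (\<lambda>i. {l $ i <..< u $ i}))"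
    by (auto simp: space_PiM)
  moreover have "{x. \<forall>i. l $ i < x $ i \<and> x $ i < u $ i} \<in> sets borel"
    unfolding box_vec_eq[symmetric] by simp
  ultimately have "emeasure (distr (PiM UNIV (\<lambda>_. lborel)) borel (\<lambda>f. \<chi> i. f i)) {x. \<forall>i. l $ i < x $ i \<and> x $ i < u $ i}
     = emeasure (PiM UNIV (\<lambda>_. lborel)) (PiE UNIV (\<lambda>i. {l $ i <..< u $ i}))"
    by (simp add: emeasure_distr)
  also have "\<dots> = (\<Prod>i\<in>UNIV. emeasure lborel {l $ i <..< u $ i})" by (rule emeasure_PiM) auto
  also have "\<dots> = (\<Prod>i\<in>UNIV. ennreal (u $ i - l $ i))" using lu by (intro prod.cong) auto
  also have "\<dots> = ennreal (\<Prod>i\<in>UNIV. u $ i - l $ i)" using lu by (intro prod_ennreal) auto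
  finally show "emeasure (distr (PiM UNIV (\<lambda>_. lborel)) borel (\<lambda>f. \<chi> i. f i)) {x. \<forall>i. l $ i < x $ i \<and> x $ i < u $ i} = ennreal (\<Prod>i\<in>UNIV. u $ i - l $ i)" .
qed simp

text \<open>Identifies the product over the groups, on which independence yields a joint density,
  with the single vector space on which the dilations act.\<close>

lemma lborel_eq_distr_PiM_prod:
  "(lborel :: (real^('k::finite \<times> 'q::finite)) measure) =
    distr (PiM UNIV (\<lambda>_. lborel)) borel (\<lambda>f. \<chi> j. f (fst j) $ snd j)"
    (is "_ = distr ?P _ ?T")
proof (rule lborel_vec_eqI)
  interpret product_sigma_finite "\<lambda>_::'k. lborel :: (real^'q) measure" by (rule product_sigma_finite_lborel)
  have [measurable]: "?T \<in> borel_measurable ?P" by measurable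
  fix l u :: "real^('k \<times> 'q)" assume lu: "\<And>i. l $ i \<le> u $ i"
  let ?l = "\<lambda>i. \<chi> j. l $ (i, j)" and ?u = "\<lambda>i. \<chi> j. u $ (i, j)"
  have "?T -` {x. \<forall>i. l $ i < x $ i \<and> x $ i < u $ i} \<inter> space ?P
      = (PiE UNIV (\<lambda>i. {x. \<forall>j. ?l i $ j < x $ j \<and> x $ j < ?u i $ j}))"
    by (auto simp: space_PiM)
  moreover have "{x. \<forall>i. l $ i < x $ i \<and> x $ i < u $ i} \<in> sets borel"
    unfolding box_vec_eq[symmetric] by simp
  ultimately have "emeasure (distr ?P borel ?T) {x. \<forall>i. l $ i < x $ i \<and> x $ i < u $ i}
     = emeasure ?P (PiE UNIV (\<lambda>i. {x. \<forall>j. ?l i $ j < x $ j \<and> x $ j < ?u i $ j}))"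
    by (simp add: emeasure_distr)
  also have "\<dots> = (\<Prod>i\<in>UNIV. emeasure lborel {x. \<forall>j. ?l i $ j < x $ j \<and> x $ j < ?u i $ j})"
    by (rule emeasure_PiM) (auto simp: box_vec_eq[symmetric])
  also have "\<dots> = (\<Prod>i\<in>UNIV. ennreal (\<Prod>j\<in>UNIV. u $ (i, j) - l $ (i, j)))"
    using lu by (intro prod.cong refl, subst emeasure_lborel_vec_box) auto
  also have "\<dots> = ennreal (\<Prod>i\<in>UNIV. \<Prod>j\<in>UNIV. u $ (i, j) - l $ (i, j))"
    using lu by (intro prod_ennreal prod_nonneg) auto
  also have "(\<Prod>i\<in>UNIV. \<Prod>j\<in>UNIV. u $ (i, j) - l $ (i, j)) = (\<Prod>i\<in>UNIV. u $ i - l $ i)"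
    by (simp add: prod.cartesian_product)
  finally show "emeasure (distr ?P borel ?T) {x. \<forall>i. l $ i < x $ i \<and> x $ i < u $ i} = ennreal (\<Prod>i\<in>UNIV. u $ i - l $ i)" .
qed simp

lemma nn_integral_lborel_translation:
  fixes w :: "'a::euclidean_space"
  assumes "F \<in> borel_measurable borel"
  shows "(\<integral>\<^sup>+x. F (w + x) \<partial>lborel) = (\<integral>\<^sup>+x. F x \<partial>lborel)"
  using nn_integral_distr[of "(+) w" lborel borel F] assms by (simp add: lborel_distr_plus)

lemma borel_measurable_linear:
  fixes f :: "real^'m::finite \<Rightarrow> 'b::euclidean_space"
  assumes "linear f"
  shows "f \<in> borel_measurable borel"
  using assms by (intro borel_measurable_continuous_onI linear_continuous_on linear_conv_bounded_linear[THEN iffD1])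

text \<open>Both sides are compatible with products of matrices, so it suffices to treat elementary
  factors: a diagonal matrix rescales axes, a transposition permutes the sides of boxes, and a shear
  is a translation in one coordinate once the others are fixed.\<close>

lemma nn_integral_lborel_matrix:
  fixes A :: "real^'m::finite^'m"
  assumes d: "det A \<noteq> 0" and F: "F \<in> borel_measurable borel"
  shows "(\<integral>\<^sup>+x. F x \<partial>lborel) = ennreal \<bar>det A\<bar> * (\<integral>\<^sup>+x. F (A *v x) \<partial>lborel)"
  using assms
proof (induction A arbitrary: F rule: induct_matrix_elementary)
  case (1 A B)
  note [measurable] = 1(4)
  have dAB: "det A \<noteq> 0" "det B \<noteq> 0" using 1(3) by (auto simp: det_mul)
  have "(\<integral>\<^sup>+x. F x \<partial>lborel) = ennreal \<bar>det A\<bar> * (\<integral>\<^sup>+x. F (A *v x) \<partial>lborel)"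
    by (rule 1(1)[OF dAB(1)]) measurable
  also have "(\<integral>\<^sup>+x. F (A *v x) \<partial>lborel) = ennreal \<bar>det B\<bar> * (\<integral>\<^sup>+x. F (A *v (B *v x)) \<partial>lborel)"
    by (rule 1(2)[OF dAB(2)]) measurable
  finally show ?case
    by (simp add: det_mul abs_mult ennreal_mult' mult.assoc matrix_vector_mul_assoc)
next
  case (2 A i)
  then show ?case using det_zero_row(1)[OF 2(1)] by simp
next
  case (3 A)
  note [measurable] = 3(3)
  have dA: "det A = (\<Prod>i\<in>UNIV. A $ i $ i)" using 3(1) by (rule det_diagonal)
  have nz: "A $ i $ i \<noteq> 0" for i using 3(2) by (auto simp: dA)
  define c where "c j = (A *v j) \<bullet> j" for j
  have caxis: "c (axis i 1) = A $ i $ i" for i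
    by (simp add: c_def inner_axis matrix_vector_mul_component inner_axis')
  have T: "(\<Sum>j\<in>Basis. (c j * (x \<bullet> j)) *\<^sub>R j) = A *v x" for x
  proof (rule euclidean_eqI)
    fix b :: "real^'m" assume b: "b \<in> Basis"
    then obtain i where i: "b = axis i 1" by (auto simp: Basis_vec_def)
    have "(\<Sum>j\<in>Basis. (c j * (x \<bullet> j)) *\<^sub>R j) \<bullet> b = c b * (x \<bullet> b)"
      using b by simp
    also have "\<dots> = A $ i $ i * x $ i" by (simp add: i caxis inner_axis)
    also have "\<dots> = (\<Sum>j\<in>UNIV. if j = i then A $ i $ j * x $ j else 0)" by simp
    also have "\<dots> = (\<Sum>j\<in>UNIV. A $ i $ j * x $ j)" using 3(1) by (intro sum.cong) auto
    also have "\<dots> = (A *v x) \<bullet> b" by (simp add: i inner_axis matrix_vector_mult_def)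
    finally show "(\<Sum>j\<in>Basis. (c j * (x \<bullet> j)) *\<^sub>R j) \<bullet> b = (A *v x) \<bullet> b" .
  qed
  have B: "(Basis :: (real^'m) set) = range (\<lambda>i. axis i 1)" by (auto simp: Basis_vec_def)
  have "inj (\<lambda>i::'m. axis i (1::real))" by (auto simp: inj_on_def axis_eq_axis)
  then have pc: "(\<Prod>j\<in>Basis. \<bar>c j\<bar>) = \<bar>det A\<bar>"
    unfolding B by (subst prod.reindex) (auto simp: caxis dA abs_prod)
  have "lborel = density (distr lborel borel (\<lambda>x. 0 + (\<Sum>j\<in>Basis. (c j * (x \<bullet> j)) *\<^sub>R j))) (\<lambda>_. ennreal (\<Prod>j\<in>Basis. \<bar>c j\<bar>))"
    by (rule lborel_affine_euclidean) (use nz in \<open>auto simp: B caxis\<close>)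
  then have "(\<integral>\<^sup>+x. F x \<partial>lborel) = (\<integral>\<^sup>+x. F x \<partial>density (distr lborel borel ((*v) A)) (\<lambda>_. ennreal \<bar>det A\<bar>))"
    by (simp add: T pc)
  also have "\<dots> = ennreal \<bar>det A\<bar> * (\<integral>\<^sup>+x. F (A *v x) \<partial>lborel)"
    by (simp add: nn_integral_density nn_integral_distr nn_integral_cmult)
  finally show ?case .
next
  case (4 m n)
  let ?P = "(\<chi> i j. mat 1 $ i $ Transposition.transpose m n j) :: real^'m^'m"
  note [measurable] = 4(3)
  define s where "s = Transposition.transpose m n"
  have s: "s (s i) = i" "i = s k \<longleftrightarrow> s i = k" for i k by (auto simp: s_def)
  have P: "?P *v x = (\<chi> i. x $ s i)" for x
    by (simp add: vec_eq_iff matrix_vector_mult_def mat_def s_def[symmetric] s(2) if_distrib[of "\<lambda>x. x * _"] cong: if_cong)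
  have "?P ** ?P = mat 1"
    by (rule matrix_eq[THEN iffD2]) (simp add: matrix_vector_mul_assoc[symmetric] P s del: matrix_vector_mul_assoc)
  then have "det ?P * det ?P = 1" by (metis det_mul det_I)
  then have dP: "\<bar>det ?P\<bar> = 1" by (auto simp: square_eq_1_iff)
  have "lborel = distr lborel borel (\<lambda>x::real^'m. \<chi> i. x $ s i)"
  proof (rule lborel_vec_eqI)
    fix l u :: "real^'m" assume lu: "\<And>i. l $ i \<le> u $ i"
    have b: "{x. \<forall>i. l $ i < x $ i \<and> x $ i < u $ i} \<in> sets borel"
      unfolding box_vec_eq[symmetric] by simp
    have "(\<lambda>x::real^'m. \<chi> i. x $ s i) -` {x. \<forall>i. l $ i < x $ i \<and> x $ i < u $ i} =
        {x. \<forall>i. (\<chi> i. l $ s i) $ i < x $ i \<and> x $ i < (\<chi> i. u $ s i) $ i}"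
      by auto (metis s(1))+
    then have "emeasure (distr lborel borel (\<lambda>x::real^'m. \<chi> i. x $ s i)) {x. \<forall>i. l $ i < x $ i \<and> x $ i < u $ i}
      = ennreal (\<Prod>i\<in>UNIV. u $ s i - l $ s i)"
      using lu b emeasure_lborel_vec_box[of "\<chi> i. l $ s i" "\<chi> i. u $ s i"]
      by (simp add: emeasure_distr)
    also have "(\<Prod>i\<in>UNIV. u $ s i - l $ s i) = (\<Prod>i\<in>UNIV. u $ i - l $ i)"
      by (rule prod.reindex_bij_witness[of _ s s]) (auto simp: s)
    finally show "emeasure (distr lborel borel (\<lambda>x::real^'m. \<chi> i. x $ s i)) {x. \<forall>i. l $ i < x $ i \<and> x $ i < u $ i}
      = ennreal (\<Prod>i\<in>UNIV. u $ i - l $ i)" .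
  qed simp
  then have "(\<integral>\<^sup>+x. F x \<partial>lborel) = (\<integral>\<^sup>+x. F x \<partial>distr lborel borel (\<lambda>x::real^'m. \<chi> i. x $ s i))" by simp
  also have "\<dots> = (\<integral>\<^sup>+x. F (?P *v x) \<partial>lborel)" by (simp add: nn_integral_distr P)
  finally show ?case by (simp add: dP)
next
  case (5 m n c)
  let ?E = "(\<chi> i j. if i = m \<and> j = n then c else of_bool (i = j)) :: real^'m^'m"
  note [measurable] = 5(3)
  have EA: "?E *v x = (\<chi> i. x $ i + (if i = m then c * x $ n else 0))" for x
  proof -
    have "(\<Sum>k\<in>UNIV. (if i = m \<and> k = n then c else of_bool (i = k)) * x $ k) =
      (\<Sum>k\<in>UNIV. (if k = i then x $ k else 0) + (if k = n then (if i = m then c * x $ k else 0) else 0))" for i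
      using 5 by (intro sum.cong) auto
    then show ?thesis by (simp add: vec_eq_iff matrix_vector_mult_def sum.distrib)
  qed
  have "det ?E = 1"
  proof -
    have "?E = (\<chi> k. if k = m then row m (mat 1) + c *s row n (mat 1) else row k (mat 1))"
      using 5(1) by (auto simp: vec_eq_iff row_def mat_def)
    then show ?thesis using det_row_operation[OF 5(1), of "mat 1" c] by (simp add: det_I)
  qed
  moreover have "(\<integral>\<^sup>+x. F x \<partial>lborel) = (\<integral>\<^sup>+x. F (?E *v x) \<partial>lborel)"
  proof -
    interpret product_sigma_finite "\<lambda>_::'m. lborel :: real measure" by (rule product_sigma_finite_lborel)
    have U: "UNIV = insert m (UNIV - {m})" by auto
    \<comment> \<open>Coordinate m becomes the innermost variable. The shear shifts it by
      \<open>c * x n\<close>, an amount that is constant in the inner integral because m and n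
      differ.\<close>
    have int: "(\<integral>\<^sup>+x. H x \<partial>(lborel :: (real^'m) measure)) =
       (\<integral>\<^sup>+x. \<integral>\<^sup>+y. H (\<chi> i. (x(m := y)) i) \<partial>lborel \<partial>PiM (UNIV - {m}) (\<lambda>_. lborel))"
      if [measurable]: "H \<in> borel_measurable borel" for H
    proof -
      have "(\<integral>\<^sup>+x. H x \<partial>(lborel :: (real^'m) measure)) = (\<integral>\<^sup>+x. H (\<chi> i. x i) \<partial>PiM UNIV (\<lambda>_. lborel))"
        by (subst lborel_eq_distr_PiM, subst nn_integral_distr) measurable
      also have "\<dots> = (\<integral>\<^sup>+x. H (\<chi> i. x i) \<partial>PiM (insert m (UNIV - {m})) (\<lambda>_. lborel))"
        using U by simp
      also have "\<dots> = (\<integral>\<^sup>+x. \<integral>\<^sup>+y. H (\<chi> i. (x(m := y)) i) \<partial>lborel \<partial>PiM (UNIV - {m}) (\<lambda>_. lborel))"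
        by (subst product_nn_integral_insert) auto
      finally show ?thesis .
    qed
    have "(\<integral>\<^sup>+x. F (?E *v x) \<partial>lborel) =
      (\<integral>\<^sup>+x. \<integral>\<^sup>+y. F (\<chi> i. (x(m := c * x n + y)) i) \<partial>lborel \<partial>PiM (UNIV - {m}) (\<lambda>_. lborel))"
    proof (subst int)
      have "?E *v (\<chi> i. (x(m := y)) i) = (\<chi> i. (x(m := c * x n + y)) i)" for x y
        using 5(1) by (auto simp: EA vec_eq_iff)
      then show "(\<integral>\<^sup>+ x. \<integral>\<^sup>+ y. F (?E *v (\<chi> i. (x(m := y)) i)) \<partial>lborel \<partial>PiM (UNIV - {m}) (\<lambda>_. lborel)) =
        (\<integral>\<^sup>+ x. \<integral>\<^sup>+ y. F (\<chi> i. (x(m := c * x n + y)) i) \<partial>lborel \<partial>PiM (UNIV - {m}) (\<lambda>_. lborel))" by simp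
    qed measurable
    also have "\<dots> = (\<integral>\<^sup>+x. \<integral>\<^sup>+y. F (\<chi> i. (x(m := y)) i) \<partial>lborel \<partial>PiM (UNIV - {m}) (\<lambda>_. lborel))"
    proof (rule nn_integral_cong)
      fix x :: "'m \<Rightarrow> real"
      have "(\<lambda>y::real. (\<chi> i. (x(m := y)) i) :: real^'m) \<in> borel_measurable borel"
        by (intro borel_measurable_vec_lambda) (auto simp: fun_upd_def)
      then have "(\<lambda>y. F (\<chi> i. (x(m := y)) i)) \<in> borel_measurable borel" by measurable
      from nn_integral_lborel_translation[OF this, of "c * x n"]
      show "(\<integral>\<^sup>+ y. F (\<chi> i. (x(m := c * x n + y)) i) \<partial>lborel) = (\<integral>\<^sup>+ y. F (\<chi> i. (x(m := y)) i) \<partial>lborel)" .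
    qed
    also have "\<dots> = (\<integral>\<^sup>+x. F x \<partial>lborel)" by (rule int[symmetric]) measurable
    finally show ?thesis ..
  qed
  ultimately show ?case by simp
qed

lemma nn_integral_lborel_linear:
  fixes f :: "real^'m::finite \<Rightarrow> real^'m"
  assumes f: "linear f" and d: "det (matrix f) \<noteq> 0" and F: "F \<in> borel_measurable borel"
  shows "(\<integral>\<^sup>+x. F x \<partial>lborel) = ennreal \<bar>det (matrix f)\<bar> * (\<integral>\<^sup>+x. F (f x) \<partial>lborel)"
  using nn_integral_lborel_matrix[OF d F] f by simp

text \<open>Used to apply one map to all observations of a sample: a translation, with factor 1
  each, or a linear map g, with factor \<open>1 / |det g|\<close> each.\<close>

lemma nn_integral_PiM_componentwise:
  fixes N :: "'i \<Rightarrow> 'b measure"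
  assumes N: "product_sigma_finite N" and I: "finite I"
    and T: "\<And>i. T i \<in> measurable (N i) (N i)"
    and c: "\<And>i F. F \<in> borel_measurable (N i) \<Longrightarrow> (\<integral>\<^sup>+x. F (T i x) \<partial>N i) = c i * (\<integral>\<^sup>+x. F x \<partial>N i)"
    and F: "F \<in> borel_measurable (PiM I N)"
  shows "(\<integral>\<^sup>+z. F (\<lambda>i\<in>I. T i (z i)) \<partial>PiM I N) = (\<Prod>i\<in>I. c i) * (\<integral>\<^sup>+z. F z \<partial>PiM I N)"
  using I F
proof (induction I arbitrary: F rule: finite_induct)
  case empty
  interpret product_sigma_finite N by fact
  show ?case unfolding prod.empty mult_1 nn_integral_empty[OF zero_le] by (simp add: restrict_def)
next
  case (insert i I)
  interpret product_sigma_finite N by fact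
  note [measurable] = insert.prems T
  have [measurable]: "(\<lambda>z. \<lambda>j\<in>J. T j (z j)) \<in> measurable (PiM J N) (PiM J N)" for J
    by (intro measurable_restrict) measurable
  interpret NI: sigma_finite_measure "PiM I N" by (rule sigma_finite) fact
  interpret Ni: sigma_finite_measure "N i" by (rule sigma_finite_measures)
  have upd: "(\<lambda>j\<in>insert i I. T j ((x(i := y)) j)) = (\<lambda>j\<in>I. T j (x j))(i := T i y)" for x y
    using insert.hyps by auto
  have "(\<integral>\<^sup>+z. F (\<lambda>j\<in>insert i I. T j (z j)) \<partial>PiM (insert i I) N)
      = (\<integral>\<^sup>+x. \<integral>\<^sup>+y. F ((\<lambda>j\<in>I. T j (x j))(i := T i y)) \<partial>N i \<partial>PiM I N)"
    unfolding upd[symmetric]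
    by (rule product_nn_integral_insert) (use insert.hyps in simp_all)
  also have "\<dots> = (\<integral>\<^sup>+x. c i * (\<integral>\<^sup>+y. F ((\<lambda>j\<in>I. T j (x j))(i := y)) \<partial>N i) \<partial>PiM I N)"
  proof (intro nn_integral_cong)
    fix x assume "x \<in> space (PiM I N)"
    then have [measurable]: "(\<lambda>j\<in>I. T j (x j)) \<in> space (PiM I N)"
      by (auto simp: space_PiM PiE_iff intro!: measurable_space[OF T])
    have "(\<lambda>y. F ((\<lambda>j\<in>I. T j (x j))(i := y))) \<in> borel_measurable (N i)"
      by measurable
    from c[OF this] show "(\<integral>\<^sup>+y. F ((\<lambda>j\<in>I. T j (x j))(i := T i y)) \<partial>N i) =
      c i * (\<integral>\<^sup>+y. F ((\<lambda>j\<in>I. T j (x j))(i := y)) \<partial>N i)" .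
  qed
  also have "\<dots> = c i * (\<integral>\<^sup>+x. (\<integral>\<^sup>+y. F ((\<lambda>j\<in>I. T j (x j))(i := y)) \<partial>N i) \<partial>PiM I N)"
    by (intro nn_integral_cmult) measurable
  also have "(\<integral>\<^sup>+x. (\<integral>\<^sup>+y. F ((\<lambda>j\<in>I. T j (x j))(i := y)) \<partial>N i) \<partial>PiM I N)
     = (\<Prod>i\<in>I. c i) * (\<integral>\<^sup>+x. (\<integral>\<^sup>+y. F (x(i := y)) \<partial>N i) \<partial>PiM I N)"
    by (rule insert.IH) measurable
  also have "(\<integral>\<^sup>+x. (\<integral>\<^sup>+y. F (x(i := y)) \<partial>N i) \<partial>PiM I N) = (\<integral>\<^sup>+z. F z \<partial>PiM (insert i I) N)"
    using insert.hyps by (subst product_nn_integral_insert) auto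
  finally show ?case using insert.hyps by (simp add: mult.assoc)
qed

lemma PiM_density:
  fixes N :: "'i \<Rightarrow> 'b measure"
  assumes N: "product_sigma_finite N" and I: "finite I"
    and f [measurable]: "\<And>i. f i \<in> borel_measurable (N i)"
    and D: "product_sigma_finite (\<lambda>i. density (N i) (f i))"
  shows "PiM I (\<lambda>i. density (N i) (f i)) = density (PiM I N) (\<lambda>x. \<Prod>i\<in>I. f i (x i))"
proof -
  interpret N: product_sigma_finite N by fact
  interpret D: product_sigma_finite "\<lambda>i. density (N i) (f i)" by fact
  have s: "sets (PiM I (\<lambda>i. density (N i) (f i))) = sets (PiM I N)" by (intro sets_PiM_cong) auto
  show ?thesis
  proof (rule D.PiM_eqI[OF I, symmetric])
    show "sets (density (PiM I N) (\<lambda>x. \<Prod>i\<in>I. f i (x i))) = sets (PiM I (\<lambda>i. density (N i) (f i)))"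
      using s by simp
    fix A assume A: "\<And>i. i \<in> I \<Longrightarrow> A i \<in> sets (density (N i) (f i))"
    then have A': "i \<in> I \<Longrightarrow> A i \<in> sets (N i)" for i by simp
    have sA: "Pi\<^sub>E I A \<in> sets (PiM I N)" using A' I by (intro sets_PiM_I_finite) auto
    have "emeasure (density (PiM I N) (\<lambda>x. \<Prod>i\<in>I. f i (x i))) (Pi\<^sub>E I A)
      = (\<integral>\<^sup>+x. (\<Prod>i\<in>I. f i (x i)) * indicator (Pi\<^sub>E I A) x \<partial>PiM I N)"
      by (rule emeasure_density[OF _ sA]) measurable
    also have "\<dots> = (\<integral>\<^sup>+x. (\<Prod>i\<in>I. f i (x i) * indicator (A i) (x i)) \<partial>PiM I N)"
    proof (intro nn_integral_cong)
      fix x assume "x \<in> space (PiM I N)"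
      then have "x \<in> extensional I" by (auto simp: space_PiM PiE_iff)
      then show "(\<Prod>i\<in>I. f i (x i)) * indicator (Pi\<^sub>E I A) x = (\<Prod>i\<in>I. f i (x i) * indicator (A i) (x i))"
        using I by (cases "x \<in> Pi\<^sub>E I A") (auto simp: PiE_iff indicator_def)
    qed
    also have "\<dots> = (\<Prod>i\<in>I. \<integral>\<^sup>+x. f i x * indicator (A i) x \<partial>N i)"
      by (rule N.product_nn_integral_prod) (use I A' in auto)
    also have "\<dots> = (\<Prod>i\<in>I. emeasure (density (N i) (f i)) (A i))"
      using A' by (intro prod.cong) (auto simp: emeasure_density)
    finally show "emeasure (density (PiM I N) (\<lambda>x. \<Prod>i\<in>I. f i (x i))) (Pi\<^sub>E I A)
      = (\<Prod>i\<in>I. emeasure (density (N i) (f i)) (A i))" .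
  qed
qed

section \<open>Jacobians of left and right multiplication of matrices\<close>

definition mat_of :: "real^('p \<times> 'p) \<Rightarrow> real^'p^'p::finite" where
  "mat_of g = (\<chi> a b. g $ (a, b))"

definition vec_of_mat :: "real^'p^'p::finite \<Rightarrow> real^('p \<times> 'p)" where
  "vec_of_mat A = (\<chi> i. A $ fst i $ snd i)"

lemma mat_of_vec_of_mat [simp]: "mat_of (vec_of_mat A) = A"
  by (simp add: mat_of_def vec_of_mat_def vec_eq_iff)

lemma borel_measurable_mat_of [measurable (raw)]:
  fixes f :: "'a \<Rightarrow> real^('p \<times> 'p::finite)"
  assumes [measurable]: "f \<in> borel_measurable M"
  shows "(\<lambda>x. mat_of (f x)) \<in> borel_measurable M"
  unfolding mat_of_def by measurable

text \<open>Multiplication acts on each of the p columns separately, which explains the exponent;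
  the proof again computes diagonal h only and uses multiplicativity.\<close>

lemma abs_det_left_mult:
  fixes h :: "real^'p::finite^'p"
  defines "L \<equiv> (\<lambda>h::real^'p^'p. \<lambda>g. vec_of_mat (h ** mat_of g))"
  shows "linear (L h)" "\<bar>det (matrix (L h))\<bar> = \<bar>det h\<bar> ^ CARD('p)"
proof -
  have lin: "linear (L h)" for h
    by (rule linearI) (simp_all add: L_def vec_of_mat_def mat_of_def matrix_matrix_mult_def vec_eq_iff
        sum.distrib sum_distrib_left algebra_simps)
  show "linear (L h)" by (rule lin)
  show "\<bar>det (matrix (L h))\<bar> = \<bar>det h\<bar> ^ CARD('p)"
  proof (rule multiplicative_eq_abs_det_power)
    fix A B :: "real^'p^'p"
    have "L (A ** B) = (\<lambda>g. L A (L B g))" by (simp add: L_def matrix_mul_assoc fun_eq_iff)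
    then show "\<bar>det (matrix (L (A ** B)))\<bar> = \<bar>det (matrix (L A))\<bar> * \<bar>det (matrix (L B))\<bar>"
      using det_matrix_compose[OF lin lin, of A B] by (simp add: abs_mult)
  next
    fix d :: "'p \<Rightarrow> real"
    have e: "L (diag_matrix d) v $ i = d (fst i) * v $ i" for v i
      by (simp add: L_def vec_of_mat_def mat_of_def matrix_matrix_mult_def diag_matrix_nth
          if_distrib[of "\<lambda>x. x * _"] cong: if_cong)
    have "det (matrix (L (diag_matrix d))) = (\<Prod>i\<in>(UNIV :: ('p \<times> 'p) set). d (fst i))"
      by (rule det_matrix_diag) (rule e)
    also have "\<dots> = (\<Prod>a\<in>UNIV. \<Prod>b\<in>(UNIV::'p set). d a)"
      by (simp only: prod.cartesian_product UNIV_Times_UNIV split_def)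
    finally show "\<bar>det (matrix (L (diag_matrix d)))\<bar> = \<bar>\<Prod>i\<in>UNIV. d i\<bar> ^ CARD('p)"
      by (simp add: prod_power_distrib[symmetric] power_abs)
  qed auto
qed

lemma abs_det_right_mult:
  fixes h :: "real^'p::finite^'p"
  defines "R \<equiv> (\<lambda>h::real^'p^'p. \<lambda>g. vec_of_mat (mat_of g ** h))"
  shows "linear (R h)" "\<bar>det (matrix (R h))\<bar> = \<bar>det h\<bar> ^ CARD('p)"
proof -
  have lin: "linear (R h)" for h
    by (rule linearI) (simp_all add: R_def vec_of_mat_def mat_of_def matrix_matrix_mult_def vec_eq_iff
        sum.distrib sum_distrib_left algebra_simps)
  show "linear (R h)" by (rule lin)
  show "\<bar>det (matrix (R h))\<bar> = \<bar>det h\<bar> ^ CARD('p)"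
  proof (rule multiplicative_eq_abs_det_power)
    fix A B :: "real^'p^'p"
    have "R (A ** B) = (\<lambda>g. R B (R A g))" by (simp add: R_def matrix_mul_assoc fun_eq_iff)
    then show "\<bar>det (matrix (R (A ** B)))\<bar> = \<bar>det (matrix (R A))\<bar> * \<bar>det (matrix (R B))\<bar>"
      using det_matrix_compose[OF lin lin, of B A] by (simp add: abs_mult mult.commute)
  next
    fix d :: "'p \<Rightarrow> real"
    have e: "R (diag_matrix d) v $ i = d (snd i) * v $ i" for v i
      by (simp add: R_def vec_of_mat_def mat_of_def matrix_matrix_mult_def diag_matrix_nth
          if_distrib[of "\<lambda>x. _ * x"] mult.commute cong: if_cong)
    have "det (matrix (R (diag_matrix d))) = (\<Prod>i\<in>(UNIV :: ('p \<times> 'p) set). d (snd i))"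
      by (rule det_matrix_diag) (rule e)
    also have "\<dots> = (\<Prod>a\<in>(UNIV::'p set). \<Prod>b\<in>UNIV. d b)"
      by (simp only: prod.cartesian_product UNIV_Times_UNIV split_def)
    finally show "\<bar>det (matrix (R (diag_matrix d)))\<bar> = \<bar>\<Prod>i\<in>UNIV. d i\<bar> ^ CARD('p)"
      by (simp add: power_abs)
  qed auto
qed

section \<open>Invariant integrals on the cone of positive definite matrices\<close>

text \<open>Density of Haar measure on the general linear group; it vanishes at singular matrices
  because \<open>inverse 0 = 0\<close>.\<close>

definition haar :: "real^('p \<times> 'p::finite) \<Rightarrow> ennreal" where
  "haar g = ennreal (inverse (\<bar>det (mat_of g)\<bar> ^ CARD('p)))"

lemma borel_measurable_haar [measurable]: "haar \<in> borel_measurable borel"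
  unfolding haar_def by measurable

text \<open>The Jacobian \<open>|det h| ^ p\<close> cancels the factor by which the density changes.
  Left and right multiplication have the same Jacobian, so one density serves both sides; the
  exchange of integrals below uses both.\<close>

lemma haar_invariant:
  fixes h :: "real^'p::finite^'p"
  assumes h: "det h \<noteq> 0" and [measurable]: "F \<in> borel_measurable borel"
  shows haar_left: "(\<integral>\<^sup>+g. haar g * F (h ** mat_of g) \<partial>lborel) = (\<integral>\<^sup>+g. haar g * F (mat_of g) \<partial>lborel)"
    and haar_right: "(\<integral>\<^sup>+g. haar g * F (mat_of g ** h) \<partial>lborel) = (\<integral>\<^sup>+g. haar g * F (mat_of g) \<partial>lborel)"
proof -
  have eq: "\<bar>det h\<bar> ^ CARD('p) * inverse (\<bar>det h * x\<bar> ^ CARD('p)) = inverse (\<bar>x\<bar> ^ CARD('p))" for x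
    using h by (simp add: abs_mult power_mult_distrib)
  let ?L = "\<lambda>g. vec_of_mat (h ** mat_of g)" and ?R = "\<lambda>g. vec_of_mat (mat_of g ** h)"
  have hL: "ennreal (\<bar>det h\<bar> ^ CARD('p)) * haar (?L g) = haar g" for g
    by (simp add: haar_def ennreal_mult'[symmetric] det_mul eq)
  have hR: "ennreal (\<bar>det h\<bar> ^ CARD('p)) * haar (?R g) = haar g" for g
    by (simp add: haar_def ennreal_mult'[symmetric] det_mul eq mult.commute[of _ "det h"])
  have [measurable]: "?L \<in> borel_measurable borel" "?R \<in> borel_measurable borel"
    by (intro borel_measurable_linear abs_det_left_mult abs_det_right_mult)+
  have L: "det (matrix ?L) \<noteq> 0" "\<bar>det (matrix ?L)\<bar> = \<bar>det h\<bar> ^ CARD('p)" and R: "det (matrix ?R) \<noteq> 0" "\<bar>det (matrix ?R)\<bar> = \<bar>det h\<bar> ^ CARD('p)"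
    using abs_det_left_mult(2)[of h] abs_det_right_mult(2)[of h] h by auto
  have "(\<integral>\<^sup>+g. haar g * F (mat_of g) \<partial>lborel) = ennreal (\<bar>det h\<bar> ^ CARD('p)) * (\<integral>\<^sup>+g. haar (?L g) * F (mat_of (?L g)) \<partial>lborel)"
    unfolding L(2)[symmetric] by (rule nn_integral_lborel_linear[OF abs_det_left_mult(1) L(1)]) measurable
  also have "\<dots> = (\<integral>\<^sup>+g. (ennreal (\<bar>det h\<bar> ^ CARD('p)) * haar (?L g)) * F (h ** mat_of g) \<partial>lborel)"
    by (subst nn_integral_cmult[symmetric]) (auto simp: mult.assoc)
  finally show "(\<integral>\<^sup>+g. haar g * F (h ** mat_of g) \<partial>lborel) = (\<integral>\<^sup>+g. haar g * F (mat_of g) \<partial>lborel)"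
    by (simp add: hL)
  have "(\<integral>\<^sup>+g. haar g * F (mat_of g) \<partial>lborel) = ennreal (\<bar>det h\<bar> ^ CARD('p)) * (\<integral>\<^sup>+g. haar (?R g) * F (mat_of (?R g)) \<partial>lborel)"
    unfolding R(2)[symmetric] by (rule nn_integral_lborel_linear[OF abs_det_right_mult(1) R(1)]) measurable
  also have "\<dots> = (\<integral>\<^sup>+g. (ennreal (\<bar>det h\<bar> ^ CARD('p)) * haar (?R g)) * F (mat_of g ** h) \<partial>lborel)"
    by (subst nn_integral_cmult[symmetric]) (auto simp: mult.assoc)
  finally show "(\<integral>\<^sup>+g. haar g * F (mat_of g ** h) \<partial>lborel) = (\<integral>\<^sup>+g. haar g * F (mat_of g) \<partial>lborel)"
    by (simp add: hR)
qed

text \<open>Cramer's rule for the inverse, which is visibly a rational function of the entries.\<close>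

definition cramer_inv :: "real^'n^'n::finite \<Rightarrow> real^'n^'n" where
  "cramer_inv A = (\<chi> i j. det (\<chi> k l. if l = i then (if k = j then 1 else 0) else A $ k $ l) / det A)"

lemma cramer_inv_eq:
  assumes "det A \<noteq> 0"
  shows "cramer_inv A = matrix_inv A"
proof -
  have "matrix_inv A $ i $ j = cramer_inv A $ i $ j" for i j
  proof -
    have "A *v (matrix_inv A *v axis j 1) = axis j 1"
      by (simp add: matrix_vector_mul_assoc matrix_inv_mult assms)
    then have "matrix_inv A *v axis j 1 = (\<chi> k. det (\<chi> i l. if l = k then axis j 1 $ i else A $ i $ l) / det A)"
      using cramer[OF assms] by simp
    then have "(matrix_inv A *v axis j 1) $ i = cramer_inv A $ i $ j"
      by (simp add: cramer_inv_def axis_def cong: if_cong)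
    then show ?thesis by (simp add: matrix_vector_mult_def axis_def if_distrib[of "\<lambda>x. _ * x"] cong: if_cong)
  qed
  then show ?thesis by (simp add: vec_eq_iff)
qed

lemma borel_measurable_cramer_inv [measurable (raw)]:
  fixes f :: "'a \<Rightarrow> real^'n::finite^'n"
  assumes [measurable]: "f \<in> borel_measurable M"
  shows "(\<lambda>x. cramer_inv (f x)) \<in> borel_measurable M"
  unfolding cramer_inv_def by measurable

lemma matrix_inv_mul:
  fixes A B :: "real^'n::finite^'n"
  assumes "det A \<noteq> 0" "det B \<noteq> 0"
  shows "matrix_inv (A ** B) = matrix_inv B ** matrix_inv A"
proof (rule matrix_inv_unique)
  have "A ** B ** (matrix_inv B ** matrix_inv A) = A ** (B ** matrix_inv B) ** matrix_inv A"
    by (simp only: matrix_mul_assoc)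
  also have "\<dots> = mat 1" using assms by (simp add: matrix_inv_mult)
  finally show "A ** B ** (matrix_inv B ** matrix_inv A) = mat 1" .
qed

lemma det_matrix_inv:
  fixes A :: "real^'n::finite^'n"
  assumes "det A \<noteq> 0"
  shows "det (matrix_inv A) = inverse (det A)"
  using arg_cong[OF matrix_inv_mult(1)[OF assms], of det] assms
  by (simp add: det_mul field_simps)

abbreviation cong_mat :: "real^'n::finite^'n \<Rightarrow> real^'n^'n \<Rightarrow> real^'n^'n" where
  "cong_mat g A \<equiv> g ** A ** transpose g"

lemma cong_mat_mult: "cong_mat (g ** h) A = cong_mat g (cong_mat h A)"
  by (simp add: matrix_transpose_mul matrix_mul_assoc)

text \<open>The general linear group acts transitively on the positive definite matrices, so its
  invariant measures are unique up to a factor: integrate \<open>f x * h (g x)\<close> over \<open>x\<close> and \<open>g\<close>.\<close>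

lemma invariant_integral_exchange:
  fixes X :: "'z \<Rightarrow> real^'p::finite^'p" and w :: "'z \<Rightarrow> ennreal"
  assumes N: "sigma_finite_measure N"
    and X [measurable]: "X \<in> borel_measurable N" and w [measurable]: "w \<in> borel_measurable N"
    and f [measurable]: "f \<in> borel_measurable borel" and h [measurable]: "h \<in> borel_measurable borel"
    and inv: "\<And>g F. det g \<noteq> 0 \<Longrightarrow> F \<in> borel_measurable borel \<Longrightarrow>
        (\<integral>\<^sup>+z. w z * F (cong_mat g (X z)) \<partial>N) = (\<integral>\<^sup>+z. w z * F (X z) \<partial>N)"
    and pd: "\<And>z. w z \<noteq> 0 \<Longrightarrow> pos_def_matrix (X z)"
  shows "(\<integral>\<^sup>+z. w z * f (X z) \<partial>N) * (\<integral>\<^sup>+g. haar g * h (cong_mat (mat_of g) (mat 1)) \<partial>lborel)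
     = (\<integral>\<^sup>+z. w z * h (X z) \<partial>N) * (\<integral>\<^sup>+g. haar g * f (cong_mat (cramer_inv (mat_of g)) (mat 1)) \<partial>lborel)"
    (is "_ * ?kh = _ * ?kf")
proof -
  interpret N: sigma_finite_measure N by fact
  interpret P: pair_sigma_finite N "lborel :: (real^('p \<times> 'p)) measure"
    by (intro pair_sigma_finite.intro N sigma_finite_lborel)
  \<comment> \<open>The integral over g does not depend on z: with
    \<open>X z = S ** transpose S\<close>, right invariance absorbs S. This is where transitivity of
    the action enters.\<close>
  have kh: "w z * ?kh = w z * (\<integral>\<^sup>+g. haar g * h (cong_mat (mat_of g) (X z)) \<partial>lborel)" for z
  proof (cases "w z = 0")
    case False
    from pos_def_factorization[OF pd[OF this]] obtain S where S: "X z = S ** transpose S" "det S \<noteq> 0" .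
    have "(\<integral>\<^sup>+g. haar g * h (cong_mat (mat_of g ** S) (mat 1)) \<partial>lborel) = ?kh"
      by (rule haar_right[OF S(2), where F = "\<lambda>A. h (cong_mat A (mat 1))"]) measurable
    then show ?thesis by (simp only: cong_mat_mult[of _ S] S(1)) simp
  qed simp
  \<comment> \<open>Inversion turns the factor S on the right into its inverse on the left, so here
    left invariance is used. Singular g have weight zero, which lets \<open>cramer_inv\<close> stand
    for the inverse.\<close>
  have kf: "w z * ?kf = w z * (\<integral>\<^sup>+g. haar g * f (cong_mat (cramer_inv (mat_of g)) (X z)) \<partial>lborel)" for z
  proof (cases "w z = 0")
    case False
    from pos_def_factorization[OF pd[OF this]] obtain S where S: "X z = S ** transpose S" "det S \<noteq> 0" .
    have d: "det (matrix_inv S) \<noteq> 0" using S by (simp add: det_matrix_inv)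
    have "(\<integral>\<^sup>+g. haar g * f (cong_mat (cramer_inv (mat_of g)) (X z)) \<partial>lborel)
       = (\<integral>\<^sup>+g. haar g * f (cong_mat (cramer_inv (matrix_inv S ** mat_of g)) (mat 1)) \<partial>lborel)"
    proof (rule nn_integral_cong)
      fix g :: "real^('p \<times> 'p)"
      show "haar g * f (cong_mat (cramer_inv (mat_of g)) (X z)) =
        haar g * f (cong_mat (cramer_inv (matrix_inv S ** mat_of g)) (mat 1))"
      proof (cases "det (mat_of g) = 0")
        case True
        then show ?thesis by (simp add: haar_def power_0_left)
      next
        case False
        have "matrix_inv (matrix_inv S) = S"
          by (rule matrix_inv_unique) (simp add: matrix_inv_mult S)
        then have "cramer_inv (matrix_inv S ** mat_of g) = cramer_inv (mat_of g) ** S"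
          using False d by (simp add: cramer_inv_eq det_mul matrix_inv_mul)
        then show ?thesis by (simp only: cong_mat_mult[of _ S] S(1)) simp
      qed
    qed
    also have "\<dots> = ?kf"
      by (rule haar_left[OF d, where F = "\<lambda>A. f (cong_mat (cramer_inv A) (mat 1))"]) measurable
    finally show ?thesis by simp
  qed simp
  have "(\<integral>\<^sup>+z. w z * f (X z) \<partial>N) * ?kh = (\<integral>\<^sup>+z. f (X z) * (w z * ?kh) \<partial>N)"
    by (subst nn_integral_multc[symmetric]) (auto simp: mult_ac)
  also have "\<dots> = (\<integral>\<^sup>+z. \<integral>\<^sup>+g. f (X z) * w z * (haar g * h (cong_mat (mat_of g) (X z))) \<partial>lborel \<partial>N)"
    unfolding kh by (subst nn_integral_cmult) (auto simp: mult_ac)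
  also have "\<dots> = (\<integral>\<^sup>+g. \<integral>\<^sup>+z. f (X z) * w z * (haar g * h (cong_mat (mat_of g) (X z))) \<partial>N \<partial>lborel)"
    by (rule P.Fubini'[symmetric]) measurable
  also have "\<dots> = (\<integral>\<^sup>+g. \<integral>\<^sup>+z. h (X z) * w z * (haar g * f (cong_mat (cramer_inv (mat_of g)) (X z))) \<partial>N \<partial>lborel)"
  proof (rule nn_integral_cong)
    fix g :: "real^('p \<times> 'p)"
    show "(\<integral>\<^sup>+z. f (X z) * w z * (haar g * h (cong_mat (mat_of g) (X z))) \<partial>N)
        = (\<integral>\<^sup>+z. h (X z) * w z * (haar g * f (cong_mat (cramer_inv (mat_of g)) (X z))) \<partial>N)"
    proof (cases "det (mat_of g) = 0")
      case True
      then show ?thesis by (simp add: haar_def power_0_left)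
    next
      case False
      \<comment> \<open>The substitution Y = g X g^T as a test function: its value at the
        transformed matrix is f(X) h(g X g^T), and invariance replaces this by f(g^-1 X g^-T)
        h(X).\<close>
      let ?F = "\<lambda>Y. haar g * (f (cong_mat (cramer_inv (mat_of g)) Y) * h Y)"
      have inv1: "cong_mat (cramer_inv (mat_of g)) (cong_mat (mat_of g) Y) = Y" for Y
        unfolding cong_mat_mult[symmetric] by (simp add: cramer_inv_eq False matrix_inv_mult)
      have "(\<integral>\<^sup>+z. w z * ?F (cong_mat (mat_of g) (X z)) \<partial>N) = (\<integral>\<^sup>+z. w z * ?F (X z) \<partial>N)"
        by (rule inv[OF False]) measurable
      then show ?thesis by (simp only: inv1 mult_ac)
    qed
  qed
  also have "\<dots> = (\<integral>\<^sup>+z. \<integral>\<^sup>+g. h (X z) * w z * (haar g * f (cong_mat (cramer_inv (mat_of g)) (X z))) \<partial>lborel \<partial>N)"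
    by (rule P.Fubini') measurable
  also have "\<dots> = (\<integral>\<^sup>+z. h (X z) * (w z * ?kf) \<partial>N)"
    unfolding kf by (subst nn_integral_cmult) (auto simp: mult_ac)
  also have "\<dots> = (\<integral>\<^sup>+z. w z * h (X z) \<partial>N) * ?kf"
    by (subst nn_integral_multc[symmetric]) (auto simp: mult_ac)
  finally show ?thesis .
qed

section \<open>Scatter matrices\<close>

definition outer :: "real^'p \<Rightarrow> real^'p^'p" where
  "outer x = (\<chi> a b. x $ a * x $ b)"

lemma outer_mult_vec: "outer x *v v = (x \<bullet> v) *\<^sub>R x"
  by (simp add: outer_def matrix_vector_mult_def vec_eq_iff inner_vec_def sum_distrib_left mult_ac)

lemma gram_eq_sum_outer: "gram m y = (\<Sum>j<m. outer (y j))"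
  by (simp add: gram_def outer_def vec_eq_iff)

lemma transpose_gram [simp]: "transpose (gram m y) = gram m y"
  by (simp add: gram_def transpose_def vec_eq_iff mult.commute)

lemma sum_matrix_vector_mult: "(\<Sum>i\<in>I. A i) *v v = (\<Sum>i\<in>I. A i *v (v::real^'n))"
  by (induction I rule: infinite_finite_induct) (auto simp: matrix_vector_mult_add_rdistrib)

lemma gram_quadratic_form: "v \<bullet> (gram m y *v v) = (\<Sum>j<m. (y j \<bullet> v)\<^sup>2)"
  by (simp add: gram_eq_sum_outer sum_matrix_vector_mult outer_mult_vec inner_sum_right
      power2_eq_square inner_commute)

lemma gram_linear: "gram m (\<lambda>j. g *v y j) = cong_mat g (gram m y)"
proof -
  have o: "outer (g *v x) = cong_mat g (outer x)" for x
    by (simp add: outer_def matrix_matrix_mult_def matrix_vector_mult_def transpose_def vec_eq_iff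
        sum_product sum_distrib_left sum_distrib_right mult_ac)
  have "cong_mat g (\<Sum>j\<in>J. outer (y j)) = (\<Sum>j\<in>J. cong_mat g (outer (y j)))" for J
    by (induction J rule: infinite_finite_induct) (auto simp: matrix_add_ldistrib matrix_add_rdistrib' )
  then show ?thesis by (simp add: gram_eq_sum_outer o)
qed

lemma borel_measurable_outer [measurable (raw)]:
  fixes f :: "'a \<Rightarrow> real^'n::finite"
  assumes [measurable]: "f \<in> borel_measurable M"
  shows "(\<lambda>x. outer (f x)) \<in> borel_measurable M"
  unfolding outer_def by measurable

section \<open>Almost sure nonsingularity of a sum of random rank-one matrices\<close>

lemma psd_add_sum_outer_kernel:
  fixes Q :: "real^'n::finite^'n"
  assumes sym: "transpose Q = Q" and psd: "\<And>v. 0 \<le> v \<bullet> (Q *v v)" and I: "finite I"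
  shows "(Q + (\<Sum>i\<in>I. outer (z i))) *v v = 0 \<longleftrightarrow> Q *v v = 0 \<and> (\<forall>i\<in>I. z i \<bullet> v = 0)"
proof
  assume "(Q + (\<Sum>i\<in>I. outer (z i))) *v v = 0"
  then have "v \<bullet> ((Q + (\<Sum>i\<in>I. outer (z i))) *v v) = 0" by simp
  then have e: "v \<bullet> (Q *v v) + (\<Sum>i\<in>I. (z i \<bullet> v)\<^sup>2) = 0"
    by (simp add: matrix_vector_mult_add_rdistrib inner_add_right sum_matrix_vector_mult
        outer_mult_vec inner_sum_right power2_eq_square inner_commute)
  moreover have "0 \<le> (\<Sum>i\<in>I. (z i \<bullet> v)\<^sup>2)" by (intro sum_nonneg) auto
  ultimately have "v \<bullet> (Q *v v) = 0" "(\<Sum>i\<in>I. (z i \<bullet> v)\<^sup>2) = 0" using psd[of v] by linarith+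
  then show "Q *v v = 0 \<and> (\<forall>i\<in>I. z i \<bullet> v = 0)"
    using psd_kernel[OF sym psd] I by (auto simp: sum_nonneg_eq_0_iff)
qed (simp add: matrix_vector_mult_add_rdistrib sum_matrix_vector_mult outer_mult_vec)

lemma det_nz_iff_kernel:
  fixes A :: "real^'n::finite^'n"
  shows "det A \<noteq> 0 \<longleftrightarrow> (\<forall>v. A *v v = 0 \<longrightarrow> v = 0)"
  by (metis invertible_det_nz invertible_left_inverse matrix_left_invertible_ker)

text \<open>Each generic rank-one summand lowers the dimension of the kernel by at least one until
  it is zero. The initial matrix Q is arbitrary so that the induction can absorb a summand into
  it.\<close>

lemma AE_det_add_sum_outer:
  fixes Q :: "real^'n::finite^'n"
  assumes "finite I" "transpose Q = Q" "\<And>v. 0 \<le> v \<bullet> (Q *v v)" "dim {v. Q *v v = 0} \<le> card I"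
  shows "AE z in PiM I (\<lambda>_. lborel). det (Q + (\<Sum>i\<in>I. outer (z i))) \<noteq> 0"
  using assms
proof (induction I arbitrary: Q rule: finite_induct)
  case empty
  have "{v. Q *v v = 0} \<subseteq> {0}" using empty(3) by (simp add: dim_eq_0)
  then have "det Q \<noteq> 0" by (auto simp: det_nz_iff_kernel)
  then show ?case by simp
next
  case (insert i I)
  interpret product_sigma_finite "\<lambda>_. lborel :: (real^'n) measure" by (rule product_sigma_finite_lborel)
  let ?P = "\<lambda>J. PiM J (\<lambda>_. lborel :: (real^'n) measure)"
  let ?bad = "\<lambda>z. if det (Q + (\<Sum>j\<in>insert i I. outer (z j))) = 0 then 1 else 0 :: ennreal"
  have [measurable]: "(\<lambda>z. outer (z j)) \<in> borel_measurable (?P (insert i I))" if "j \<in> insert i I" for j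
    using that by measurable
  have m [measurable]: "(\<lambda>z. det (Q + (\<Sum>j\<in>insert i I. outer (z j)))) \<in> borel_measurable (?P (insert i I))"
    by (intro borel_measurable_det borel_measurable_add borel_measurable_const borel_measurable_sum) measurable
  have inner: "AE y in lborel. (\<integral>\<^sup>+x. ?bad (x(i := y)) \<partial>?P I) = 0"
  proof -
    have upd: "Q + (\<Sum>j\<in>insert i I. outer ((x(i := y)) j)) = (Q + outer y) + (\<Sum>j\<in>I. outer (x j))" for x y
    proof -
      have "(\<Sum>j\<in>I. outer ((x(i := y)) j)) = (\<Sum>j\<in>I. outer (x j))"
        using insert.hyps by (intro sum.cong) auto
      then show ?thesis using insert.hyps by simp
    qed
    have psd': "0 \<le> v \<bullet> ((Q + outer y) *v v)" for v y
      using insert.prems(2)[of v] by (simp add: matrix_vector_mult_add_rdistrib inner_add_right outer_mult_vec inner_commute)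
    have sym': "transpose (Q + outer y) = Q + outer y" for y
      using insert.prems(1) by (simp add: transpose_def vec_eq_iff outer_def)
    have ker': "(Q + outer y) *v v = 0 \<longleftrightarrow> Q *v v = 0 \<and> y \<bullet> v = 0" for v y
      using psd_add_sum_outer_kernel[of Q "{i}" "\<lambda>_. y" v] insert.prems by simp
    have sub: "subspace {v. (Q::real^'n^'n) *v v = 0}" for Q
      by (auto simp: subspace_def matrix_vector_right_distrib matrix_vector_mult_scaleR)
    have *: "(\<integral>\<^sup>+x. ?bad (x(i := y)) \<partial>?P I) = 0" if d: "dim {v. (Q + outer y) *v v = 0} \<le> card I" for y
    proof -
      have "AE x in ?P I. det ((Q + outer y) + (\<Sum>j\<in>I. outer (x j))) \<noteq> 0"
        by (rule insert.IH[OF sym' psd' d])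
      then show ?thesis unfolding upd
        by (subst nn_integral_cong_AE[where v = "\<lambda>_. 0"]) auto
    qed
    show ?thesis
    proof (cases "\<exists>k. k \<noteq> 0 \<and> Q *v k = 0")
      case True
      then obtain k where k: "k \<noteq> 0" "Q *v k = 0" by auto
      \<comment> \<open>Almost every y avoids the hyperplane orthogonal to k, and then k drops out
        of the kernel. In the other case the kernel is trivial and stays so for every y.\<close>
      have "negligible {y. k \<bullet> y = 0}" using k by (intro negligible_hyperplane) auto
      then have "{y. k \<bullet> y = 0} \<in> null_sets lebesgue" by (simp add: negligible_iff_null_sets)
      then have "{y. k \<bullet> y = 0} \<in> null_sets lborel"
        by (subst (asm) null_sets_completion_iff) (auto intro!: borel_closed closed_hyperplane)
      then have "AE y in lborel. y \<notin> {y. k \<bullet> y = 0}" by (rule AE_not_in)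
      then show ?thesis
      proof eventually_elim
        case (elim y)
        have "{v. (Q + outer y) *v v = 0} \<subset> {v. Q *v v = 0}"
          using k elim by (auto simp: ker' inner_commute)
        then have "dim {v. (Q + outer y) *v v = 0} < dim {v. Q *v v = 0}"
          by (metis sub subspace_dim_equal less_le_not_le linorder_not_le order.strict_iff_order psubset_imp_subset)
        then show ?case using insert.prems(3) insert.hyps by (intro *) simp
      qed
    next
      case False
      have "dim {v. (Q + outer y) *v v = 0} \<le> card I" for y
      proof -
        have "{v. (Q + outer y) *v v = 0} \<subseteq> {0}" using False by (auto simp: ker')
        then show ?thesis by (metis dim_eq_0 zero_le)
      qed
      then show ?thesis using * by simp
    qed
  qed
  have "(\<integral>\<^sup>+z. ?bad z \<partial>?P (insert i I)) = (\<integral>\<^sup>+y. \<integral>\<^sup>+x. ?bad (x(i := y)) \<partial>?P I \<partial>lborel)"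
    using insert.hyps by (intro product_nn_integral_insert_rev) measurable
  also have "\<dots> = (\<integral>\<^sup>+(y::real^'n). 0 \<partial>lborel)" using inner by (rule nn_integral_cong_AE)
  finally have "(\<integral>\<^sup>+z. ?bad z \<partial>?P (insert i I)) = 0" by simp
  moreover have "?bad \<in> borel_measurable (?P (insert i I))" by measurable
  ultimately have "AE z in ?P (insert i I). ?bad z = 0"
    using nn_integral_0_iff_AE by blast
  then show ?case by eventually_elim (auto split: if_splits)
qed

section \<open>Scatter matrix and sample mean\<close>

definition scatter :: "nat \<Rightarrow> (nat \<Rightarrow> real^'p) \<Rightarrow> real^'p^'p" where
  "scatter m y = gram m (\<lambda>j. y j - sample_mean m y)"

lemma transpose_scatter [simp]: "transpose (scatter m y) = scatter m y"
  by (simp add: scatter_def)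

lemma sample_mean_translate:
  assumes "m > 0"
  shows "sample_mean m (\<lambda>j. y j + w) = sample_mean m y + w"
  using assms by (simp add: sample_mean_def sum.distrib scaleR_add_right sum_constant_scaleR del: sum_constant)

lemma sample_mean_linear: "sample_mean m (\<lambda>j. g *v y j) = g *v sample_mean m y"
proof -
  have "(\<Sum>j\<in>J. g *v y j) = g *v (\<Sum>j\<in>J. y j)" for J
    by (induction J rule: infinite_finite_induct) (auto simp: matrix_vector_right_distrib)
  then show ?thesis by (simp add: sample_mean_def matrix_vector_mult_scaleR)
qed

lemma sample_mean_cong: "(\<And>j. j < m \<Longrightarrow> y j = y' j) \<Longrightarrow> sample_mean m y = sample_mean m y'"
  by (simp add: sample_mean_def)

lemma gram_cong: "(\<And>j. j < m \<Longrightarrow> y j = y' j) \<Longrightarrow> gram m y = gram m y'"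
  by (simp add: gram_def)

lemma scatter_cong: "(\<And>j. j < m \<Longrightarrow> y j = y' j) \<Longrightarrow> scatter m y = scatter m y'"
  using sample_mean_cong[of m y y'] by (auto simp: scatter_def intro!: gram_cong)

lemma scatter_translate: "m > 0 \<Longrightarrow> scatter m (\<lambda>j. y j + w) = scatter m y"
  by (simp add: scatter_def sample_mean_translate)

lemma scatter_linear: "scatter m (\<lambda>j. g *v y j) = cong_mat g (scatter m y)"
  by (simp add: scatter_def sample_mean_linear matrix_vector_mult_diff_distrib[symmetric] gram_linear)

lemma sum_sample_mean: "m > 0 \<Longrightarrow> (\<Sum>j<m. y j) = real m *\<^sub>R sample_mean m y"
  by (simp add: sample_mean_def)

lemma gram_eq_scatter_add:
  assumes "m > 0"
  shows "gram m y = scatter m y + real m *\<^sub>R outer (sample_mean m y)"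
proof -
  let ?b = "sample_mean m y"
  have s: "(\<Sum>j<m. y j $ a) = real m * ?b $ a" for a
    using arg_cong[OF sum_sample_mean[OF assms, of y], of "\<lambda>v. v $ a"] by simp
  have "(\<Sum>j<m. (y j $ a - ?b $ a) * (y j $ b - ?b $ b)) = (\<Sum>j<m. y j $ a * y j $ b) - real m * (?b $ a * ?b $ b)" for a b
  proof -
    have "(\<Sum>j<m. (y j $ a - ?b $ a) * (y j $ b - ?b $ b)) =
      (\<Sum>j<m. y j $ a * y j $ b) - (\<Sum>j<m. y j $ a) * ?b $ b - ?b $ a * (\<Sum>j<m. y j $ b) + real m * (?b $ a * ?b $ b)"
      by (simp add: algebra_simps sum.distrib sum_subtractf sum_distrib_left sum_distrib_right)
    then show ?thesis by (simp add: s algebra_simps)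
  qed
  then show ?thesis by (simp add: scatter_def gram_def outer_def vec_eq_iff)
qed

lemma trace_mult_outer: "trace (A ** outer x) = x \<bullet> (A *v x)"
  by (simp add: trace_def matrix_matrix_mult_def outer_def inner_vec_def matrix_vector_mult_def
      sum_distrib_left mult_ac)

lemma trace_sum: "trace (\<Sum>i\<in>I. A i) = (\<Sum>i\<in>I. trace (A i :: real^'n^'n))"
  by (induction I rule: infinite_finite_induct) (auto simp: trace_add trace_0[unfolded mat_0])

lemma matrix_mult_sum_right: "(A::real^'n^'m) ** (\<Sum>i\<in>I. B i) = (\<Sum>i\<in>I. A ** B i)"
  by (induction I rule: infinite_finite_induct) (auto simp: matrix_add_ldistrib)

lemma trace_mult_gram: "trace (A ** gram m y) = (\<Sum>j<m. y j \<bullet> (A *v y j))"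
  by (simp add: gram_eq_sum_outer matrix_mult_sum_right trace_sum trace_mult_outer)

lemma trace_scaleR: "trace (c *\<^sub>R A) = c * trace (A :: real^'n^'n)"
  by (simp add: trace_def sum_distrib_left)

text \<open>Splits the exponent of the joint normal density into a function of the scatter matrix
  and a function of the sample mean, so that the density factorizes.\<close>

lemma sum_quadratic_form_decomposition:
  assumes m: "m > 0"
  shows "(\<Sum>j<m. (y j - \<mu>) \<bullet> (L *v (y j - \<mu>))) =
    trace (L ** scatter m y) + real m * ((sample_mean m y - \<mu>) \<bullet> (L *v (sample_mean m y - \<mu>)))"
proof -
  have "(\<Sum>j<m. (y j - \<mu>) \<bullet> (L *v (y j - \<mu>))) = trace (L ** gram m (\<lambda>j. y j + (- \<mu>)))"
    by (simp add: trace_mult_gram)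
  also have "gram m (\<lambda>j. y j + (- \<mu>)) = scatter m y + real m *\<^sub>R outer (sample_mean m y - \<mu>)"
    using gram_eq_scatter_add[OF m, of "\<lambda>j. y j + (- \<mu>)"] scatter_translate[OF m, of y "- \<mu>"]
      sample_mean_translate[OF m, of y "- \<mu>"] by simp
  finally show ?thesis
    by (simp add: matrix_add_ldistrib trace_add matrix_scaleR_right trace_scaleR trace_mult_outer)
qed

section \<open>Openness of the cone, reference integrals and uniqueness of the invariant
  measure\<close>

lemma norm_matrix_vector_mult_le: "norm (A *v v) \<le> norm A * norm (v :: real^'n::finite)"
  for A :: "real^'n::finite^'m::finite"
proof -
  have "norm (A *v v) = L2_set (\<lambda>a. \<bar>A $ a \<bullet> v\<bar>) UNIV"
    by (simp add: norm_vec_def matrix_vector_mult_def inner_vec_def)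
  also have "\<dots> \<le> L2_set (\<lambda>a. norm (A $ a) * norm v) UNIV"
    by (intro L2_set_mono Cauchy_Schwarz_ineq2) auto
  also have "\<dots> = norm A * norm v" by (simp add: norm_vec_def[of A] L2_set_left_distrib)
  finally show ?thesis .
qed

text \<open>By compactness the quadratic form of A has a positive minimum e on the unit sphere, and
  a perturbation of norm less than e changes it by less than \<open>e * |v|^2\<close>.\<close>

lemma pos_def_perturb:
  fixes A :: "real^'n::finite^'n"
  assumes A: "pos_def_matrix A"
  obtains e where "e > 0" "\<And>B. transpose B = B \<Longrightarrow> norm (B - A) < e \<Longrightarrow> pos_def_matrix B"
proof -
  let ?S = "sphere 0 1 :: (real^'n) set"
  obtain k :: 'n where True by blast
  have "axis k 1 \<in> ?S" by simp
  then have "?S \<noteq> {}" by blast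
  moreover have "continuous_on ?S (\<lambda>v. v \<bullet> (A *v v))"
    by (intro continuous_intros)
  ultimately obtain u where u: "u \<in> ?S" and min: "\<And>v. v \<in> ?S \<Longrightarrow> u \<bullet> (A *v u) \<le> v \<bullet> (A *v v)"
    using continuous_attains_inf[of ?S "\<lambda>v. v \<bullet> (A *v v)"] by (auto simp: compact_sphere)
  define e where "e = u \<bullet> (A *v u)"
  have "u \<noteq> 0" using u by auto
  then have e: "e > 0" unfolding e_def by (rule pos_def_pos[OF A])
  have lb: "e * (norm v)\<^sup>2 \<le> v \<bullet> (A *v v)" for v
  proof (cases "v = 0")
    case False
    have "e \<le> (v /\<^sub>R norm v) \<bullet> (A *v (v /\<^sub>R norm v))"
      unfolding e_def using False by (intro min) simp
    also have "\<dots> = (v \<bullet> (A *v v)) / (norm v)\<^sup>2"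
      by (simp add: matrix_vector_mult_scaleR power2_eq_square field_simps)
    finally show ?thesis using False by (simp add: field_simps)
  qed simp
  have "pos_def_matrix B" if B: "transpose B = B" "norm (B - A) < e" for B
    unfolding pos_def_matrix_def
  proof (intro conjI allI impI)
    fix v :: "real^'n" assume v: "v \<noteq> 0"
    have "\<bar>v \<bullet> ((B - A) *v v)\<bar> \<le> norm v * norm ((B - A) *v v)" by (rule Cauchy_Schwarz_ineq2)
    also have "\<dots> \<le> norm v * (norm (B - A) * norm v)" by (intro mult_left_mono norm_matrix_vector_mult_le) auto
    also have "\<dots> = norm (B - A) * (norm v)\<^sup>2" by (simp add: power2_eq_square)
    also have "\<dots> < e * (norm v)\<^sup>2" using B(2) v by (intro mult_strict_right_mono) auto
    also have "\<dots> \<le> v \<bullet> (A *v v)" by (rule lb)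
    finally show "0 < v \<bullet> (B *v v)"
      by (simp add: matrix_vector_mult_diff_rdistrib inner_diff_right abs_less_iff)
  qed (rule B)
  with e show ?thesis by (rule that)
qed

lemma lborel_AE_not_in_open:
  assumes "open U" "x \<in> U"
  shows "\<not> (AE y in lborel. y \<notin> U)"
proof
  assume "AE y in lborel. y \<notin> U"
  then have "AE y in lebesgue. y \<in> - U" by (simp add: AE_completion)
  then have "x \<in> - U" using assms(1) by (intro mem_closed_if_AE_lebesgue) auto
  then show False using assms(2) by simp
qed

text \<open>A test function whose integrals against the Haar measure and against the invariant
  measure of the cone are finite and nonzero, so that one may divide by them. The norm cutoff bounds
  the domain. The exponent p + 1 beats both singularities: along A = g g^T it leaves
  \<open>|det g| ^ (p + 2)\<close> after the Haar factor, and on the cone it leaves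
  \<open>det A\<close> to the power (p + 1)/2.\<close>

definition reference_weight :: "real^'p::finite^'p \<Rightarrow> ennreal" where
  "reference_weight A = ennreal (\<bar>det A\<bar> ^ (CARD('p) + 1) * (if norm A \<le> 1 then 1 else 0))"

lemma borel_measurable_reference_weight [measurable]: "reference_weight \<in> borel_measurable borel"
  unfolding reference_weight_def by measurable

lemma matrix_nth_le_norm: "\<bar>A $ a $ b\<bar> \<le> norm (A :: real^'n::finite^'m::finite)"
proof -
  have "\<bar>A $ a $ b\<bar> \<le> norm (A $ a)" by (rule component_le_norm_cart)
  also have "\<dots> \<le> norm A" by (rule Finite_Cartesian_Product.norm_nth_le)
  finally show ?thesis .
qed

lemma nn_integral_bounded_cbox:
  fixes f :: "real^'m::finite \<Rightarrow> real" and F :: "real^'m \<Rightarrow> ennreal"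
  assumes f: "continuous_on UNIV f" and F: "\<And>x. F x \<noteq> 0 \<Longrightarrow> (\<forall>i. \<bar>x $ i\<bar> \<le> 1) \<and> F x \<le> ennreal (f x)"
  shows "(\<integral>\<^sup>+x. F x \<partial>lborel) < \<infinity>"
proof -
  let ?B = "cbox (- 1) 1 :: (real^'m) set"
  have B: "x \<in> ?B \<longleftrightarrow> (\<forall>i. \<bar>x $ i\<bar> \<le> 1)" for x
    by (auto simp: mem_box Basis_vec_def inner_axis abs_le_iff)
  have "0 \<in> ?B" by (simp add: B)
  then obtain z where z: "\<And>x. x \<in> ?B \<Longrightarrow> f x \<le> f z"
    using continuous_attains_sup[of ?B f] continuous_on_subset[OF f] by (metis compact_cbox empty_iff subset_UNIV)
  have "(\<integral>\<^sup>+x. F x \<partial>lborel) \<le> (\<integral>\<^sup>+x. ennreal (f z) * indicator ?B x \<partial>lborel)"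
  proof (rule nn_integral_mono)
    fix x show "F x \<le> ennreal (f z) * indicator ?B x"
    proof (cases "F x = 0")
      case False
      then have "x \<in> ?B" "F x \<le> ennreal (f x)" using F B by auto
      then show ?thesis using z[of x] by (auto intro: order_trans ennreal_leI)
    qed simp
  qed
  also have "\<dots> = ennreal (f z) * emeasure lborel ?B" by (simp add: nn_integral_cmult)
  also have "\<dots> < \<infinity>" using emeasure_lborel_cbox_finite[of "- 1" "1 :: real^'m"] by (simp add: ennreal_mult_less_top less_top)
  finally show ?thesis .
qed

lemma haar_reference_finite:
  "(\<integral>\<^sup>+g. haar g * reference_weight (cong_mat (mat_of g) (mat 1)) \<partial>(lborel :: (real^('p::finite \<times> 'p)) measure)) < \<infinity>"
proof (rule nn_integral_bounded_cbox)
  let ?f = "\<lambda>g::real^('p \<times> 'p). \<bar>det (mat_of g)\<bar> ^ (CARD('p) + 2)"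
  show "continuous_on UNIV ?f" unfolding mat_of_def by (intro continuous_intros)
  fix g :: "real^('p \<times> 'p)" assume nz: "haar g * reference_weight (cong_mat (mat_of g) (mat 1)) \<noteq> 0"
  let ?A = "mat_of g ** transpose (mat_of g)"
  have n: "norm ?A \<le> 1" using nz by (auto simp: reference_weight_def split: if_splits)
  have d: "det (mat_of g) \<noteq> 0" using nz by (auto simp: haar_def power_0_left)
  have "\<bar>g $ i\<bar> \<le> 1" for i
  proof (cases i)
    case (Pair a b)
    \<comment> \<open>The diagonal entries of g g^T are the squared norms of the rows of g, so the
      cutoff bounds every entry of g.\<close>
    have "(g $ (a, b))\<^sup>2 \<le> (\<Sum>b\<in>UNIV. (g $ (a, b))\<^sup>2)"
      by (rule member_le_sum) auto
    also have "\<dots> = ?A $ a $ a"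
      by (simp add: matrix_matrix_mult_def transpose_def mat_of_def power2_eq_square)
    also have "\<dots> \<le> 1" using matrix_nth_le_norm[of ?A a a] n by linarith
    finally show ?thesis by (simp add: Pair abs_square_le_1)
  qed
  moreover have "haar g * reference_weight (cong_mat (mat_of g) (mat 1)) \<le> ennreal (?f g)"
  proof -
    let ?d = "\<bar>det (mat_of g)\<bar>"
    have "haar g * reference_weight (cong_mat (mat_of g) (mat 1)) = ennreal (inverse (?d ^ CARD('p)) * (?d * ?d) ^ (CARD('p) + 1))"
      using n by (simp add: haar_def reference_weight_def det_mul abs_mult ennreal_mult'[symmetric])
    also have "inverse (?d ^ CARD('p)) * (?d * ?d) ^ (CARD('p) + 1) = ?d ^ (CARD('p) + 2)"
    proof -
      have "inverse (x ^ k) * (x * x) ^ (k + 1) = x ^ (k + 2)" if "x \<noteq> 0" for x :: real and k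
        using that by (simp add: power_mult_distrib power_add field_simps)
      then show ?thesis using d by (metis abs_eq_0)
    qed
    finally show ?thesis by simp
  qed
  ultimately show "(\<forall>i. \<bar>g $ i\<bar> \<le> 1) \<and> haar g * reference_weight (cong_mat (mat_of g) (mat 1)) \<le> ennreal (?f g)" by auto
qed

lemma diag_matrix_const: "diag_matrix (\<lambda>_. c) = c *\<^sub>R mat 1"
  by (simp add: vec_eq_iff diag_matrix_def mat_def)

lemma small_scalar_matrix:
  obtains c :: real where "c > 0" "norm (c *\<^sub>R (mat 1 :: real^'p::finite^'p)) < 1" "c \<le> 1"
proof -
  let ?c = "1 / (1 + norm (mat 1 :: real^'p^'p))"
  have "0 < 1 + norm (mat 1 :: real^'p^'p)" by (simp add: add_pos_nonneg)
  then have "?c > 0" "norm (?c *\<^sub>R (mat 1 :: real^'p^'p)) < 1" "?c \<le> 1"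
    by (auto simp: field_simps)
  then show ?thesis by (rule that)
qed

lemma haar_reference_nonzero:
  "(\<integral>\<^sup>+g. haar g * reference_weight (cong_mat (mat_of g) (mat 1)) \<partial>(lborel :: (real^('p::finite \<times> 'p)) measure)) \<noteq> 0"
proof
  assume "(\<integral>\<^sup>+g. haar g * reference_weight (cong_mat (mat_of g) (mat 1)) \<partial>(lborel :: (real^('p \<times> 'p)) measure)) = 0"
  then have ae: "AE g in (lborel :: (real^('p \<times> 'p)) measure). haar g * reference_weight (cong_mat (mat_of g) (mat 1)) = 0"
    by (subst (asm) nn_integral_0_iff_AE) measurable
  let ?U = "{g :: real^('p \<times> 'p). det (mat_of g) \<noteq> 0} \<inter> {g. norm (mat_of g ** transpose (mat_of g)) < 1}"
  have "open ?U"
    unfolding mat_of_def matrix_matrix_mult_def transpose_def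
    by (intro open_Int open_Collect_neq open_Collect_less continuous_intros)
  obtain c where c: "c > 0" "norm (c *\<^sub>R (mat 1 :: real^'p^'p)) < 1" "c \<le> 1" using small_scalar_matrix .
  \<comment> \<open>The scalar matrix c gives c^2 times the identity after forming g g^T;
    \<open>c <= 1\<close> keeps this below the cutoff.\<close>
  have "norm ((c * c) *\<^sub>R (mat 1 :: real^'p^'p)) \<le> norm (c *\<^sub>R (mat 1 :: real^'p^'p))"
    using c by (auto simp: mult_right_mono mult_le_one intro!: mult_right_mono mult_left_le)
  then have "norm (diag_matrix (\<lambda>_::'p. c * c)) < 1"
    using c(2) unfolding diag_matrix_const by linarith
  then have "vec_of_mat (diag_matrix (\<lambda>_::'p. c)) \<in> ?U"
    using c by (simp add: diag_matrix_mult)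
  moreover have "AE g in lborel. g \<notin> ?U"
    using ae
  proof eventually_elim
    case (elim g)
    show ?case
    proof
      assume g: "g \<in> ?U"
      then have "haar g > 0" by (simp add: haar_def)
      moreover have "reference_weight (cong_mat (mat_of g) (mat 1)) > 0"
      proof -
        have "0 < det (mat_of g) * det (mat_of g)" using g not_real_square_gt_zero by blast
        then show ?thesis using g by (simp add: reference_weight_def det_mul)
      qed
      ultimately show False using elim by (metis mult_eq_0_iff less_irrefl)
    qed
  qed
  ultimately show False using lborel_AE_not_in_open[OF \<open>open ?U\<close>] by blast
qed

text \<open>Density of the invariant measure of the cone. The exponent is minus half the power p + 1
  in the Jacobian of a congruence, since the congruence multiplies the determinant by
  \<open>det g\<close> squared.\<close>

definition sym_weight :: "real^('p::finite uprod) \<Rightarrow> ennreal" where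
  "sym_weight v = ennreal (if pos_def_matrix (sym_of v) then det (sym_of v) powr (- (real CARD('p) + 1) / 2) else 0)"

lemma borel_measurable_sym_weight [measurable]: "sym_weight \<in> borel_measurable borel"
  unfolding sym_weight_def by measurable

lemma pos_def_cong_iff:
  fixes g A :: "real^'n::finite^'n"
  assumes "det g \<noteq> 0"
  shows "pos_def_matrix (cong_mat g A) \<longleftrightarrow> pos_def_matrix A"
proof
  assume "pos_def_matrix (cong_mat g A)"
  then have "pos_def_matrix (cong_mat (matrix_inv g) (cong_mat g A))"
    using assms pos_def_congruence[of "cong_mat g A" "matrix_inv g"] by (simp add: det_matrix_inv)
  moreover have "cong_mat (matrix_inv g) (cong_mat g A) = A"
    unfolding cong_mat_mult[symmetric] by (simp add: matrix_inv_mult assms)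
  ultimately show "pos_def_matrix A" by simp
qed (use assms pos_def_congruence in blast)

lemma sym_weight_invariant:
  fixes g :: "real^'p::finite^'p"
  assumes g: "det g \<noteq> 0" and [measurable]: "F \<in> borel_measurable borel"
  shows "(\<integral>\<^sup>+v. sym_weight v * F (cong_mat g (sym_of v)) \<partial>lborel) = (\<integral>\<^sup>+v. sym_weight v * F (sym_of v) \<partial>lborel)"
proof -
  let ?f = "sym_cong g" and ?p = "real CARD('p) + 1"
  have D: "\<bar>det (matrix ?f)\<bar> = \<bar>det g\<bar> powr ?p"
    using g by (simp add: abs_det_sym_cong powr_realpow powr_add)
  have D0: "det (matrix ?f) \<noteq> 0" using g abs_det_sym_cong[of g] by auto
  have m [measurable]: "?f \<in> borel_measurable borel" by (intro borel_measurable_linear linear_sym_cong)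
  have w: "ennreal \<bar>det (matrix ?f)\<bar> * sym_weight (?f v) = sym_weight v" for v
  proof (cases "pos_def_matrix (sym_of v)")
    case True
    have "det (cong_mat g (sym_of v)) = \<bar>det g\<bar> powr 2 * det (sym_of v)"
      using g by (simp add: det_mul power2_eq_square)
    then have "det (cong_mat g (sym_of v)) powr (- ?p / 2) = \<bar>det g\<bar> powr (- ?p) * det (sym_of v) powr (- ?p / 2)"
    proof -
      have "2 * (- ?p / 2) = - ?p" by simp
      then show ?thesis
        using pos_def_det_pos[OF True] \<open>det (cong_mat g (sym_of v)) = _\<close>
        by (simp only: powr_mult powr_powr powr_ge_zero less_imp_le)
    qed
    then have "\<bar>det g\<bar> powr ?p * det (cong_mat g (sym_of v)) powr (- ?p / 2) = det (sym_of v) powr (- ?p / 2)"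
    proof -
      have "\<bar>det g\<bar> powr ?p * \<bar>det g\<bar> powr (- ?p) = 1"
        using g by (simp only: powr_add[symmetric]) simp
      then show ?thesis using \<open>det (cong_mat g (sym_of v)) powr _ = _\<close> by (metis mult.assoc mult_1)
    qed
    then show ?thesis
      using True pos_def_cong_iff[OF g] unfolding D sym_weight_def sym_of_sym_cong
      by (simp add: ennreal_mult'[symmetric])
  qed (simp add: sym_weight_def sym_of_sym_cong pos_def_cong_iff[OF g])
  have "(\<integral>\<^sup>+v. sym_weight v * F (sym_of v) \<partial>lborel) =
     ennreal \<bar>det (matrix ?f)\<bar> * (\<integral>\<^sup>+v. sym_weight (?f v) * F (sym_of (?f v)) \<partial>lborel)"
    by (rule nn_integral_lborel_linear[OF linear_sym_cong D0]) measurable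
  also have "\<dots> = (\<integral>\<^sup>+v. (ennreal \<bar>det (matrix ?f)\<bar> * sym_weight (?f v)) * F (sym_of (?f v)) \<partial>lborel)"
    by (subst nn_integral_cmult[symmetric]) (auto simp: mult.assoc)
  finally show ?thesis unfolding w sym_of_sym_cong ..
qed

lemma sym_weight_reference:
  defines "I \<equiv> (\<integral>\<^sup>+v. sym_weight v * reference_weight (sym_of v) \<partial>(lborel :: (real^('p::finite uprod)) measure))"
  shows "I < \<infinity>" "I \<noteq> 0"
proof -
  let ?f = "\<lambda>v::real^('p uprod). 1 + \<bar>det (sym_of v)\<bar> ^ (CARD('p) + 1)"
  show "I < \<infinity>" unfolding I_def
  proof (rule nn_integral_bounded_cbox)
    show "continuous_on UNIV ?f" unfolding sym_of_def by (intro continuous_intros)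
    fix v :: "real^('p uprod)" assume nz: "sym_weight v * reference_weight (sym_of v) \<noteq> 0"
    then have pd: "pos_def_matrix (sym_of v)" and n: "norm (sym_of v) \<le> 1"
      by (auto simp: sym_weight_def reference_weight_def split: if_splits)
    have "\<bar>v $ u\<bar> \<le> 1" for u
    proof (cases u)
      case (Upair a b)
      then show ?thesis using matrix_nth_le_norm[of "sym_of v" a b] n by simp
    qed
    moreover have "sym_weight v * reference_weight (sym_of v) \<le> ennreal (?f v)"
    proof -
      let ?d = "det (sym_of v)" and ?p = "real CARD('p) + 1"
      have d: "?d > 0" using pos_def_det_pos[OF pd] .
      have "sym_weight v * reference_weight (sym_of v) = ennreal (?d powr (- ?p / 2) * ?d powr ?p)"
        using pd n d by (simp add: sym_weight_def reference_weight_def ennreal_mult'[symmetric] powr_realpow powr_add)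
      also have "?d powr (- ?p / 2) * ?d powr ?p = ?d powr (?p / 2)"
        by (simp only: powr_add[symmetric]) (rule arg_cong[where f = "(powr) ?d"], simp add: field_simps)
      \<comment> \<open>The dominating function has to be continuous on the whole space, including
        points outside the cone; hence the passage from the power (p + 1)/2 to a polynomial in
        \<open>|det|\<close>.\<close>
      also have "\<dots> \<le> 1 + ?d powr ?p"
      proof (cases "?d \<le> 1")
        case True
        then have "?d powr (?p / 2) \<le> 1 powr (?p / 2)" using d by (intro powr_mono2) auto
        then show ?thesis by (simp add: add_increasing2)
      next
        case False
        then have "?d powr (?p / 2) \<le> ?d powr ?p" by (intro powr_mono) auto
        then show ?thesis by simp
      qed
      also have "?d powr ?p = \<bar>?d\<bar> ^ (CARD('p) + 1)" using d by (simp add: powr_realpow powr_add)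
      finally show ?thesis by (simp add: ennreal_leI)
    qed
    ultimately show "(\<forall>i. \<bar>v $ i\<bar> \<le> 1) \<and> sym_weight v * reference_weight (sym_of v) \<le> ennreal (?f v)" by auto
  qed
  show "I \<noteq> 0"
  proof
    assume "I = 0"
    then have ae: "AE v in (lborel :: (real^('p uprod)) measure). sym_weight v * reference_weight (sym_of v) = 0"
      unfolding I_def by (subst (asm) nn_integral_0_iff_AE) measurable
    obtain c where c: "c > 0" "norm (c *\<^sub>R (mat 1 :: real^'p^'p)) < 1" using small_scalar_matrix .
    let ?A = "c *\<^sub>R (mat 1 :: real^'p^'p)"
    have A: "pos_def_matrix ?A" using c by (intro pos_def_scaleR pos_def_mat_1)
    obtain e where e: "e > 0" "\<And>B. transpose B = B \<Longrightarrow> norm (B - ?A) < e \<Longrightarrow> pos_def_matrix B"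
      using pos_def_perturb[OF A] by blast
    let ?U = "{v. norm (sym_of v - ?A) < e} \<inter> {v. norm (sym_of v) < 1}"
    have "open ?U" unfolding sym_of_def by (intro open_Int open_Collect_less continuous_intros)
    moreover have "vec_of_sym ?A \<in> ?U"
      using e c sym_of_vec_of_sym[OF pos_def_transpose[OF A]] by simp
    moreover have "AE v in lborel. v \<notin> ?U"
      using ae
    proof eventually_elim
      case (elim v)
      show ?case
      proof
        assume "v \<in> ?U"
        then have pd: "pos_def_matrix (sym_of v)" and n: "norm (sym_of v) < 1" using e(2)[of "sym_of v"] by auto
        have "det (sym_of v) > 0" using pos_def_det_pos[OF pd] .
        then have "sym_weight v * reference_weight (sym_of v) > 0"
          using pd n by (simp add: sym_weight_def reference_weight_def ennreal_zero_less_mult_iff)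
        then show False using elim by simp
      qed
    qed
    ultimately show False using lborel_AE_not_in_open by blast
  qed
qed

text \<open>The exchange identity, applied to the given measure and to the explicit one, expresses
  both integrals of F through the same integral over g. Their ratio is therefore that of the
  reference integrals, whatever F is. The cancellations in \<open>ennreal\<close> rest on the
  reference integrals being finite and nonzero.\<close>

lemma invariant_integral_eq:
  fixes X :: "'z \<Rightarrow> real^'p::finite^'p" and w :: "'z \<Rightarrow> ennreal"
  assumes N: "sigma_finite_measure N"
    and X [measurable]: "X \<in> borel_measurable N" and w [measurable]: "w \<in> borel_measurable N"
    and inv: "\<And>g F. det g \<noteq> 0 \<Longrightarrow> F \<in> borel_measurable borel \<Longrightarrow>
        (\<integral>\<^sup>+z. w z * F (cong_mat g (X z)) \<partial>N) = (\<integral>\<^sup>+z. w z * F (X z) \<partial>N)"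
    and pd: "\<And>z. w z \<noteq> 0 \<Longrightarrow> pos_def_matrix (X z)"
  shows "\<exists>K. \<forall>F\<in>borel_measurable borel. (\<integral>\<^sup>+z. w z * F (X z) \<partial>N) = K * (\<integral>\<^sup>+v. sym_weight v * F (sym_of v) \<partial>lborel)"
proof -
  let ?I1 = "\<lambda>F. (\<integral>\<^sup>+z. w z * F (X z) \<partial>N)"
  let ?I2 = "\<lambda>F. (\<integral>\<^sup>+v. sym_weight v * F (sym_of v) \<partial>(lborel :: (real^('p uprod)) measure))"
  let ?kh = "(\<integral>\<^sup>+g. haar g * reference_weight (cong_mat (mat_of g) (mat 1)) \<partial>(lborel :: (real^('p \<times> 'p)) measure))"
  let ?kf = "\<lambda>F. (\<integral>\<^sup>+g. haar g * F (cong_mat (cramer_inv (mat_of g)) (mat 1)) \<partial>(lborel :: (real^('p \<times> 'p)) measure))"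
  have "?I1 F = (?I1 reference_weight / ?I2 reference_weight) * ?I2 F" if F: "F \<in> borel_measurable borel" for F
  proof -
    have 1: "?I1 F * ?kh = ?I1 reference_weight * ?kf F"
      by (rule invariant_integral_exchange[OF N X w F borel_measurable_reference_weight inv pd])
    have 2: "?I2 F * ?kh = ?I2 reference_weight * ?kf F"
    proof (rule invariant_integral_exchange[OF sigma_finite_lborel _ _ F borel_measurable_reference_weight])
      show "pos_def_matrix (sym_of z)" if "sym_weight z \<noteq> 0" for z :: "real^('p uprod)"
        using that by (auto simp: sym_weight_def split: if_splits)
    qed (auto intro: sym_weight_invariant)
    have "(?I1 F * ?I2 reference_weight) * ?kh = (?I1 reference_weight * ?I2 F) * ?kh"
    proof -
      have "(?I1 F * ?I2 reference_weight) * ?kh = (?I1 F * ?kh) * ?I2 reference_weight" by (simp only: mult_ac)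
      also have "\<dots> = ?I1 reference_weight * (?I2 reference_weight * ?kf F)" by (simp only: 1 mult_ac)
      also have "\<dots> = ?I1 reference_weight * (?I2 F * ?kh)" by (simp only: 2)
      finally show ?thesis by (simp only: mult_ac)
    qed
    then have "?I1 F * ?I2 reference_weight = ?I1 reference_weight * ?I2 F"
      using haar_reference_finite[where 'p='p] haar_reference_nonzero[where 'p='p]
      by (metis (no_types, lifting) mult_divide_eq_ennreal infinity_ennreal_def order_less_irrefl)
    then have "?I1 F = (?I1 reference_weight * ?I2 F) / ?I2 reference_weight"
      using sym_weight_reference[where 'p='p]
      by (metis (no_types, lifting) ennreal_mult_divide_eq infinity_ennreal_def order_less_irrefl)
    then show ?thesis by (simp add: ennreal_divide_times ennreal_times_divide)
  qed
  then show ?thesis by blast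
qed

section \<open>Law of the scatter matrix of a normal sample\<close>

lemma borel_measurable_gram:
  fixes f :: "'a \<Rightarrow> nat \<Rightarrow> real^'n::finite"
  assumes "\<And>j. j < m \<Longrightarrow> (\<lambda>x. f x j) \<in> borel_measurable M"
  shows "(\<lambda>x. gram m (f x)) \<in> borel_measurable M"
  unfolding gram_eq_sum_outer
  by (intro borel_measurable_sum borel_measurable_outer assms) auto

lemma borel_measurable_sample_mean:
  fixes f :: "'a \<Rightarrow> nat \<Rightarrow> real^'n::finite"
  assumes "\<And>j. j < m \<Longrightarrow> (\<lambda>x. f x j) \<in> borel_measurable M"
  shows "(\<lambda>x. sample_mean m (f x)) \<in> borel_measurable M"
  unfolding sample_mean_def
  by (intro borel_measurable_scaleR borel_measurable_const borel_measurable_sum assms) auto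

lemma borel_measurable_scatter:
  fixes f :: "'a \<Rightarrow> nat \<Rightarrow> real^'n::finite"
  assumes "\<And>j. j < m \<Longrightarrow> (\<lambda>x. f x j) \<in> borel_measurable M"
  shows "(\<lambda>x. scatter m (f x)) \<in> borel_measurable M"
  unfolding scatter_def
  by (intro borel_measurable_gram borel_measurable_diff borel_measurable_sample_mean assms) auto

abbreviation lborel_pow :: "nat \<Rightarrow> (nat \<Rightarrow> real^'p::finite) measure" where
  "lborel_pow m \<equiv> PiM {..<m} (\<lambda>_. lborel)"

lemma borel_measurable_component_upd:
  assumes "j < Suc m"
  shows "(\<lambda>x. (x(m := w)) j) \<in> borel_measurable (lborel_pow m)"
proof (cases "j = m")
  case False
  then have "(\<lambda>x. x j) \<in> measurable (lborel_pow m) lborel"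
    using assms by (intro measurable_component_singleton) auto
  then show ?thesis using False by simp
qed simp

text \<open>Differences to the last observation are free of location, and given them the sample mean
  ranges over a translate of Lebesgue measure.\<close>

lemma nn_integral_scatter_mean:
  fixes G :: "real^'p::finite^'p \<Rightarrow> ennreal" and k :: "real^'p \<Rightarrow> ennreal"
  assumes [measurable]: "G \<in> borel_measurable borel" "k \<in> borel_measurable borel"
  shows "(\<integral>\<^sup>+y. G (scatter (Suc m) y) * k (sample_mean (Suc m) y) \<partial>lborel_pow (Suc m)) =
    (\<integral>\<^sup>+w. k w \<partial>lborel) * (\<integral>\<^sup>+x. G (scatter (Suc m) (x(m := 0))) \<partial>lborel_pow m)"
proof -
  interpret product_sigma_finite "\<lambda>_. lborel :: (real^'p) measure" by (rule product_sigma_finite_lborel)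
  interpret F: pair_sigma_finite "lborel_pow m :: (nat \<Rightarrow> real^'p) measure" "lborel :: (real^'p) measure"
    by (intro pair_sigma_finite.intro sigma_finite sigma_finite_lborel) auto
  let ?n = "Suc m"
  have S: "{..<?n} = insert m {..<m}" by auto
  have m0 [measurable]: "(\<lambda>x. scatter ?n (x(m := 0))) \<in> borel_measurable (lborel_pow m :: (nat \<Rightarrow> real^'p) measure)"
    by (intro borel_measurable_scatter borel_measurable_component_upd)
  have m1 [measurable]: "(\<lambda>x. sample_mean ?n (x(m := 0))) \<in> borel_measurable (lborel_pow m :: (nat \<Rightarrow> real^'p) measure)"
    by (intro borel_measurable_sample_mean borel_measurable_component_upd)
  have comp: "(\<lambda>y. y j) \<in> borel_measurable (lborel_pow ?n :: (nat \<Rightarrow> real^'p) measure)" if "j < ?n" for j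
    using measurable_component_singleton[of j "{..<?n}" "\<lambda>_. lborel :: (real^'p) measure"] that by simp
  have [measurable]: "(\<lambda>y. scatter ?n y) \<in> borel_measurable (lborel_pow ?n :: (nat \<Rightarrow> real^'p) measure)"
      "(\<lambda>y. sample_mean ?n y) \<in> borel_measurable (lborel_pow ?n :: (nat \<Rightarrow> real^'p) measure)"
    by (intro borel_measurable_scatter borel_measurable_sample_mean comp; assumption)+
  have "(\<integral>\<^sup>+y. G (scatter ?n y) * k (sample_mean ?n y) \<partial>lborel_pow ?n) =
    (\<integral>\<^sup>+w. \<integral>\<^sup>+x. G (scatter ?n (x(m := w))) * k (sample_mean ?n (x(m := w))) \<partial>lborel_pow m \<partial>lborel)"
    unfolding S by (rule product_nn_integral_insert_rev) (auto simp: S[symmetric])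
  also have "\<dots> = (\<integral>\<^sup>+w. \<integral>\<^sup>+x. G (scatter ?n (x(m := 0))) * k (sample_mean ?n (x(m := 0)) + w) \<partial>lborel_pow m \<partial>lborel)"
  proof (rule nn_integral_cong)
    fix w :: "real^'p"
    let ?H = "\<lambda>x. G (scatter ?n (x(m := w))) * k (sample_mean ?n (x(m := w)))"
    have [measurable]: "(\<lambda>x. scatter ?n (x(m := w))) \<in> borel_measurable (lborel_pow m :: (nat \<Rightarrow> real^'p) measure)"
      "(\<lambda>x. sample_mean ?n (x(m := w))) \<in> borel_measurable (lborel_pow m :: (nat \<Rightarrow> real^'p) measure)"
      by (intro borel_measurable_scatter borel_measurable_sample_mean borel_measurable_component_upd; assumption)+
    \<comment> \<open>Shifting the other observations by the last one, w, turns the whole sample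
      into a translate of one whose last observation is 0: the scatter matrix forgets w and the mean
      moves by w.\<close>
    have "(\<integral>\<^sup>+x. ?H (\<lambda>j\<in>{..<m}. w + x j) \<partial>lborel_pow m) = (\<Prod>i\<in>{..<m}. 1) * (\<integral>\<^sup>+x. ?H x \<partial>lborel_pow m)"
      by (rule nn_integral_PiM_componentwise[OF product_sigma_finite_lborel])
        (auto simp: nn_integral_lborel_translation)
    moreover have "?H (\<lambda>j\<in>{..<m}. w + x j) = G (scatter ?n (x(m := 0))) * k (sample_mean ?n (x(m := 0)) + w)" for x
    proof -
      have e: "((\<lambda>j\<in>{..<m}. w + x j)(m := w)) j = (x(m := 0)) j + w" if "j < ?n" for j
        using that by auto
      then have "scatter ?n ((\<lambda>j\<in>{..<m}. w + x j)(m := w)) = scatter ?n (x(m := 0))"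
        using scatter_translate[of ?n "x(m := 0)" w] by (subst scatter_cong[OF e]) auto
      moreover have "sample_mean ?n ((\<lambda>j\<in>{..<m}. w + x j)(m := w)) = sample_mean ?n (x(m := 0)) + w"
        using sample_mean_translate[of ?n "x(m := 0)" w] by (subst sample_mean_cong[OF e]) auto
      ultimately show ?thesis by simp
    qed
    ultimately show "(\<integral>\<^sup>+x. ?H x \<partial>lborel_pow m) =
      (\<integral>\<^sup>+x. G (scatter ?n (x(m := 0))) * k (sample_mean ?n (x(m := 0)) + w) \<partial>lborel_pow m)" by simp
  qed
  also have "\<dots> = (\<integral>\<^sup>+x. \<integral>\<^sup>+w. G (scatter ?n (x(m := 0))) * k (sample_mean ?n (x(m := 0)) + w) \<partial>lborel \<partial>lborel_pow m)"
    by (rule F.Fubini') measurable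
  also have "\<dots> = (\<integral>\<^sup>+x. G (scatter ?n (x(m := 0))) * (\<integral>\<^sup>+w. k w \<partial>lborel) \<partial>lborel_pow m)"
    by (intro nn_integral_cong, subst nn_integral_cmult) (auto simp: nn_integral_lborel_translation)
  also have "\<dots> = (\<integral>\<^sup>+w. k w \<partial>lborel) * (\<integral>\<^sup>+x. G (scatter ?n (x(m := 0))) \<partial>lborel_pow m)"
    by (subst nn_integral_multc) (auto simp: mult.commute)
  finally show ?thesis .
qed

text \<open>A kernel vector of the scatter matrix is orthogonal to all deviations from the mean. As
  the last observation is 0, it is orthogonal to the mean and thus to every \<open>x j\<close>, so
  it lies in the kernel of a sum of m outer products, which is almost surely nonsingular for m at
  least p.\<close>

lemma AE_scatter_pos_def:
  assumes "CARD('p) \<le> m"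
  shows "AE x in (lborel_pow m :: (nat \<Rightarrow> real^'p::finite) measure). pos_def_matrix (scatter (Suc m) (x(m := 0)))"
proof -
  have "AE x in (lborel_pow m :: (nat \<Rightarrow> real^'p) measure). det (0 + (\<Sum>i<m. outer (x i))) \<noteq> 0"
    by (rule AE_det_add_sum_outer) (use assms in \<open>auto simp: transpose_def vec_eq_iff\<close>)
  then show ?thesis
  proof eventually_elim
    case (elim x)
    let ?y = "x(m := 0)" let ?b = "sample_mean (Suc m) ?y"
    have "v = 0" if v: "scatter (Suc m) ?y *v v = 0" for v
    proof -
      have "v \<bullet> (scatter (Suc m) ?y *v v) = 0" using v by simp
      then have "(\<Sum>j<Suc m. ((?y j - ?b) \<bullet> v)\<^sup>2) = 0" by (simp add: scatter_def gram_quadratic_form)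
      then have "(?y j - ?b) \<bullet> v = 0" if "j < Suc m" for j
        using that by (subst (asm) sum_nonneg_eq_0_iff) auto
      then have y: "?y j \<bullet> v = ?b \<bullet> v" if "j < Suc m" for j
        using that by (simp add: inner_diff_left)
      have b: "?b \<bullet> v = 0" using y[of m] by simp
      have "x j \<bullet> v = 0" if "j < m" for j using y[of j] b that by simp
      then have "(0 + (\<Sum>i<m. outer (x i))) *v v = 0"
        by (simp add: sum_matrix_vector_mult outer_mult_vec)
      then show "v = 0" using elim matrix_vector_mult_eq_0_iff by blast
    qed
    then have "det (scatter (Suc m) ?y) \<noteq> 0" by (simp add: det_nz_iff_kernel)
    moreover have "0 \<le> v \<bullet> (scatter (Suc m) ?y *v v)" for v
      by (simp add: scatter_def gram_quadratic_form sum_nonneg)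
    ultimately show ?case by (simp add: pos_def_matrix_iff)
  qed
qed

text \<open>Unnormalized density of the Wishart distribution with n - 1 degrees of freedom and scale
  matrix L^-1, in the coordinates of the distinct entries.\<close>

definition wishart_weight :: "nat \<Rightarrow> real^'p::finite^'p \<Rightarrow> real^('p uprod) \<Rightarrow> real" where
  "wishart_weight n L v = (if pos_def_matrix (sym_of v)
     then det (sym_of v) powr ((real n - real CARD('p) - 2) / 2) * exp (- trace (L ** sym_of v) / 2) else 0)"

lemma borel_measurable_wishart_weight [measurable]: "wishart_weight n L \<in> borel_measurable borel"
  unfolding wishart_weight_def by measurable

text \<open>Applying g to all m free observations has Jacobian \<open>|det g| ^ m\<close> and turns
  the scatter matrix A into g A g^T. Weighted by det A to the power -m/2, the image of Lebesgue
  measure is therefore invariant, hence a multiple of the explicit invariant measure. Removing the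
  weight again adds m/2 to the exponent -(p + 1)/2.\<close>

lemma nn_integral_scatter_lborel:
  assumes p: "CARD('p::finite) \<le> m"
  shows "\<exists>K. \<forall>G\<in>borel_measurable borel.
    (\<integral>\<^sup>+x. G (scatter (Suc m) (x(m := 0))) \<partial>(lborel_pow m :: (nat \<Rightarrow> real^'p) measure)) =
    K * (\<integral>\<^sup>+v. ennreal (if pos_def_matrix (sym_of v)
       then det (sym_of v) powr ((real m - real CARD('p) - 1) / 2) else 0) * G (sym_of v) \<partial>lborel)"
proof -
  let ?N = "lborel_pow m :: (nat \<Rightarrow> real^'p) measure"
  let ?X = "\<lambda>x :: nat \<Rightarrow> real^'p. scatter (Suc m) (x(m := 0))"
  let ?W = "\<lambda>A::real^'p^'p. ennreal (if pos_def_matrix A then det A powr (- real m / 2) else 0)"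
  interpret product_sigma_finite "\<lambda>_. lborel :: (real^'p) measure" by (rule product_sigma_finite_lborel)
  have mX [measurable]: "?X \<in> borel_measurable ?N"
    by (intro borel_measurable_scatter borel_measurable_component_upd)
  have mW [measurable]: "(\<lambda>x. ?W (?X x)) \<in> borel_measurable ?N"
  proof (rule measurable_compose[OF mX])
    show "?W \<in> borel_measurable borel" by measurable
  qed
  have inv: "(\<integral>\<^sup>+x. ?W (?X x) * F (cong_mat g (?X x)) \<partial>?N) = (\<integral>\<^sup>+x. ?W (?X x) * F (?X x) \<partial>?N)"
    if g: "det g \<noteq> 0" and [measurable]: "F \<in> borel_measurable borel" for g F
  proof -
    have W: "?W A = ennreal (\<bar>det g\<bar> ^ m) * ?W (cong_mat g A)" for A
    proof (cases "pos_def_matrix A")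
      case True
      have "\<bar>det g\<bar> * \<bar>det g\<bar> = \<bar>det g\<bar> powr 2" using g by (simp add: power2_eq_square)
      then have "det (cong_mat g A) = \<bar>det g\<bar> powr 2 * det A"
        by (simp add: det_mul)
      moreover have "2 * (- real m / 2) = - real m" by simp
      ultimately have "det (cong_mat g A) powr (- real m / 2) = \<bar>det g\<bar> powr (- real m) * det A powr (- real m / 2)"
        using pos_def_det_pos[OF True] by (simp only: powr_mult powr_powr powr_ge_zero less_imp_le)
      then have "\<bar>det g\<bar> ^ m * det (cong_mat g A) powr (- real m / 2) = det A powr (- real m / 2)"
        using g by (simp add: powr_minus powr_realpow)
      then show ?thesis using True pos_def_cong_iff[OF g] by (simp add: ennreal_mult'[symmetric])
    qed (simp add: pos_def_cong_iff[OF g])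
    let ?H = "\<lambda>x. ?W (?X x) * F (?X x)"
    have g': "det (matrix ((*v) g)) \<noteq> 0" using g by simp
    have H: "(\<integral>\<^sup>+x. ?H (\<lambda>j\<in>{..<m}. g *v x j) \<partial>?N) = (\<Prod>i\<in>{..<m}. ennreal (1 / \<bar>det g\<bar>)) * (\<integral>\<^sup>+x. ?H x \<partial>?N)"
    proof (rule nn_integral_PiM_componentwise[OF product_sigma_finite_lborel])
      fix F :: "real^'p \<Rightarrow> ennreal" assume "F \<in> borel_measurable lborel"
      then have "(\<integral>\<^sup>+x. F x \<partial>lborel) = ennreal \<bar>det g\<bar> * (\<integral>\<^sup>+x. F (g *v x) \<partial>lborel)"
        using nn_integral_lborel_matrix[OF g, of F] by simp
      then have "ennreal (1 / \<bar>det g\<bar>) * (\<integral>\<^sup>+x. F x \<partial>lborel) =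
          (ennreal (1 / \<bar>det g\<bar>) * ennreal \<bar>det g\<bar>) * (\<integral>\<^sup>+x. F (g *v x) \<partial>lborel)"
        by (simp add: mult.assoc)
      also have "ennreal (1 / \<bar>det g\<bar>) * ennreal \<bar>det g\<bar> = 1" using g by (simp add: ennreal_mult'[symmetric])
      finally show "(\<integral>\<^sup>+x. F (g *v x) \<partial>lborel) = ennreal (1 / \<bar>det g\<bar>) * (\<integral>\<^sup>+x. F x \<partial>lborel)" by simp
    qed (auto intro: borel_measurable_linear)
    have X: "?X (\<lambda>j\<in>{..<m}. g *v x j) = cong_mat g (?X x)" for x
      unfolding scatter_linear[symmetric] by (rule scatter_cong) auto
    have "(\<integral>\<^sup>+x. ?W (?X x) * F (cong_mat g (?X x)) \<partial>?N) = ennreal (\<bar>det g\<bar> ^ m) * (\<integral>\<^sup>+x. ?H (\<lambda>j\<in>{..<m}. g *v x j) \<partial>?N)"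
      unfolding X W[of "?X _"] by (subst nn_integral_cmult[symmetric]) (auto simp: mult.assoc)
    also have "\<dots> = (ennreal (\<bar>det g\<bar> ^ m) * (\<Prod>i\<in>{..<m}. ennreal (1 / \<bar>det g\<bar>))) * (\<integral>\<^sup>+x. ?H x \<partial>?N)"
      unfolding H by (simp only: mult.assoc)
    also have "ennreal (\<bar>det g\<bar> ^ m) * (\<Prod>i\<in>{..<m}. ennreal (1 / \<bar>det g\<bar>)) = 1"
      using g by (simp add: ennreal_power ennreal_mult'[symmetric] power_one_over)
    finally show ?thesis by (simp only: mult_1)
  qed
  have "\<exists>K. \<forall>F\<in>borel_measurable borel. (\<integral>\<^sup>+x. ?W (?X x) * F (?X x) \<partial>?N) = K * (\<integral>\<^sup>+v. sym_weight v * F (sym_of v) \<partial>lborel)"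
    by (rule invariant_integral_eq[OF sigma_finite mX mW inv]) (auto split: if_splits)
  then obtain K where K: "\<And>F. F \<in> borel_measurable borel \<Longrightarrow>
    (\<integral>\<^sup>+x. ?W (?X x) * F (?X x) \<partial>?N) = K * (\<integral>\<^sup>+v. sym_weight v * F (sym_of v) \<partial>lborel)" by blast
  show ?thesis
  proof (intro exI[of _ K] ballI)
    fix G :: "real^'p^'p \<Rightarrow> ennreal" assume [measurable]: "G \<in> borel_measurable borel"
    \<comment> \<open>The added power undoes the weight wherever the scatter matrix is positive
      definite, that is, almost everywhere.\<close>
    let ?F = "\<lambda>A. ennreal (det A powr (real m / 2)) * G A"
    have 1: "?W A * ?F A = G A" if "pos_def_matrix A" for A
      using that pos_def_det_pos[OF that]
      by (simp add: mult.assoc[symmetric] ennreal_mult'[symmetric] powr_add[symmetric])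
    have 2: "sym_weight v * ?F (sym_of v) = ennreal (if pos_def_matrix (sym_of v)
       then det (sym_of v) powr ((real m - real CARD('p) - 1) / 2) else 0) * G (sym_of v)" for v
    proof (cases "pos_def_matrix (sym_of v)")
      case True
      have "- (real CARD('p) + 1) / 2 + real m / 2 = (real m - real CARD('p) - 1) / 2"
        by (simp add: field_simps)
      then have e: "det (sym_of v) powr (- (real CARD('p) + 1) / 2) * det (sym_of v) powr (real m / 2) =
          det (sym_of v) powr ((real m - real CARD('p) - 1) / 2)"
        by (simp only: powr_add[symmetric])
      show ?thesis
        by (simp only: sym_weight_def True if_True mult.assoc[symmetric] ennreal_mult'[symmetric] powr_ge_zero e)
    qed (simp add: sym_weight_def)
    have "(\<integral>\<^sup>+x. G (?X x) \<partial>?N) = (\<integral>\<^sup>+x. ?W (?X x) * ?F (?X x) \<partial>?N)"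
    proof (rule nn_integral_cong_AE)
      show "AE x in ?N. G (?X x) = ?W (?X x) * ?F (?X x)"
        using AE_scatter_pos_def[OF p] by eventually_elim (rule 1[symmetric])
    qed
    also have "\<dots> = K * (\<integral>\<^sup>+v. sym_weight v * ?F (sym_of v) \<partial>lborel)"
      by (rule K) measurable
    finally show "(\<integral>\<^sup>+x. G (?X x) \<partial>?N) = K * (\<integral>\<^sup>+v. ennreal (if pos_def_matrix (sym_of v)
       then det (sym_of v) powr ((real m - real CARD('p) - 1) / 2) else 0) * G (sym_of v) \<partial>lborel)"
      unfolding 2 .
  qed
qed

lemma mvnormal_density_eq:
  fixes L :: "real^'p::finite^'p"
  assumes "pos_def_matrix L"
  shows "mvnormal_density \<mu> (matrix_inv L) x =
    exp (- ((x - \<mu>) \<bullet> (L *v (x - \<mu>))) / 2) / sqrt ((2 * pi) ^ CARD('p) * det (matrix_inv L))"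
  using assms by (simp add: mvnormal_density_def matrix_inv_inv_pos_def)

lemma borel_measurable_mvnormal_density [measurable]:
  "mvnormal_density \<mu> \<Sigma> \<in> borel_measurable borel"
  unfolding mvnormal_density_def by measurable

text \<open>The density of the sample is a function of the scatter matrix times a function of the
  mean. Integrating out the mean leaves a constant, and what remains is the Lebesgue image times the
  exponential of the trace. The location \<mu> survives only inside \<open>K\<close>.\<close>

lemma scatter_law:
  fixes L :: "real^'p::finite^'p" and Y :: "nat \<Rightarrow> 'a \<Rightarrow> real^'p"
  assumes L: "pos_def_matrix L" and p: "CARD('p) + 1 \<le> n"
    and Y: "\<And>j. j < n \<Longrightarrow> Y j \<in> borel_measurable M"
    and P: "prob_space (density lborel (\<lambda>x. ennreal (mvnormal_density \<mu> (matrix_inv L) x)))"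
    and D: "distr M (PiM {..<n} (\<lambda>_. borel)) (\<lambda>\<omega>. \<lambda>j\<in>{..<n}. Y j \<omega>) =
      PiM {..<n} (\<lambda>_. density lborel (\<lambda>x. ennreal (mvnormal_density \<mu> (matrix_inv L) x)))"
  shows "\<exists>K. \<forall>F\<in>borel_measurable borel. (\<integral>\<^sup>+\<omega>. F (scatter n (\<lambda>j. Y j \<omega>)) \<partial>M) =
    K * (\<integral>\<^sup>+v. ennreal (wishart_weight n L v) * F (sym_of v) \<partial>lborel)"
proof -
  obtain m where n: "n = Suc m" and pm: "CARD('p) \<le> m" using p by (cases n) auto
  let ?f = "mvnormal_density \<mu> (matrix_inv L)"
  interpret Pr: prob_space "density lborel (\<lambda>x. ennreal (?f x))" by (rule P)
  have psf: "product_sigma_finite (\<lambda>_::nat. density lborel (\<lambda>x. ennreal (?f x)))"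
    by (simp add: product_sigma_finite_def Pr.sigma_finite_measure_axioms)
  have dens: "PiM {..<n} (\<lambda>_. density lborel (\<lambda>x. ennreal (?f x))) =
      density (lborel_pow n) (\<lambda>y. \<Prod>j\<in>{..<n}. ennreal (?f (y j)))"
    by (rule PiM_density[OF product_sigma_finite_lborel _ _ psf]) auto
  define c where "c = 1 / sqrt ((2 * pi) ^ CARD('p) * det (matrix_inv L))"
  have c0: "c \<ge> 0"
    using pos_def_det_pos[OF pos_def_matrix_inv[OF L]] by (simp add: c_def)
  let ?e = "\<lambda>A. ennreal (c ^ n * exp (- trace (L ** A) / 2))"
  let ?k = "\<lambda>w. ennreal (exp (- real n * ((w - \<mu>) \<bullet> (L *v (w - \<mu>))) / 2))"
  have prod: "(\<Prod>j\<in>{..<n}. ennreal (?f (y j))) = ?e (scatter n y) * ?k (sample_mean n y)" for y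
  proof -
    have "(\<Prod>j\<in>{..<n}. ennreal (?f (y j))) = ennreal (\<Prod>j\<in>{..<n}. ?f (y j))"
      using c0 by (intro prod_ennreal) (simp add: mvnormal_density_eq[OF L] c_def)
    also have "(\<Prod>j\<in>{..<n}. ?f (y j)) = (\<Prod>j\<in>{..<n}. c * exp (- ((y j - \<mu>) \<bullet> (L *v (y j - \<mu>))) / 2))"
      by (simp add: mvnormal_density_eq[OF L] c_def)
    also have "\<dots> = c ^ n * exp (\<Sum>j<n. - ((y j - \<mu>) \<bullet> (L *v (y j - \<mu>))) / 2)"
      by (simp add: prod.distrib exp_sum)
    also have "(\<Sum>j<n. - ((y j - \<mu>) \<bullet> (L *v (y j - \<mu>))) / 2) = - (\<Sum>j<n. (y j - \<mu>) \<bullet> (L *v (y j - \<mu>))) / 2"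
      by (simp add: sum_negf sum_divide_distrib)
    also have "\<dots> = - trace (L ** scatter n y) / 2 + - real n * ((sample_mean n y - \<mu>) \<bullet> (L *v (sample_mean n y - \<mu>))) / 2"
      using n by (subst sum_quadratic_form_decomposition) (auto simp: field_simps)
    finally show ?thesis by (simp only: exp_add mult.assoc[symmetric] ennreal_mult'' exp_ge_zero)
  qed
  from nn_integral_scatter_lborel[OF pm] obtain K where K: "\<And>G. G \<in> borel_measurable borel \<Longrightarrow>
    (\<integral>\<^sup>+x. G (scatter (Suc m) (x(m := 0))) \<partial>(lborel_pow m :: (nat \<Rightarrow> real^'p) measure)) =
    K * (\<integral>\<^sup>+v. ennreal (if pos_def_matrix (sym_of v)
       then det (sym_of v) powr ((real m - real CARD('p) - 1) / 2) else 0) * G (sym_of v) \<partial>lborel)" by blast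
  let ?K = "(\<integral>\<^sup>+w. ?k w \<partial>lborel) * K * ennreal (c ^ n)"
  show ?thesis
  proof (intro exI[of _ ?K] ballI)
    fix F :: "real^'p^'p \<Rightarrow> ennreal" assume F [measurable]: "F \<in> borel_measurable borel"
    have comp: "(\<lambda>y. y j) \<in> borel_measurable (PiM {..<n} (\<lambda>_. borel :: (real^'p) measure))" if "j < n" for j
      using measurable_component_singleton[of j "{..<n}" "\<lambda>_. borel :: (real^'p) measure"] that by simp
    have sc [measurable]: "(\<lambda>y. scatter n y) \<in> borel_measurable (PiM {..<n} (\<lambda>_. borel :: (real^'p) measure))"
      by (intro borel_measurable_scatter comp)
    have sm [measurable]: "(\<lambda>y. sample_mean n y) \<in> borel_measurable (PiM {..<n} (\<lambda>_. borel :: (real^'p) measure))"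
      by (intro borel_measurable_sample_mean comp)
    have sets: "sets (lborel_pow n :: (nat \<Rightarrow> real^'p) measure) = sets (PiM {..<n} (\<lambda>_. borel))"
      by (intro sets_PiM_cong) auto
    note mc = measurable_cong_sets[OF sets refl]
    have mY: "(\<lambda>\<omega>. \<lambda>j\<in>{..<n}. Y j \<omega>) \<in> measurable M (PiM {..<n} (\<lambda>_. borel))"
      using Y by (intro measurable_restrict) auto
    have "(\<integral>\<^sup>+\<omega>. F (scatter n (\<lambda>j. Y j \<omega>)) \<partial>M) = (\<integral>\<^sup>+\<omega>. F (scatter n (\<lambda>j\<in>{..<n}. Y j \<omega>)) \<partial>M)"
      by (intro nn_integral_cong arg_cong[where f = F] scatter_cong) auto
    also have "\<dots> = (\<integral>\<^sup>+y. F (scatter n y) \<partial>distr M (PiM {..<n} (\<lambda>_. borel)) (\<lambda>\<omega>. \<lambda>j\<in>{..<n}. Y j \<omega>))"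
      by (subst nn_integral_distr[OF mY]) measurable
    also have "\<dots> = (\<integral>\<^sup>+y. (\<Prod>j\<in>{..<n}. ennreal (?f (y j))) * F (scatter n y) \<partial>lborel_pow n)"
      unfolding D dens unfolding prod by (subst nn_integral_density) (auto simp: mc)
    also have "\<dots> = (\<integral>\<^sup>+y. (?e (scatter (Suc m) y) * F (scatter (Suc m) y)) * ?k (sample_mean (Suc m) y) \<partial>lborel_pow (Suc m))"
      unfolding prod unfolding n by (simp only: mult_ac)
    also have "\<dots> = (\<integral>\<^sup>+w. ?k w \<partial>lborel) * (\<integral>\<^sup>+x. ?e (scatter (Suc m) (x(m := 0))) * F (scatter (Suc m) (x(m := 0))) \<partial>lborel_pow m)"
      by (rule nn_integral_scatter_mean) measurable
    also have "(\<integral>\<^sup>+x. ?e (scatter (Suc m) (x(m := 0))) * F (scatter (Suc m) (x(m := 0))) \<partial>lborel_pow m) =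
      K * (\<integral>\<^sup>+v. ennreal (if pos_def_matrix (sym_of v)
       then det (sym_of v) powr ((real m - real CARD('p) - 1) / 2) else 0) * (?e (sym_of v) * F (sym_of v)) \<partial>lborel)"
      by (rule K) measurable
    also have "(\<integral>\<^sup>+v. ennreal (if pos_def_matrix (sym_of v)
       then det (sym_of v) powr ((real m - real CARD('p) - 1) / 2) else 0) * (?e (sym_of v) * F (sym_of v)) \<partial>lborel)
      = (\<integral>\<^sup>+v. ennreal (c ^ n) * (ennreal (wishart_weight n L v) * F (sym_of v)) \<partial>lborel)"
    proof (rule nn_integral_cong)
      fix v :: "real^('p uprod)"
      show "ennreal (if pos_def_matrix (sym_of v)
       then det (sym_of v) powr ((real m - real CARD('p) - 1) / 2) else 0) * (?e (sym_of v) * F (sym_of v)) =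
        ennreal (c ^ n) * (ennreal (wishart_weight n L v) * F (sym_of v))"
      proof (cases "pos_def_matrix (sym_of v)")
        case True
        have e: "real m - real CARD('p) - 1 = real n - real CARD('p) - 2" using n by simp
        show ?thesis using True c0 unfolding e
          by (simp add: wishart_weight_def ennreal_mult' mult_ac)
      qed (simp add: wishart_weight_def)
    qed
    also have "\<dots> = ennreal (c ^ n) * (\<integral>\<^sup>+v. ennreal (wishart_weight n L v) * F (sym_of v) \<partial>lborel)"
      by (rule nn_integral_cmult) measurable
    finally show "(\<integral>\<^sup>+\<omega>. F (scatter n (\<lambda>j. Y j \<omega>)) \<partial>M) = ?K * (\<integral>\<^sup>+v. ennreal (wishart_weight n L v) * F (sym_of v) \<partial>lborel)"
      by (simp only: mult_ac)
  qed
qed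

section \<open>Probability integral transform along rays\<close>

text \<open>Probability integral transform for an unnormalized density h. A measure with a density
  has no atoms, so its distribution function is continuous and attains every intermediate level. As
  h may vanish on intervals, that function need not be injective; the leftmost point of the level
  makes the set in question a closed half-line.\<close>

lemma emeasure_superlevel_cdf:
  fixes h :: "real \<Rightarrow> ennreal"
  assumes [measurable]: "h \<in> borel_measurable borel"
    and fin: "(\<integral>\<^sup>+t. h t \<partial>lborel) < \<infinity>" and pos: "(\<integral>\<^sup>+t. h t \<partial>lborel) > 0"
    and x: "0 < x" "x < 1"
  shows "(\<integral>\<^sup>+r. h r * (if (\<integral>\<^sup>+t. h t * indicator {r<..} t \<partial>lborel) \<le> ennreal x * (\<integral>\<^sup>+t. h t \<partial>lborel) then 1 else 0) \<partial>lborel)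
    = ennreal x * (\<integral>\<^sup>+t. h t \<partial>lborel)"
proof -
  define M where "M = density lborel h"
  define q where "q = measure M UNIV"
  have tot: "emeasure M UNIV = (\<integral>\<^sup>+t. h t \<partial>lborel)" by (simp add: M_def emeasure_density)
  interpret finite_borel_measure M
  proof (intro finite_borel_measure.intro finite_measureI finite_borel_measure_axioms.intro)
    show "emeasure M (space M) \<noteq> \<infinity>" using fin tot by (simp add: M_def less_top)
  qed (simp_all add: M_def)
  have q: "(\<integral>\<^sup>+t. h t \<partial>lborel) = ennreal q" unfolding tot[symmetric] q_def by (rule emeasure_eq_measure)
  have q0: "q > 0" using pos unfolding q by simp
  have [simp]: "sets M = sets borel" "space M = UNIV" by (simp_all add: M_def)
  have atom: "measure M {r} = 0" for r
  proof -
    have "emeasure M {r} = (\<integral>\<^sup>+t. h t * indicator {r} t \<partial>lborel)" by (simp add: M_def emeasure_density)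
    also have "\<dots> = (\<integral>\<^sup>+t. 0 \<partial>(lborel :: real measure))"
      using AE_lborel_singleton[of r] by (intro nn_integral_cong_AE) (auto elim!: eventually_mono simp: indicator_def)
    finally show ?thesis by (simp add: measure_def)
  qed
  then have cont: "isCont (cdf M) r" for r by (simp add: isCont_cdf)
  have "(\<integral>\<^sup>+t. h t * indicator {r<..} t \<partial>lborel) = ennreal (q - cdf M r)" for r
  proof -
    have "UNIV - {..r} = {r<..}" by auto
    then have m: "measure M {r<..} = q - cdf M r"
      using finite_measure_compl[of "{..r}"] by (simp add: q_def cdf_def)
    have "(\<integral>\<^sup>+t. h t * indicator {r<..} t \<partial>lborel) = emeasure M {r<..}" by (simp add: M_def emeasure_density)
    also have "\<dots> = ennreal (q - cdf M r)" unfolding m[symmetric] by (rule emeasure_eq_measure)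
    finally show ?thesis .
  qed
  then have tail: "(\<integral>\<^sup>+t. h t * indicator {r<..} t \<partial>lborel) \<le> ennreal x * (\<integral>\<^sup>+t. h t \<partial>lborel) \<longleftrightarrow> (1 - x) * q \<le> cdf M r" for r
    using x q0 by (simp add: q ennreal_mult'[symmetric] ennreal_le_iff algebra_simps)
  \<comment> \<open>The tail beyond r is at most the fraction x of the total mass q exactly when the
    distribution function at r is at least c.\<close>
  define c where "c = (1 - x) * q"
  have c: "0 < c" "c < q" using x q0 by (auto simp: c_def algebra_simps)
  have top: "(cdf M \<longlongrightarrow> q) at_top" unfolding q_def using cdf_lim_at_top by simp
  have bot: "(cdf M \<longlongrightarrow> 0) at_bot" by (rule cdf_lim_at_bot)
  obtain b where b: "c < cdf M b"
    using order_tendstoD(1)[OF top c(2)] by (auto simp: eventually_at_top_linorder)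
  obtain a where a: "\<And>r. r \<le> a \<Longrightarrow> cdf M r < c"
    using order_tendstoD(2)[OF bot c(1)] by (auto simp: eventually_at_bot_linorder)
  have ab: "a \<le> b"
    using a[of b] b by (meson linorder_le_cases not_less_iff_gr_or_eq)
  have "continuous_on {a..b} (cdf M)" using cont by (simp add: continuous_at_imp_continuous_on)
  then obtain r1 where r1: "cdf M r1 = c"
    using IVT'[of "cdf M" a c b] a[of a] b ab by auto
  let ?S = "{r. c \<le> cdf M r}"
  have "closed ?S"
    using cont by (intro closed_Collect_le continuous_on_const continuous_at_imp_continuous_on) auto
  moreover have bdd: "bdd_below ?S"
    using a by (intro bdd_belowI[of _ a]) (metis linorder_le_cases mem_Collect_eq not_less)
  moreover have "?S \<noteq> {}" using r1 by auto
  ultimately have r0: "Inf ?S \<in> ?S" by (intro closed_contains_Inf)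
  define r0 where "r0 = Inf ?S"
  have S: "?S = {r0..}"
  proof
    show "?S \<subseteq> {r0..}" using bdd by (auto simp: r0_def intro: cInf_lower)
    show "{r0..} \<subseteq> ?S" using r0 cdf_nondecreasing unfolding r0_def by (auto intro: order_trans)
  qed
  have "r1 \<in> ?S" using r1 by simp
  then have "r0 \<le> r1" unfolding S by simp
  then have "cdf M r0 \<le> c" using r1 cdf_nondecreasing by metis
  then have cr0: "cdf M r0 = c" using r0 by (simp add: r0_def)
  have u: "{..r0} = {..<r0} \<union> {r0}" by auto
  have "cdf M r0 = measure M {..<r0} + measure M {r0}"
    unfolding cdf_def u by (rule finite_measure_Union) auto
  then have "measure M {..<r0} = c" using atom cr0 by simp
  moreover have "{r0..} = UNIV - {..<r0}" by auto
  ultimately have m: "measure M {r0..} = q - c"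
    using finite_measure_compl[of "{..<r0}"] by (simp add: q_def)
  have "(\<integral>\<^sup>+r. h r * (if (\<integral>\<^sup>+t. h t * indicator {r<..} t \<partial>lborel) \<le> ennreal x * (\<integral>\<^sup>+t. h t \<partial>lborel) then 1 else 0) \<partial>lborel)
     = (\<integral>\<^sup>+r. h r * indicator {r0..} r \<partial>lborel)"
    unfolding tail c_def[symmetric] S[symmetric] by (intro nn_integral_cong) (auto simp: indicator_def)
  also have "\<dots> = emeasure M {r0..}" by (simp add: M_def emeasure_density)
  also have "\<dots> = ennreal (q - c)" unfolding m[symmetric] by (rule emeasure_eq_measure)
  also have "q - c = x * q" by (simp add: c_def algebra_simps)
  finally show ?thesis using x q0 by (simp add: q ennreal_mult')
qed

text \<open>A one-parameter group of linear maps acting as \<open>t\<close> on a subspace of dimension \<open>d\<close> and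
  trivially on a complement; \<open>N\<close> measures the distance from the fixed points, \<open>f\<close> is an
  unnormalized density along the rays and \<open>e\<close> an invariant factor.\<close>

locale dilation_group =
  fixes D :: "real \<Rightarrow> real^'m::finite \<Rightarrow> real^'m" and d :: nat and N :: "real^'m \<Rightarrow> real"
    and f e :: "real^'m \<Rightarrow> real"
  assumes D_linear: "\<And>t. linear (D t)"
    and D_det: "\<And>t. t > 0 \<Longrightarrow> \<bar>det (matrix (D t))\<bar> = t ^ d"
    and D_mult: "\<And>s t a. D s (D t a) = D (s * t) a"
    and D_1: "\<And>a. D 1 a = a"
    and d_pos: "d > 0"
    and D_meas: "(\<lambda>(t, a). D t a) \<in> borel_measurable (borel \<Otimes>\<^sub>M borel)"
    and N_meas [measurable]: "N \<in> borel_measurable borel"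
    and N_scale: "\<And>t a. t > 0 \<Longrightarrow> N (D t a) = t * N a"
    and N_pos: "AE a in lborel. N a > 0"
    and f_meas [measurable]: "f \<in> borel_measurable borel" and f_nonneg: "\<And>a. f a \<ge> 0"
    and e_meas [measurable]: "e \<in> borel_measurable borel" and e_nonneg: "\<And>a. e a \<ge> 0"
    and e_inv: "\<And>t a. t > 0 \<Longrightarrow> e (D t a) = e a"
begin

lemma D_measurable [measurable (raw)]:
  assumes "g \<in> borel_measurable M" "h \<in> borel_measurable M"
  shows "(\<lambda>x. D (g x) (h x)) \<in> borel_measurable M"
  using measurable_compose[OF measurable_Pair[OF assms] D_meas] by simp

text \<open>Taken in \<open>ennreal\<close>, so that the tails can be manipulated before their
  finiteness is known.\<close>

definition ray_tail :: "real^'m \<Rightarrow> real \<Rightarrow> ennreal" where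
  "ray_tail a r = (\<integral>\<^sup>+t. ennreal (t ^ (d - 1) * f (D t a)) * indicator {r<..} t \<partial>lborel)"

definition ray_p_value :: "real^'m \<Rightarrow> real" where
  "ray_p_value a = enn2real (ray_tail a 1) / enn2real (ray_tail a 0)"

lemma borel_measurable_ray_tail [measurable]: "(\<lambda>a. ray_tail a r) \<in> borel_measurable borel"
  unfolding ray_tail_def by measurable

lemma borel_measurable_ray_p_value [measurable]: "ray_p_value \<in> borel_measurable borel"
  unfolding ray_p_value_def by measurable

text \<open>Replaces the unit sphere: every ray with positive \<open>N\<close> meets the shell in a
  piece of measure ln e = 1 for dr/r, so that no surface measure on a cross-section has to be
  constructed.\<close>

definition shell :: "real^'m \<Rightarrow> ennreal" where
  "shell a = (if 1 \<le> N a \<and> N a < exp 1 then 1 else 0)"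

lemma borel_measurable_shell [measurable]: "shell \<in> borel_measurable borel"
  unfolding shell_def by measurable

lemma nn_integral_inverse_shell:
  assumes a: "N a > 0"
  shows "(\<integral>\<^sup>+r. ennreal (1 / r) * indicator {0<..} r * shell (D (1 / r) a) \<partial>lborel) = 1"
proof -
  define l where "l = N a / exp 1"
  let ?u = "N a"
  have lu: "0 < l" "l \<le> ?u" using a by (auto simp: l_def field_simps)
  have "(\<integral>\<^sup>+r. ennreal (1 / r) * indicator {0<..} r * shell (D (1 / r) a) \<partial>lborel) =
      (\<integral>\<^sup>+r. ennreal (1 / r) * indicator {l..?u} r \<partial>lborel)"
  proof (rule nn_integral_cong_AE)
    \<comment> \<open>The half-open shell corresponds to l < r \<le> u; discarding the null set {l}
      gives the closed interval on which the integral of 1/r is evaluated.\<close>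
    show "AE r in lborel. ennreal (1 / r) * indicator {0<..} r * shell (D (1 / r) a) = ennreal (1 / r) * indicator {l..?u} r"
      using AE_lborel_singleton[of l]
    proof eventually_elim
      case (elim r)
      show ?case
      proof (cases "r > 0")
        case True
        then have "N (D (1 / r) a) = N a / r" by (simp add: N_scale)
        moreover have "1 \<le> N a / r \<and> N a / r < exp 1 \<longleftrightarrow> l \<le> r \<and> r \<le> ?u"
          using True elim by (auto simp: l_def field_simps less_le)
        ultimately show ?thesis using True by (auto simp: shell_def indicator_def)
      next
        case False
        then show ?thesis using lu by (auto simp: indicator_def)
      qed
    qed
  qed
  also have "\<dots> = ennreal (ln ?u - ln l)"
  proof (rule nn_integral_FTC_Icc)
    fix r assume "r \<in> {l..?u}"
    then have "r > 0" using lu by auto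
    then show "(ln has_real_derivative 1 / r) (at r)" "0 \<le> 1 / r"
      by (auto intro!: derivative_eq_intros simp: divide_inverse)
  qed (use lu in auto)
  also have "ln ?u - ln l = 1" using a by (simp add: l_def ln_div)
  finally show ?thesis by simp
qed

text \<open>Insert the factor 1 provided by the shell, exchange the integrals, and substitute a = D
  r u for fixed r. The Jacobian r^d together with the weight 1/r gives r^(d - 1).\<close>

lemma nn_integral_polar:
  assumes [measurable]: "G \<in> borel_measurable borel"
  shows "(\<integral>\<^sup>+a. G a \<partial>lborel) =
    (\<integral>\<^sup>+u. shell u * (\<integral>\<^sup>+r. ennreal (r ^ (d - 1)) * indicator {0<..} r * G (D r u) \<partial>lborel) \<partial>lborel)"
proof -
  have "(\<integral>\<^sup>+a. G a \<partial>lborel) = (\<integral>\<^sup>+a. G a * (\<integral>\<^sup>+r. ennreal (1 / r) * indicator {0<..} r * shell (D (1 / r) a) \<partial>lborel) \<partial>lborel)"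
    using N_pos by (intro nn_integral_cong_AE) (auto elim!: eventually_mono simp: nn_integral_inverse_shell)
  also have "\<dots> = (\<integral>\<^sup>+a. \<integral>\<^sup>+r. G a * (ennreal (1 / r) * indicator {0<..} r * shell (D (1 / r) a)) \<partial>lborel \<partial>lborel)"
    by (intro nn_integral_cong nn_integral_cmult[symmetric]) measurable
  also have "\<dots> = (\<integral>\<^sup>+r. \<integral>\<^sup>+a. G a * (ennreal (1 / r) * indicator {0<..} r * shell (D (1 / r) a)) \<partial>lborel \<partial>lborel)"
    by (rule lborel_pair.Fubini') measurable
  also have "\<dots> = (\<integral>\<^sup>+r. \<integral>\<^sup>+u. shell u * (ennreal (r ^ (d - 1)) * indicator {0<..} r * G (D r u)) \<partial>lborel \<partial>lborel)"
  proof (rule nn_integral_cong)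
    fix r :: real
    show "(\<integral>\<^sup>+a. G a * (ennreal (1 / r) * indicator {0<..} r * shell (D (1 / r) a)) \<partial>lborel) =
      (\<integral>\<^sup>+u. shell u * (ennreal (r ^ (d - 1)) * indicator {0<..} r * G (D r u)) \<partial>lborel)"
    proof (cases "r > 0")
      case True
      have det0: "det (matrix (D (1 / r))) \<noteq> 0" "\<bar>det (matrix (D (1 / r)))\<bar> = (1 / r) ^ d"
        using D_det[of "1 / r"] True by auto
      have "(\<integral>\<^sup>+u. shell u * (ennreal (r ^ (d - 1)) * indicator {0<..} r * G (D r u)) \<partial>lborel) =
        ennreal ((1 / r) ^ d) * (\<integral>\<^sup>+a. shell (D (1 / r) a) * (ennreal (r ^ (d - 1)) * indicator {0<..} r * G (D r (D (1 / r) a))) \<partial>lborel)"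
        unfolding det0(2)[symmetric] by (rule nn_integral_lborel_linear[OF D_linear det0(1)]) measurable
      also have "\<dots> = (\<integral>\<^sup>+a. ennreal ((1 / r) ^ d) * (shell (D (1 / r) a) * (ennreal (r ^ (d - 1)) * G a)) \<partial>lborel)"
        using True by (subst nn_integral_cmult[symmetric]) (auto simp: D_mult D_1)
      also have "\<dots> = (\<integral>\<^sup>+a. G a * (ennreal (1 / r) * indicator {0<..} r * shell (D (1 / r) a)) \<partial>lborel)"
      proof (rule nn_integral_cong)
        fix a
        have "(1 / r) ^ d * r ^ (d - 1) = 1 / r"
          using True d_pos by (cases d) (auto simp: power_one_over field_simps)
        then have "ennreal ((1 / r) ^ d) * ennreal (r ^ (d - 1)) = ennreal (1 / r)"
          using True by (simp add: ennreal_mult'[symmetric])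
        moreover have "ennreal ((1 / r) ^ d) * (shell (D (1 / r) a) * (ennreal (r ^ (d - 1)) * G a)) =
          (ennreal ((1 / r) ^ d) * ennreal (r ^ (d - 1))) * (shell (D (1 / r) a) * G a)"
          by (simp only: mult_ac)
        ultimately show "ennreal ((1 / r) ^ d) * (shell (D (1 / r) a) * (ennreal (r ^ (d - 1)) * G a)) =
          G a * (ennreal (1 / r) * indicator {0<..} r * shell (D (1 / r) a))"
          using True by (simp add: mult_ac)
      qed
      finally show ?thesis by simp
    qed simp
  qed
  also have "\<dots> = (\<integral>\<^sup>+u. \<integral>\<^sup>+r. shell u * (ennreal (r ^ (d - 1)) * indicator {0<..} r * G (D r u)) \<partial>lborel \<partial>lborel)"
    by (rule lborel_pair.Fubini'[symmetric]) measurable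
  also have "\<dots> = (\<integral>\<^sup>+u. shell u * (\<integral>\<^sup>+r. ennreal (r ^ (d - 1)) * indicator {0<..} r * G (D r u) \<partial>lborel) \<partial>lborel)"
    by (intro nn_integral_cong nn_integral_cmult) measurable
  finally show ?thesis .
qed

text \<open>The rays through u and through \<open>D r u\<close> are the same up to rescaling the
  parameter by r. So the p-value of \<open>D r u\<close> is the tail of the fixed ray of u beyond r,
  divided by its total.\<close>

lemma ray_tail_D:
  assumes r: "r > 0" and s: "s \<ge> 0"
  shows "ray_tail u (r * s) = ennreal (r ^ d) * ray_tail (D r u) s"
proof -
  have "ray_tail u (r * s) = ennreal \<bar>r\<bar> * (\<integral>\<^sup>+t. ennreal ((0 + r * t) ^ (d - 1) * f (D (0 + r * t) u)) * indicator {r * s<..} (0 + r * t) \<partial>lborel)"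
    unfolding ray_tail_def using r by (intro nn_integral_real_affine) auto
  also have "\<dots> = (\<integral>\<^sup>+t. ennreal r * (ennreal ((r * t) ^ (d - 1) * f (D (r * t) u)) * indicator {r * s<..} (r * t)) \<partial>lborel)"
    using r by (subst nn_integral_cmult[symmetric]) auto
  also have "\<dots> = (\<integral>\<^sup>+t. ennreal (r ^ d) * (ennreal (t ^ (d - 1) * f (D t (D r u))) * indicator {s<..} t) \<partial>lborel)"
  proof (rule nn_integral_cong)
    fix t :: real
    show "ennreal r * (ennreal ((r * t) ^ (d - 1) * f (D (r * t) u)) * indicator {r * s<..} (r * t)) =
      ennreal (r ^ d) * (ennreal (t ^ (d - 1) * f (D t (D r u))) * indicator {s<..} t)"
    proof (cases "t > s")
      case True
      have "r * ((r * t) ^ (d - 1) * f (D (r * t) u)) = r ^ d * (t ^ (d - 1) * f (D t (D r u)))"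
        using d_pos by (cases d) (auto simp: power_mult_distrib D_mult mult_ac)
      then show ?thesis using r True by (simp add: ennreal_mult'[symmetric])
    qed (use r in simp)
  qed
  also have "\<dots> = ennreal (r ^ d) * ray_tail (D r u) s"
    unfolding ray_tail_def by (subst nn_integral_cmult) auto
  finally show ?thesis .
qed

lemma ray_p_value_le_iff:
  assumes r: "r > 0" and fin: "ray_tail u 0 < \<infinity>" and pos: "ray_tail u 0 > 0" and x: "x > 0"
  shows "ray_p_value (D r u) \<le> x \<longleftrightarrow> ray_tail u r \<le> ennreal x * ray_tail u 0"
proof -
  define A where "A = enn2real (ray_tail (D r u) 1)"
  define B where "B = enn2real (ray_tail (D r u) 0)"
  have e: "ray_tail u r = ennreal (r ^ d) * ray_tail (D r u) 1" "ray_tail u 0 = ennreal (r ^ d) * ray_tail (D r u) 0"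
    using ray_tail_D[OF r, of 1 u] ray_tail_D[OF r, of 0 u] by auto
  have rd: "r ^ d > 0" using r by simp
  have "ray_tail (D r u) 1 \<le> ray_tail (D r u) 0"
    unfolding ray_tail_def by (intro nn_integral_mono) (auto simp: indicator_def)
  moreover have f0: "ray_tail (D r u) 0 < \<infinity>"
  proof -
    have "ennreal (r ^ d) \<noteq> 0" using rd by (simp add: ennreal_eq_0_iff not_le del: zero_less_power_eq)
    then show ?thesis using fin unfolding e
      by (metis ennreal_mult_less_top ennreal_zero_less_top infinity_ennreal_def)
  qed
  ultimately have "ray_tail (D r u) 1 < \<infinity>" by (rule order.strict_trans1)
  then have A: "ray_tail (D r u) 1 = ennreal A" and B: "ray_tail (D r u) 0 = ennreal B"
    using f0 by (simp_all add: A_def B_def)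
  have nn: "A \<ge> 0" "B \<ge> 0" by (simp_all add: A_def B_def)
  have "B > 0" using pos unfolding e B by (auto simp: ennreal_zero_less_mult_iff)
  then show ?thesis
    unfolding ray_p_value_def e A B using nn rd x
    by (simp add: ennreal_mult'[symmetric] ennreal_le_iff divide_le_eq mult_ac)
qed

text \<open>On each ray the position r has unnormalized density r^(d - 1) f(D r u), and the p-value
  is its normalized upper tail; hence the sublevel set carries the fraction x of every ray. The
  factor e is constant on rays and comes out of the inner integral. Rays of mass zero satisfy the
  identity trivially.\<close>

lemma ray_p_value_uniform:
  assumes x: "0 < x" "x < 1" and fin: "\<And>u. N u > 0 \<Longrightarrow> ray_tail u 0 < \<infinity>"
  shows "(\<integral>\<^sup>+a. ennreal (f a * e a) * (if ray_p_value a \<le> x then 1 else 0) \<partial>lborel) =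
    ennreal x * (\<integral>\<^sup>+a. ennreal (f a * e a) \<partial>lborel)"
proof -
  let ?h = "\<lambda>u r. ennreal (r ^ (d - 1) * f (D r u)) * indicator {0<..} r"
  have tail0: "ray_tail u 0 = (\<integral>\<^sup>+r. ?h u r \<partial>lborel)" for u by (simp add: ray_tail_def)
  have inner: "(\<integral>\<^sup>+r. ennreal (r ^ (d - 1)) * indicator {0<..} r * (ennreal (f (D r u) * e (D r u)) * g r) \<partial>lborel)
    = ennreal (e u) * (\<integral>\<^sup>+r. ?h u r * g r \<partial>lborel)" if [measurable]: "g \<in> borel_measurable borel" for u g
  proof -
    have "(\<integral>\<^sup>+r. ennreal (r ^ (d - 1)) * indicator {0<..} r * (ennreal (f (D r u) * e (D r u)) * g r) \<partial>lborel)
       = (\<integral>\<^sup>+r. ennreal (e u) * (?h u r * g r) \<partial>lborel)"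
      by (intro nn_integral_cong)
        (auto simp: indicator_def e_inv ennreal_mult' f_nonneg e_nonneg mult_ac)
    then show ?thesis by (subst (asm) nn_integral_cmult) auto
  qed
  have key: "(\<integral>\<^sup>+r. ?h u r * (if ray_p_value (D r u) \<le> x then 1 else 0) \<partial>lborel) = ennreal x * (\<integral>\<^sup>+r. ?h u r \<partial>lborel)"
    if u: "N u > 0" for u
  proof (cases "ray_tail u 0 = 0")
    case True
    have "(\<integral>\<^sup>+r. ?h u r * (if ray_p_value (D r u) \<le> x then 1 else 0) \<partial>lborel) \<le> (\<integral>\<^sup>+r. ?h u r \<partial>lborel)"
      by (intro nn_integral_mono) auto
    then show ?thesis using True unfolding tail0 by simp
  next
    case False
    then have pos: "ray_tail u 0 > 0" by (simp add: zero_less_iff_neq_zero)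
    have "(\<integral>\<^sup>+r. ?h u r * (if ray_p_value (D r u) \<le> x then 1 else 0) \<partial>lborel) =
      (\<integral>\<^sup>+r. ?h u r * (if (\<integral>\<^sup>+t. ?h u t * indicator {r<..} t \<partial>lborel) \<le> ennreal x * (\<integral>\<^sup>+t. ?h u t \<partial>lborel) then 1 else 0) \<partial>lborel)"
    proof (rule nn_integral_cong)
      fix r :: real
      show "?h u r * (if ray_p_value (D r u) \<le> x then 1 else 0) =
        ?h u r * (if (\<integral>\<^sup>+t. ?h u t * indicator {r<..} t \<partial>lborel) \<le> ennreal x * (\<integral>\<^sup>+t. ?h u t \<partial>lborel) then 1 else 0)"
      proof (cases "r > 0")
        case True
        have "(\<integral>\<^sup>+t. ?h u t * indicator {r<..} t \<partial>lborel) = ray_tail u r"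
          unfolding ray_tail_def using True by (intro nn_integral_cong) (auto simp: indicator_def)
        then show ?thesis
          using ray_p_value_le_iff[OF True fin[OF u] pos x(1)] by (simp add: tail0)
      qed simp
    qed
    also have "\<dots> = ennreal x * (\<integral>\<^sup>+r. ?h u r \<partial>lborel)"
    proof (rule emeasure_superlevel_cdf[OF _ _ _ x])
      show "(\<integral>\<^sup>+r. ?h u r \<partial>lborel) < \<infinity>" using fin[OF u] unfolding tail0 .
      show "(\<integral>\<^sup>+r. ?h u r \<partial>lborel) > 0" using pos unfolding tail0 .
    qed measurable
    finally show ?thesis .
  qed
  have "(\<integral>\<^sup>+a. ennreal (f a * e a) * (if ray_p_value a \<le> x then 1 else 0) \<partial>lborel) =
    (\<integral>\<^sup>+u. shell u * (\<integral>\<^sup>+r. ennreal (r ^ (d - 1)) * indicator {0<..} r * (ennreal (f (D r u) * e (D r u)) * (if ray_p_value (D r u) \<le> x then 1 else 0)) \<partial>lborel) \<partial>lborel)"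
    by (rule nn_integral_polar) measurable
  also have "\<dots> = (\<integral>\<^sup>+u. shell u * (ennreal (e u) * (\<integral>\<^sup>+r. ?h u r * (if ray_p_value (D r u) \<le> x then 1 else 0) \<partial>lborel)) \<partial>lborel)"
    by (subst inner) auto
  also have "\<dots> = (\<integral>\<^sup>+u. ennreal x * (shell u * (ennreal (e u) * (\<integral>\<^sup>+r. ?h u r * 1 \<partial>lborel))) \<partial>lborel)"
  proof (rule nn_integral_cong)
    fix u
    show "shell u * (ennreal (e u) * (\<integral>\<^sup>+r. ?h u r * (if ray_p_value (D r u) \<le> x then 1 else 0) \<partial>lborel)) =
      ennreal x * (shell u * (ennreal (e u) * (\<integral>\<^sup>+r. ?h u r * 1 \<partial>lborel)))"
    proof (cases "N u > 0")
      case True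
      then show ?thesis unfolding key[OF True] mult.right_neutral by (simp only: mult_ac)
    qed (auto simp: shell_def)
  qed
  also have "\<dots> = ennreal x * (\<integral>\<^sup>+u. shell u * (ennreal (e u) * (\<integral>\<^sup>+r. ?h u r * 1 \<partial>lborel)) \<partial>lborel)"
    by (rule nn_integral_cmult) measurable
  also have "(\<integral>\<^sup>+u. shell u * (ennreal (e u) * (\<integral>\<^sup>+r. ?h u r * 1 \<partial>lborel)) \<partial>lborel)
     = (\<integral>\<^sup>+u. shell u * (\<integral>\<^sup>+r. ennreal (r ^ (d - 1)) * indicator {0<..} r * (ennreal (f (D r u) * e (D r u)) * 1) \<partial>lborel) \<partial>lborel)"
    by (subst inner) auto
  also have "\<dots> = (\<integral>\<^sup>+a. ennreal (f a * e a) * 1 \<partial>lborel)"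
    by (rule nn_integral_polar[symmetric]) measurable
  finally show ?thesis by simp
qed

end

section \<open>The dilations of the scatter matrices about their pooled value\<close>

definition block :: "real^('k::finite \<times> 'p::finite uprod) \<Rightarrow> 'k \<Rightarrow> real^('p uprod)" where
  "block a i = (\<chi> u. a $ (i, u))"

definition block_sum :: "real^('k::finite \<times> 'p::finite uprod) \<Rightarrow> real^('p uprod)" where
  "block_sum a = (\<Sum>i\<in>UNIV. block a i)"

definition dilate :: "('k::finite \<Rightarrow> real) \<Rightarrow> real \<Rightarrow> real^('k \<times> 'p::finite uprod) \<Rightarrow> real^('k \<times> 'p uprod)" where
  "dilate w t a = (\<chi> j. t * a $ j + (1 - t) * w (fst j) * block_sum a $ snd j)"

lemma block_nth [simp]: "block a i $ u = a $ (i, u)"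
  by (simp add: block_def)

lemma block_sum_nth: "block_sum a $ u = (\<Sum>i\<in>UNIV. a $ (i, u))"
  by (simp add: block_sum_def)

lemma borel_measurable_block [measurable (raw)]:
  assumes [measurable]: "f \<in> borel_measurable M"
  shows "(\<lambda>x. block (f x) i) \<in> borel_measurable M"
  unfolding block_def by measurable

lemma borel_measurable_block_sum [measurable (raw)]:
  assumes [measurable]: "f \<in> borel_measurable M"
  shows "(\<lambda>x. block_sum (f x)) \<in> borel_measurable M"
  unfolding block_sum_def by measurable

lemma block_dilate: "block (dilate w t a) i = t *\<^sub>R block a i + ((1 - t) * w i) *\<^sub>R block_sum a"
  by (simp add: vec_eq_iff dilate_def)

lemma block_sum_dilate:
  assumes "sum w UNIV = 1"
  shows "block_sum (dilate w t a) = block_sum a"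
proof -
  have "block_sum (dilate w t a) $ u = block_sum a $ u" for u
  proof -
    have "block_sum (dilate w t a) $ u = t * block_sum a $ u + (1 - t) * (\<Sum>i\<in>UNIV. w i) * block_sum a $ u"
      by (simp add: block_sum_nth[of "dilate w t a"] dilate_def sum.distrib sum_distrib_left sum_distrib_right block_sum_nth mult_ac)
    then show ?thesis using assms by (simp add: algebra_simps)
  qed
  then show ?thesis by (simp add: vec_eq_iff)
qed

lemma dilate_dilate:
  assumes "sum w UNIV = 1"
  shows "dilate w s (dilate w t a) = dilate w (s * t) a"
  by (simp add: vec_eq_iff dilate_def[of w s] dilate_def[of w "s * t"] block_sum_dilate[OF assms])
    (simp add: dilate_def algebra_simps)

lemma dilate_1: "dilate w 1 a = a"
  by (simp add: dilate_def vec_eq_iff)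

lemma block_sum_linear: "block_sum (a + b) = block_sum a + block_sum b" "block_sum (c *\<^sub>R a) = c *\<^sub>R block_sum a"
  by (simp_all add: vec_eq_iff block_sum_nth sum.distrib sum_distrib_left)

lemma linear_dilate: "linear (dilate w t)"
  by (rule linearI) (simp_all add: vec_eq_iff dilate_def block_sum_linear algebra_simps)

text \<open>Replacing one block by the block sum and centering the others diagonalizes the dilations.\<close>

lemma det_dilate:
  fixes w :: "'k::finite \<Rightarrow> real"
  assumes w: "sum w UNIV = 1"
  shows "det (matrix (dilate w t :: real^('k \<times> 'p::finite uprod) \<Rightarrow> _)) = t ^ ((CARD('k) - 1) * CARD('p uprod))"
proof -
  obtain k0 :: 'k where True by blast
  let ?K = "\<lambda>a :: real^('k \<times> 'p uprod). (\<chi> j. if fst j = k0 then block_sum a $ snd j else a $ j - w (fst j) * block_sum a $ snd j) :: real^('k \<times> 'p uprod)"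
  let ?E = "\<lambda>a :: real^('k \<times> 'p uprod). (\<chi> j. if fst j = k0 then a $ j else t * a $ j) :: real^('k \<times> 'p uprod)"
  let ?D = "dilate w t :: real^('k \<times> 'p uprod) \<Rightarrow> _"
  have lK: "linear ?K" by (rule linearI) (simp_all add: vec_eq_iff block_sum_linear algebra_simps)
  have lE: "linear ?E" by (rule linearI) (simp_all add: vec_eq_iff algebra_simps)
  have KD: "?K (dilate w t a) = ?E (?K a)" for a
  proof -
    have "(dilate w t a) $ (i, u) - w i * block_sum a $ u = t * (a $ (i, u) - w i * block_sum a $ u)" for i u
      by (simp add: dilate_def algebra_simps)
    then show ?thesis by (simp add: vec_eq_iff block_sum_dilate[OF w])
  qed
  have "inj ?K"
  proof (rule linear_injective_0[OF lK, THEN iffD2], intro allI impI)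
    fix a assume a: "?K a = 0"
    have T: "block_sum a $ u = 0" for u
      using arg_cong[OF a, of "\<lambda>v. v $ (k0, u)"] by simp
    have A: "a $ (i, u) = 0" if "i \<noteq> k0" for i u
      using arg_cong[OF a, of "\<lambda>v. v $ (i, u)"] that by (simp add: T)
    have "a $ (k0, u) = 0" for u
    proof -
      have "block_sum a $ u = a $ (k0, u) + (\<Sum>i\<in>UNIV - {k0}. a $ (i, u))"
        unfolding block_sum_nth by (simp add: sum.remove[of UNIV k0])
      also have "(\<Sum>i\<in>UNIV - {k0}. a $ (i, u)) = 0" using A by (intro sum.neutral) auto
      finally show ?thesis using T by simp
    qed
    then have "a $ j = 0" for j using A by (cases j) (metis)
    then show "a = 0" by (simp add: vec_eq_iff)
  qed
  \<comment> \<open>The coordinate change \<open>?K\<close> need not be inverted: its determinant is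
    nonzero and cancels from the conjugation identity.\<close>
  then have "det (matrix ?K) \<noteq> 0" using det_nz_iff_inj[OF lK] by simp
  moreover have "det (matrix ?K) * det (matrix ?D) = det (matrix ?E) * det (matrix ?K)"
  proof -
    have e: "(\<lambda>a. ?K (dilate w t a)) = (\<lambda>a. ?E (?K a))" by (rule ext) (rule KD)
    show ?thesis
      by (rule trans[OF det_matrix_compose[OF lK linear_dilate, symmetric]
            trans[OF arg_cong[OF e, of "\<lambda>f. det (matrix f)"] det_matrix_compose[OF lE lK]]])
  qed
  ultimately have "det (matrix ?D) = det (matrix ?E)" by simp
  also have "\<dots> = (\<Prod>j\<in>(UNIV :: ('k \<times> 'p uprod) set). if fst j = k0 then 1 else t)"
    by (rule det_matrix_diag) simp
  also have "\<dots> = (\<Prod>i\<in>UNIV. \<Prod>u\<in>(UNIV :: 'p uprod set). if i = k0 then 1 else t)"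
    by (simp only: prod.cartesian_product UNIV_Times_UNIV split_def)
  also have "\<dots> = (\<Prod>i\<in>UNIV. if i = k0 then 1 else t ^ CARD('p uprod))"
    by (intro prod.cong) auto
  also have "\<dots> = (t ^ CARD('p uprod)) ^ (CARD('k) - 1)"
    by (simp add: prod.remove[of UNIV k0] card_Diff_singleton)
  finally show ?thesis by (simp add: power_mult[symmetric] mult.commute)
qed

text \<open>Being zero outside the cone, it allows integration over a whole half-line in place of an
  integral that stops at \<open>t_sup\<close>.\<close>

definition block_density :: "('k::finite \<Rightarrow> nat) \<Rightarrow> real^('k \<times> 'p::finite uprod) \<Rightarrow> real" where
  "block_density n a = (\<Prod>i\<in>UNIV. if pos_def_matrix (sym_of (block a i))
     then det (sym_of (block a i)) powr ((real (n i) - real CARD('p) - 2) / 2) else 0)"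

lemma borel_measurable_block_density [measurable]: "block_density n \<in> borel_measurable borel"
  unfolding block_density_def by measurable

lemma block_density_nonneg: "block_density n a \<ge> 0"
  unfolding block_density_def by (intro prod_nonneg) auto

text \<open>Here the null hypothesis acts: with one L for all groups the traces add up to a function
  of the sum of the scatter matrices.\<close>

lemma prod_wishart_weight:
  fixes a :: "real^('k::finite \<times> 'p::finite uprod)"
  shows
  "(\<Prod>i\<in>UNIV. wishart_weight (n i) L (block a i)) = block_density n a * exp (- trace (L ** sym_of (block_sum a)) / 2)"
proof -
  have "(\<Prod>i\<in>UNIV. wishart_weight (n i) L (block a i)) =
    (\<Prod>i\<in>UNIV. (if pos_def_matrix (sym_of (block a i))
     then det (sym_of (block a i)) powr ((real (n i) - real CARD('p) - 2) / 2) else 0) * exp (- trace (L ** sym_of (block a i)) / 2))"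
    by (intro prod.cong) (auto simp: wishart_weight_def)
  also have "\<dots> = block_density n a * exp (\<Sum>i\<in>UNIV. - trace (L ** sym_of (block a i)) / 2)"
    by (simp add: prod.distrib block_density_def exp_sum)
  also have "(\<Sum>i\<in>UNIV. - trace (L ** sym_of (block a i)) / 2) = - trace (L ** sym_of (block_sum a)) / 2"
    by (simp add: block_sum_def sym_of_sum matrix_mult_sum_right trace_sum sum_negf sum_divide_distrib)
  finally show ?thesis .
qed

lemma quadratic_form_zero:
  fixes A :: "real^'n::finite^'n"
  assumes "transpose A = A" "\<And>v. v \<bullet> (A *v v) = 0"
  shows "A = 0"
proof -
  have "A *v v = 0" for v using assms by (intro psd_kernel) auto
  then show ?thesis by (simp add: matrix_eq)
qed

text \<open>If the ray stayed in the cone for arbitrarily large t, every difference A_i - w_i (sum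
  of A_j) would be positive semidefinite. These differences sum to zero because the weights sum to
  one, so each of them vanishes and a is a fixed point.\<close>

lemma dilate_eventually_not_pos_def:
  fixes a :: "real^('k::finite \<times> 'p::finite uprod)"
  assumes w: "sum w UNIV = 1" and a: "dilate w 0 a \<noteq> a"
  shows "\<exists>R. \<forall>t>R. \<exists>i. \<not> pos_def_matrix (sym_of (block (dilate w t a) i))"
proof (rule ccontr)
  assume "\<not> ?thesis"
  then have pd: "\<exists>t>R. \<forall>i. pos_def_matrix (sym_of (block (dilate w t a) i))" for R by auto
  let ?x = "\<lambda>i. sym_of (block a i)" and ?y = "\<lambda>i. w i *\<^sub>R sym_of (block_sum a)"
  have nn: "v \<bullet> ((?x i - ?y i) *v v) \<ge> 0" for i v
  proof (cases "v = 0")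
    case False
    show ?thesis
    proof (rule ccontr)
      assume neg: "\<not> ?thesis"
      \<comment> \<open>The form at v is the affine function \<open>t * ?d + ?b\<close>, and for
        \<open>?d < 0\<close> it is negative beyond \<open>?b / - ?d\<close>.\<close>
      let ?d = "v \<bullet> ((?x i - ?y i) *v v)" and ?b = "v \<bullet> (?y i *v v)"
      obtain t where t: "t > max 0 (?b / - ?d)" "pos_def_matrix (sym_of (block (dilate w t a) i))" using pd by blast
      have "sym_of (block (dilate w t a) i) = t *\<^sub>R (?x i - ?y i) + ?y i"
        by (simp add: vec_eq_iff dilate_def algebra_simps)
      then have "t * ?d + ?b > 0"
        using pos_def_pos[OF t(2) False]
        by (simp add: matrix_vector_mult_add_rdistrib inner_add_right scaleR_matrix_vector_assoc[symmetric])
      moreover have "?b < t * (- ?d)"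
      proof -
        have "0 < - ?d" using neg by linarith
        moreover have "?b / - ?d < t" using t(1) by simp
        ultimately show ?thesis using pos_divide_less_eq by blast
      qed
      ultimately show False by simp
    qed
  qed simp
  have "(\<Sum>i\<in>UNIV. v \<bullet> ((?x i - ?y i) *v v)) = 0" for v
  proof -
    have "(\<Sum>i\<in>UNIV. ?x i - ?y i) = 0"
      using w by (simp add: sum_subtractf sym_of_sum[symmetric] block_sum_def[symmetric] scaleR_left.sum[symmetric])
    then show ?thesis by (simp add: inner_sum_right[symmetric] sum_matrix_vector_mult[symmetric])
  qed
  then have z: "v \<bullet> ((?x i - ?y i) *v v) = 0" for i v
    using sum_nonneg_eq_0_iff[of UNIV "\<lambda>i. v \<bullet> ((?x i - ?y i) *v v)"] nn by auto
  have "?x i - ?y i = 0" for i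
    by (rule quadratic_form_zero[OF _ z]) (simp add: sym_of_scaleR[symmetric] sym_of_diff[symmetric])
  then have "sym_of (block a i) = sym_of (w i *\<^sub>R block_sum a)" for i by (simp add: sym_of_scaleR)
  then have b: "block a i = w i *\<^sub>R block_sum a" for i by simp
  have "dilate w 0 a $ (i, u) = a $ (i, u)" for i u
    using arg_cong[OF b[of i], of "\<lambda>v. v $ u"] by (simp add: dilate_def)
  then have "dilate w 0 a = a" by (simp add: vec_eq_iff)
  then show False using a by simp
qed

text \<open>\<open>dilate w 0 a\<close> is the fixed point associated with the ray of a, and the
  distance from it serves as radius. Two groups are required for d > 0 and for the fixed points to
  form a null set.\<close>

lemma dilation_group_dilate:
  fixes n :: "'k::finite \<Rightarrow> nat" and L :: "real^'p::finite^'p"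
  assumes w: "sum w UNIV = 1" "\<And>i. w i > 0" and k: "CARD('k) \<ge> 2"
  shows "dilation_group (dilate w) ((CARD('k) - 1) * CARD('p uprod)) (\<lambda>a. norm (a - dilate w 0 a))
    (block_density n) (\<lambda>a. exp (- trace (L ** sym_of (block_sum a)) / 2))"
proof (rule dilation_group.intro)
  have m: "(\<lambda>(t, a). dilate w t a) \<in> borel_measurable (borel \<Otimes>\<^sub>M (borel :: (real^('k \<times> 'p uprod)) measure))"
    unfolding dilate_def split_def by measurable
  then show "(\<lambda>(t, a). dilate w t a) \<in> borel_measurable (borel \<Otimes>\<^sub>M (borel :: (real^('k \<times> 'p uprod)) measure))" .
  have [measurable]: "dilate w t \<in> borel_measurable borel" for t
    by (intro borel_measurable_linear linear_dilate)
  show "(\<lambda>a :: real^('k \<times> 'p uprod). norm (a - dilate w 0 a)) \<in> borel_measurable borel" by measurable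
  show "(\<lambda>a :: real^('k \<times> 'p uprod). exp (- trace (L ** sym_of (block_sum a)) / 2)) \<in> borel_measurable borel" by measurable
  show "(CARD('k) - 1) * CARD('p uprod) > 0" using k by simp
  show "AE a in lborel. norm (a - dilate w 0 a :: real^('k \<times> 'p uprod)) > 0"
  proof -
    obtain i j :: 'k where ij: "i \<noteq> j" using k by (metis (full_types) One_nat_def Suc_1 card_2_iff' card_le_Suc0_iff_eq finite UNIV_I not_less_eq_eq)
    obtain u :: "'p uprod" where True by blast
    \<comment> \<open>A fixed point has entries proportional to the weights, so the entries of
      groups i and j at u satisfy a linear relation; \<open>?z\<close> is the normal vector of that
      hyperplane.\<close>
    let ?z = "w j *\<^sub>R axis (i, u) 1 - w i *\<^sub>R axis (j, u) (1::real) :: real^('k \<times> 'p uprod)"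
    have "?z $ (i, u) = w j" using ij by (simp add: axis_def)
    then have "?z \<noteq> 0" using w(2)[of j] by (metis less_irrefl zero_index)
    then have "{a. ?z \<bullet> a = 0} \<in> null_sets lebesgue"
      using negligible_hyperplane[of ?z 0] by (simp add: negligible_iff_null_sets)
    then have "{a. ?z \<bullet> a = 0} \<in> null_sets lborel"
      by (subst (asm) null_sets_completion_iff) (auto intro!: borel_closed closed_hyperplane)
    then have "AE a in lborel. a \<notin> {a. ?z \<bullet> a = 0}" by (rule AE_not_in)
    then show ?thesis
    proof eventually_elim
      case (elim a)
      have "a \<noteq> dilate w 0 a"
      proof
        assume e: "a = dilate w 0 a"
        have "a $ (l, u) = w l * block_sum a $ u" for l
          using arg_cong[OF e, of "\<lambda>v. v $ (l, u)"] by (simp add: dilate_def)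
        then have "?z \<bullet> a = 0" by (simp add: inner_diff_left inner_axis' mult_ac)
        then show False using elim by simp
      qed
      then show ?case by simp
    qed
  qed
next
  fix t :: real and a :: "real^('k \<times> 'p uprod)" assume "t > 0"
  have "dilate w t a - dilate w 0 (dilate w t a) = t *\<^sub>R (a - dilate w 0 a)"
    unfolding dilate_dilate[OF w(1)] by (simp add: dilate_def vec_eq_iff algebra_simps)
  then show "norm (dilate w t a - dilate w 0 (dilate w t a)) = t * norm (a - dilate w 0 a)"
    using \<open>t > 0\<close> by simp
qed (auto simp: linear_dilate det_dilate[OF w(1)] dilate_dilate[OF w(1)] dilate_1 block_density_nonneg block_sum_dilate[OF w(1)])

text \<open>The ray leaves the cone at some finite R, and up to R the determinants are bounded by
  continuity. Their powers are bounded too, because \<open>n i >= p + 2\<close> makes the exponents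
  nonnegative.\<close>

lemma block_density_ray_finite:
  fixes n :: "'k::finite \<Rightarrow> nat" and a :: "real^('k \<times> 'p::finite uprod)"
  assumes w: "sum w UNIV = 1" and n: "\<And>i. n i \<ge> CARD('p) + 2" and a: "dilate w 0 a \<noteq> a"
  shows "(\<integral>\<^sup>+t. ennreal (t ^ d * block_density n (dilate w t a)) * indicator {0<..} t \<partial>lborel) < \<infinity>"
proof -
  obtain R0 where R0: "\<And>t. t > R0 \<Longrightarrow> \<exists>i. \<not> pos_def_matrix (sym_of (block (dilate w t a) i))"
    using dilate_eventually_not_pos_def[OF w a] by blast
  define R where "R = max R0 0"
  have z: "block_density n (dilate w t a) = 0" if tR: "t > R" for t
  proof -
    obtain i where "\<not> pos_def_matrix (sym_of (block (dilate w t a) i))" using R0[of t] tR by (auto simp: R_def)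
    then show ?thesis unfolding block_density_def by (intro prod_zero) auto
  qed
  have "\<exists>C\<ge>1. \<forall>t\<in>{0..R}. det (sym_of (block (dilate w t a) i)) \<le> C" for i
  proof -
    have "continuous_on {0..R} (\<lambda>t. det (sym_of (block (dilate w t a) i)))"
      unfolding sym_of_def block_def dilate_def by (simp, intro continuous_intros)
    then have "\<exists>s\<in>{0..R}. \<forall>t\<in>{0..R}. det (sym_of (block (dilate w t a) i)) \<le> det (sym_of (block (dilate w s a) i))"
      by (intro continuous_attains_sup) (auto simp: R_def)
    then obtain s where "\<And>t. t \<in> {0..R} \<Longrightarrow> det (sym_of (block (dilate w t a) i)) \<le> det (sym_of (block (dilate w s a) i))"
      by blast
    then show ?thesis by (intro exI[of _ "max 1 (det (sym_of (block (dilate w s a) i)))"]) (auto simp: le_max_iff_disj)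
  qed
  then obtain C where C: "\<And>i. C i \<ge> 1" "\<And>i t. t \<in> {0..R} \<Longrightarrow> det (sym_of (block (dilate w t a) i)) \<le> C i"
    by metis
  define B where "B = (\<Prod>i\<in>UNIV. C i powr ((real (n i) - real CARD('p) - 2) / 2))"
  have le: "block_density n (dilate w t a) \<le> B" if t: "t \<in> {0..R}" for t
    unfolding block_density_def B_def
  proof (intro prod_mono conjI)
    fix i
    have e: "(real (n i) - real CARD('p) - 2) / 2 \<ge> 0" using n[of i] by simp
    show "(if pos_def_matrix (sym_of (block (dilate w t a) i))
        then det (sym_of (block (dilate w t a) i)) powr ((real (n i) - real CARD('p) - 2) / 2) else 0)
        \<le> C i powr ((real (n i) - real CARD('p) - 2) / 2)"
      using C(2)[OF t, of i] pos_def_det_pos[of "sym_of (block (dilate w t a) i)"] e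
      by (auto intro!: powr_mono2 simp: less_imp_le)
  qed auto
  have "(\<integral>\<^sup>+t. ennreal (t ^ d * block_density n (dilate w t a)) * indicator {0<..} t \<partial>lborel) \<le>
    (\<integral>\<^sup>+t. ennreal (R ^ d * B) * indicator {0..R} t \<partial>lborel)"
  proof (rule nn_integral_mono)
    fix t :: real
    show "ennreal (t ^ d * block_density n (dilate w t a)) * indicator {0<..} t \<le> ennreal (R ^ d * B) * indicator {0..R} t"
    proof (cases "0 < t \<and> t \<le> R")
      case True
      then have "t ^ d * block_density n (dilate w t a) \<le> R ^ d * B"
        using le[of t] block_density_nonneg[of n "dilate w t a"] by (intro mult_mono power_mono) (auto simp: R_def)
      then show ?thesis using True by (simp add: ennreal_leI)
    next
      case False
      then show ?thesis using z[of t] by (auto simp: indicator_def)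
    qed
  qed
  also have "\<dots> = ennreal (R ^ d * B) * ennreal R" by (simp add: nn_integral_cmult R_def)
  also have "\<dots> < \<infinity>" by (simp add: ennreal_mult_less_top)
  finally show ?thesis .
qed

section \<open>Derivatives of determinant and inverse\<close>

lemma differentiable_prod_at:
  fixes f :: "'i \<Rightarrow> 'a::real_normed_vector \<Rightarrow> real"
  assumes "\<And>i. i \<in> I \<Longrightarrow> f i differentiable (at x)"
  shows "(\<lambda>x. \<Prod>i\<in>I. f i x) differentiable (at x)"
  using assms by (induction I rule: infinite_finite_induct) (auto intro!: differentiable_mult)

lemma differentiable_sum_at:
  fixes f :: "'i \<Rightarrow> 'a::real_normed_vector \<Rightarrow> real"
  assumes "finite I" "\<And>i. i \<in> I \<Longrightarrow> f i differentiable (at x)"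
  shows "(\<lambda>x. \<Sum>i\<in>I. f i x) differentiable (at x)"
  using assms by (intro differentiable_sum) auto

lemma differentiable_det:
  fixes f :: "'a::real_normed_vector \<Rightarrow> real^'n::finite^'n"
  assumes "\<And>i j. (\<lambda>x. f x $ i $ j) differentiable (at x)"
  shows "(\<lambda>x. det (f x)) differentiable (at x)"
  unfolding det_def
  by (intro differentiable_sum_at differentiable_mult differentiable_const differentiable_prod_at assms) auto

lemma differentiable_entry: "(\<lambda>A::real^'n::finite^'m::finite. A $ i $ j) differentiable (at A)"
proof -
  have "bounded_linear (\<lambda>A::real^'n^'m. A $ i $ j)"
    by (intro linear_conv_bounded_linear[THEN iffD1] linearI) auto
  then show ?thesis by (rule bounded_linear_imp_differentiable)
qed

lemma has_derivative_vec:
  fixes f :: "'a::real_normed_vector \<Rightarrow> 'b::euclidean_space^'n::finite"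
  assumes "\<And>i. ((\<lambda>x. f x $ i) has_derivative (\<lambda>h. f' h $ i)) (at x)"
  shows "(f has_derivative f') (at x)"
proof -
  have "((\<lambda>x. f x \<bullet> b) has_derivative (\<lambda>h. f' h \<bullet> b)) (at x)" if bB: "b \<in> Basis" for b
  proof -
    obtain i u where b: "b = axis i u" using bB by (auto simp: Basis_vec_def)
    show ?thesis unfolding b inner_axis using assms[of i] by (rule has_derivative_inner_left)
  qed
  then show ?thesis by (subst has_derivative_componentwise_within) auto
qed

lemma bounded_bilinear_matrix_mult:
  "bounded_bilinear ((**) :: real^'n::finite^'m::finite \<Rightarrow> real^'k::finite^'n \<Rightarrow> real^'k^'m)"
  unfolding bilinear_conv_bounded_bilinear[symmetric] bilinear_def
  by (auto intro!: linearI simp: matrix_add_ldistrib matrix_add_rdistrib' matrix_scaleR_left matrix_scaleR_right)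

lemma bounded_bilinear_matrix_vector_mult:
  "bounded_bilinear ((*v) :: real^'n::finite^'m::finite \<Rightarrow> real^'n \<Rightarrow> real^'m)"
  unfolding bilinear_conv_bounded_bilinear[symmetric] bilinear_def
  by (auto intro!: linearI simp: matrix_vector_right_distrib matrix_vector_mult_add_rdistrib
      matrix_vector_mult_scaleR scaleR_matrix_vector_assoc)

lemma matrix_vector_mult_minus_left: "(- A) *v v = - (A *v (v :: real^'n))"
  by (simp add: matrix_vector_mult_def vec_eq_iff sum_negf)

lemma matrix_mult_minus_left: "(- A) ** B = - (A ** (B :: real^'k^'n))"
  by (simp add: matrix_matrix_mult_def vec_eq_iff sum_negf)

lemma trace_minus: "trace (- A) = - trace (A :: real^'n^'n)"
  by (simp add: trace_def sum_negf)

lemma matrix_mult_vec_linear: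
  fixes f :: "real^'n::finite \<Rightarrow> real^'m::finite"
  assumes "linear f"
  shows "matrix f *v x = f x"
  using assms by simp

lemma inner_transpose: "v \<bullet> (transpose M *v w) = (M *v v) \<bullet> (w :: real^'m)"
  for M :: "real^'n^'m"
proof -
  have "v \<bullet> (transpose M *v w) = (w v* M) \<bullet> v" by (simp add: inner_commute)
  also have "\<dots> = w \<bullet> (M *v v)" by (rule dot_lmul_matrix)
  finally show ?thesis by (simp add: inner_commute)
qed

lemma bounded_linear_trace: "bounded_linear (trace :: real^'n::finite^'n \<Rightarrow> real)"
  by (intro linear_conv_bounded_linear[THEN iffD1] linearI) (auto simp: trace_add trace_scaleR)

lemma open_det_nz: "open {A :: real^'n::finite^'n. det A \<noteq> 0}"
  by (intro open_Collect_neq continuous_intros)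

text \<open>Cramer's rule shows differentiability. The derivative is then identified by
  differentiating X X^-1, which is constant near A, and solving the resulting linear
  equation.\<close>

lemma has_derivative_matrix_inv_at:
  fixes A :: "real^'n::finite^'n"
  assumes A: "det A \<noteq> 0"
  shows "(matrix_inv has_derivative (\<lambda>H. - (matrix_inv A ** H ** matrix_inv A))) (at A)"
proof -
  have d: "(\<lambda>X :: real^'n^'n. det (\<chi> k l. if l = i then (if k = j then 1 else 0) else X $ k $ l)) differentiable (at A)" for i j
  proof (rule differentiable_det)
    fix k l
    show "(\<lambda>X. (\<chi> k l. if l = i then (if k = j then 1 else 0) else X $ k $ l) $ k $ l) differentiable (at A)"
      by (cases "l = i") (auto intro: differentiable_entry)
  qed
  have dd: "(\<lambda>X :: real^'n^'n. det X) differentiable (at A)"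
    by (intro differentiable_det differentiable_entry)
  have "(\<lambda>X. cramer_inv X $ i $ j) differentiable (at A)" for i j
    unfolding cramer_inv_def using d[of i j] dd A by (simp add: differentiable_divide)
  then have "\<exists>c'. \<forall>i j. ((\<lambda>X. cramer_inv X $ i $ j) has_derivative c' i j) (at A)"
    unfolding differentiable_def by metis
  then obtain c' where c': "\<And>i j. ((\<lambda>X. cramer_inv X $ i $ j) has_derivative c' i j) (at A)" by blast
  define D where "D H = (\<chi> i j. c' i j H)" for H
  have "(cramer_inv has_derivative D) (at A)"
    by (intro has_derivative_vec) (simp add: D_def c')
  then have inv: "(matrix_inv has_derivative D) (at A)"
    by (rule has_derivative_transform_within_open[OF _ open_det_nz]) (use A in \<open>auto simp: cramer_inv_eq\<close>)
  have "((\<lambda>X. X ** matrix_inv X) has_derivative (\<lambda>H. A ** D H + H ** matrix_inv A)) (at A)"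
    by (rule bounded_bilinear.FDERIV[OF bounded_bilinear_matrix_mult has_derivative_ident inv])
  then have "((\<lambda>X. mat 1) has_derivative (\<lambda>H. A ** D H + H ** matrix_inv A)) (at A)"
    by (rule has_derivative_transform_within_open[OF _ open_det_nz]) (use A in \<open>auto simp: matrix_inv_mult\<close>)
  then have "(\<lambda>H. A ** D H + H ** matrix_inv A) = (\<lambda>H. 0)"
    using has_derivative_unique has_derivative_const by blast
  then have z: "A ** D H + H ** matrix_inv A = 0" for H by metis
  have "D H = - (matrix_inv A ** H ** matrix_inv A)" for H
  proof -
    have "matrix_inv A ** (A ** D H + H ** matrix_inv A) = 0"
      unfolding z by (simp add: matrix_matrix_mult_def vec_eq_iff)
    then have "D H + matrix_inv A ** H ** matrix_inv A = 0"
      by (simp add: matrix_add_ldistrib matrix_mul_assoc matrix_inv_mult A)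
    then show ?thesis by (simp add: add_eq_0_iff2)
  qed
  then show ?thesis using inv by presburger
qed

text \<open>Jacobi's formula: at the identity, compare the two sides on the matrix units.\<close>

lemma has_derivative_det_at:
  fixes A :: "real^'n::finite^'n"
  assumes A: "det A \<noteq> 0"
  shows "(det has_derivative (\<lambda>H. det A * trace (matrix_inv A ** H))) (at A)"
proof -
  have "(\<lambda>X :: real^'n^'n. det X) differentiable (at (mat 1))"
    by (intro differentiable_det differentiable_entry)
  then obtain L where L: "(det has_derivative L) (at (mat 1 :: real^'n^'n))"
    unfolding differentiable_def by auto
  have linL: "linear L" using L has_derivative_linear by blast
  let ?E = "\<lambda>a b. (\<chi> i j. if i = a \<and> j = b then 1 else 0) :: real^'n^'n"
  have LE: "L (?E a b) = (if a = b then 1 else 0)" for a b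
  proof -
    have detE: "det (mat 1 + \<tau> *\<^sub>R ?E a b) = 1 + \<tau> * (if a = b then 1 else 0)" for \<tau>
    proof (cases "a = b")
      case True
      have "mat 1 + \<tau> *\<^sub>R ?E a b = diag_matrix (\<lambda>i. if i = a then 1 + \<tau> else 1)"
        using True by (auto simp: vec_eq_iff mat_def diag_matrix_def)
      then show ?thesis using True by (simp add: prod.remove[of UNIV a])
    next
      case False
      have "mat 1 + \<tau> *\<^sub>R ?E a b = (\<chi> k. if k = a then row a (mat 1) + \<tau> *s row b (mat 1) else row k (mat 1))"
        using False by (auto simp: vec_eq_iff row_def mat_def)
      then show ?thesis using False det_row_operation[OF False, of "mat 1" \<tau>] by simp
    qed
    have "((\<lambda>\<tau>. mat 1 + \<tau> *\<^sub>R ?E a b) has_derivative (\<lambda>\<tau>. \<tau> *\<^sub>R ?E a b)) (at 0)"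
      by (auto intro!: derivative_eq_intros)
    moreover have "(det has_derivative L) (at (mat 1 + 0 *\<^sub>R ?E a b))" using L by simp
    ultimately have "((\<lambda>\<tau>. det (mat 1 + \<tau> *\<^sub>R ?E a b)) has_derivative (\<lambda>\<tau>. L (\<tau> *\<^sub>R ?E a b))) (at 0)"
      by (rule has_derivative_compose)
    moreover have "((\<lambda>\<tau>::real. 1 + \<tau> * (if a = b then 1 else 0)) has_derivative (\<lambda>\<tau>. \<tau> * (if a = b then 1 else 0))) (at 0)"
      by (auto intro!: derivative_eq_intros)
    ultimately have "(\<lambda>\<tau>. L (\<tau> *\<^sub>R ?E a b)) = (\<lambda>\<tau>. \<tau> * (if a = b then 1 else 0))"
      unfolding detE using has_derivative_unique by blast
    then have "L (1 *\<^sub>R ?E a b) = 1 * (if a = b then 1 else 0)" by (rule fun_cong)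
    then show ?thesis by simp
  qed
  have Ltr: "L K = trace K" for K
  proof -
    have K: "K = (\<Sum>a\<in>UNIV. \<Sum>b\<in>UNIV. K $ a $ b *\<^sub>R ?E a b)"
    proof -
      have "(\<Sum>a\<in>UNIV. \<Sum>b\<in>UNIV. K $ a $ b *\<^sub>R ?E a b) $ i $ j = K $ i $ j" for i j
      proof -
        have "(\<Sum>a\<in>UNIV. \<Sum>b\<in>UNIV. K $ a $ b *\<^sub>R ?E a b) $ i $ j =
           (\<Sum>a\<in>UNIV. if a = i then (\<Sum>b\<in>UNIV. if b = j then K $ a $ b else 0) else 0)"
          unfolding sum_component
          by (intro sum.cong refl) (auto simp: if_distrib[of "\<lambda>x. _ * x"] cong: if_cong)
        then show ?thesis by simp
      qed
      then show ?thesis by (simp add: vec_eq_iff)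
    qed
    have "L K = (\<Sum>a\<in>UNIV. \<Sum>b\<in>UNIV. K $ a $ b * L (?E a b))"
      by (subst K) (simp add: linear_sum[OF linL] linear_scale[OF linL])
    then show ?thesis by (simp add: LE trace_def if_distrib[of "\<lambda>x. _ * x"] cong: if_cong)
  qed
  \<comment> \<open>The factorization det X = det A * det (A^-1 X) transports the formula from the
    identity to A.\<close>
  have "((\<lambda>X. matrix_inv A ** X) has_derivative (\<lambda>H. matrix_inv A ** H)) (at A)"
    by (intro bounded_linear_imp_has_derivative bounded_bilinear.bounded_linear_right bounded_bilinear_matrix_mult)
  moreover have "(det has_derivative trace) (at (matrix_inv A ** A))"
    using L Ltr A by (simp add: matrix_inv_mult fun_eq_iff[symmetric, of L trace] ext[of L trace])
  ultimately have "((\<lambda>X. det (matrix_inv A ** X)) has_derivative (\<lambda>H. trace (matrix_inv A ** H))) (at A)"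
    by (rule has_derivative_compose)
  then have "((\<lambda>X. det A * det (matrix_inv A ** X)) has_derivative (\<lambda>H. det A * trace (matrix_inv A ** H))) (at A)"
    by (rule has_derivative_mult_right)
  moreover have "det A * det (matrix_inv A ** X) = det X" for X
    using A by (simp add: det_mul det_matrix_inv)
  ultimately show ?thesis by simp
qed

lemma has_derivative_ln_det_at:
  fixes A :: "real^'n::finite^'n"
  assumes A: "det A > 0"
  shows "((\<lambda>X. ln (det X)) has_derivative (\<lambda>H. trace (matrix_inv A ** H))) (at A)"
proof -
  have "(ln has_derivative (\<lambda>h. inverse (det A) * h)) (at (det A))"
    using DERIV_ln[OF A] by (simp add: has_field_derivative_def mult.commute[of _ "inverse (det A)"])
  from has_derivative_compose[OF has_derivative_det_at this] A
  show ?thesis by (simp add: mult.assoc[symmetric])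
qed

section \<open>The log-likelihood\<close>

lemma xi_of_linear: "xi_of (\<phi> + \<psi>) i = xi_of \<phi> i + xi_of \<psi> i" "xi_of (c *\<^sub>R \<phi>) i = c *\<^sub>R xi_of \<phi> i"
  by (simp_all add: xi_of_def vec_eq_iff)

lemma conc_of_linear: "conc_of (\<phi> + \<psi>) i = conc_of \<phi> i + conc_of \<psi> i" "conc_of (c *\<^sub>R \<phi>) i = c *\<^sub>R conc_of \<phi> i"
  by (simp_all add: conc_of_def vec_eq_iff)

lemma bounded_linear_xi_of: "bounded_linear (\<lambda>\<phi>. xi_of \<phi> i)"
  by (intro linear_conv_bounded_linear[THEN iffD1] linearI) (simp_all add: xi_of_linear)

lemma bounded_linear_conc_of: "bounded_linear (\<lambda>\<phi>. conc_of \<phi> i)"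
  by (intro linear_conv_bounded_linear[THEN iffD1] linearI) (simp_all add: conc_of_linear)

lemma transpose_conc_of [simp]: "transpose (conc_of \<phi> i) = conc_of \<phi> i"
  by (simp add: conc_of_def transpose_def vec_eq_iff Upair_swap)

definition param :: "('k::finite \<Rightarrow> real^'p::finite) \<Rightarrow> ('k \<Rightarrow> real^'p^'p) \<Rightarrow> real^('k \<times> ('p + 'p uprod))" where
  "param \<xi> L = (\<chi> j. case snd j of Inl a \<Rightarrow> \<xi> (fst j) $ a | Inr u \<Rightarrow> vec_of_sym (L (fst j)) $ u)"

lemma xi_of_param [simp]: "xi_of (param \<xi> L) i = \<xi> i"
  by (simp add: xi_of_def param_def)

lemma conc_of_param: "transpose (L i) = L i \<Longrightarrow> conc_of (param \<xi> L) i = L i"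
  by (simp add: conc_of_def param_def vec_eq_iff vec_of_sym_nth)

lemma param_eqI:
  assumes "\<And>i. xi_of \<phi> i = xi_of \<psi> i" "\<And>i. conc_of \<phi> i = conc_of \<psi> i"
  shows "\<phi> = \<psi>"
proof -
  have "\<phi> $ (i, z) = \<psi> $ (i, z)" for i z
  proof (cases z)
    case (Inl a)
    then show ?thesis using assms(1)[of i] by (simp add: xi_of_def vec_eq_iff)
  next
    case (Inr u)
    then show ?thesis using assms(2)[of i] by (cases u) (simp add: conc_of_def vec_eq_iff)
  qed
  then show ?thesis by (simp add: vec_eq_iff)
qed

text \<open>The log-likelihood with arbitrary scatter matrices \<open>A\<close> in place of the observed ones; all the
  tilted log-likelihoods on the line have this form.\<close>

definition group_loglik :: "real \<Rightarrow> real^'p \<Rightarrow> real^'p^'p \<Rightarrow> real^'p \<Rightarrow> real^'p::finite^'p \<Rightarrow> real" where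
  "group_loglik n m A \<xi> L = n * (\<xi> \<bullet> m) - trace (L ** (A + n *\<^sub>R outer m)) / 2
     + n / 2 * ln (det L) - n / 2 * (\<xi> \<bullet> (matrix_inv L *v \<xi>))"

definition loglik :: "('k \<Rightarrow> nat) \<Rightarrow> ('k \<Rightarrow> real^'p) \<Rightarrow> ('k \<Rightarrow> real^'p^'p) \<Rightarrow> real^('k::finite \<times> ('p::finite + 'p uprod)) \<Rightarrow> real" where
  "loglik n m A \<phi> = (\<Sum>i\<in>UNIV. group_loglik (real (n i)) (m i) (A i) (xi_of \<phi> i) (conc_of \<phi> i))"

lemma normal_loglik_eq:
  assumes "\<And>i. n i > 0"
  shows "normal_loglik n y = loglik n (\<lambda>i. sample_mean (n i) (y i)) (\<lambda>i. scatter (n i) (y i))"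
  using assms by (simp add: fun_eq_iff normal_loglik_def loglik_def group_loglik_def gram_eq_scatter_add)

text \<open>In terms of the mean L^-1 \<xi> the linear and quadratic terms form a square centred at
  m, which separates the maximization over the mean from that over L.\<close>

lemma group_loglik_complete_square:
  assumes L: "pos_def_matrix L"
  shows "group_loglik n m A \<xi> L = n / 2 * ln (det L) - trace (L ** A) / 2
    - n / 2 * ((matrix_inv L *v \<xi> - m) \<bullet> (L *v (matrix_inv L *v \<xi> - m)))"
proof -
  have d: "det L \<noteq> 0" using pos_def_det_pos[OF L] by simp
  let ?x = "matrix_inv L *v \<xi>"
  have Lx: "L *v ?x = \<xi>" by (simp add: matrix_vector_mul_assoc matrix_inv_mult d)
  have "(?x - m) \<bullet> (L *v (?x - m)) = ?x \<bullet> \<xi> - m \<bullet> \<xi> - ?x \<bullet> (L *v m) + m \<bullet> (L *v m)"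
    by (simp only: matrix_vector_mult_diff_distrib Lx inner_diff_left inner_diff_right)
  also have "?x \<bullet> (L *v m) = \<xi> \<bullet> m"
    using matrix_self_adjoint[OF pos_def_transpose[OF L], of ?x m] Lx by simp
  finally have "(?x - m) \<bullet> (L *v (?x - m)) = \<xi> \<bullet> ?x - 2 * (\<xi> \<bullet> m) + m \<bullet> (L *v m)"
    by (simp add: inner_commute)
  then show ?thesis
    by (simp only: group_loglik_def matrix_add_ldistrib trace_add matrix_scaleR_right trace_scaleR trace_mult_outer)
      (simp add: field_simps)
qed

section \<open>Existence, uniqueness and nonexistence of maximum likelihood estimates\<close>

lemma mle_eqI:
  assumes "\<phi> \<in> \<Phi>" "\<And>\<psi>. \<psi> \<in> \<Phi> \<Longrightarrow> l \<psi> \<le> l \<phi>" "\<And>\<psi>. \<psi> \<in> \<Phi> \<Longrightarrow> l \<psi> = l \<phi> \<Longrightarrow> \<psi> = \<phi>"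
  shows "mle_exists \<Phi> l" "mle \<Phi> l = \<phi>"
proof -
  have "is_arg_max l (\<lambda>x. x \<in> \<Phi>) \<phi>"
    using assms(1,2) by (auto simp: is_arg_max_def not_less)
  then show "mle_exists \<Phi> l" by (auto simp: mle_exists_def)
  \<comment> \<open>\<open>mle\<close> selects an arbitrary maximizer, so its value can be named
    only through uniqueness.\<close>
  have "is_arg_max l (\<lambda>x. x \<in> \<Phi>) \<psi> \<Longrightarrow> \<psi> = \<phi>" for \<psi>
    using assms by (auto simp: is_arg_max_def not_less intro: antisym)
  with \<open>is_arg_max l (\<lambda>x. x \<in> \<Phi>) \<phi>\<close> show "mle \<Phi> l = \<phi>"
    unfolding mle_def arg_max_on_def arg_max_def by (rule some_equality)
qed

lemma pos_def_psd: "pos_def_matrix A \<Longrightarrow> 0 \<le> v \<bullet> (A *v v)"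
  using pos_def_pos[of A v] by (cases "v = 0") auto

text \<open>The square costs something unless the mean is m, and the remaining function of L is
  bounded by \<open>ln_det_minus_trace\<close>. Writing the scatter matrix as n B makes B itself the
  covariance estimate; the equality case supplies the uniqueness that \<open>mle\<close>
  requires.\<close>

lemma group_loglik_le:
  fixes B :: "real^'p::finite^'p"
  assumes n: "n > 0" and L: "pos_def_matrix L" and B: "pos_def_matrix B"
  shows "group_loglik n m (n *\<^sub>R B) \<xi> L \<le> - n / 2 * (ln (det B) + real CARD('p))"
    and "group_loglik n m (n *\<^sub>R B) \<xi> L = - n / 2 * (ln (det B) + real CARD('p)) \<longleftrightarrow>
      L = matrix_inv B \<and> \<xi> = matrix_inv B *v m"
proof -
  let ?d = "matrix_inv L *v \<xi> - m"
  let ?q = "?d \<bullet> (L *v ?d)" and ?g = "ln (det L) - trace (L ** B)"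
  have eq: "group_loglik n m (n *\<^sub>R B) \<xi> L = n / 2 * (?g - ?q)"
    using group_loglik_complete_square[OF L, of n m "n *\<^sub>R B" \<xi>]
    by (simp add: matrix_scaleR_right trace_scaleR algebra_simps)
  have q: "?q \<ge> 0" by (rule pos_def_psd[OF L])
  note g = ln_det_minus_trace[OF L B]
  have "n / 2 * (?g - ?q) \<le> n / 2 * (- ln (det B) - real CARD('p))"
    using g(1) q n by (intro mult_left_mono) auto
  then show "group_loglik n m (n *\<^sub>R B) \<xi> L \<le> - n / 2 * (ln (det B) + real CARD('p))"
    unfolding eq by (simp add: algebra_simps)
  have "n / 2 * (?g - ?q) = - n / 2 * (ln (det B) + real CARD('p)) \<longleftrightarrow> ?g - ?q = - ln (det B) - real CARD('p)"
  proof -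
    have "- n / 2 * (ln (det B) + real CARD('p)) = n / 2 * (- ln (det B) - real CARD('p))"
      by (simp add: algebra_simps)
    then show ?thesis using n by (simp only: mult_cancel_left) simp
  qed
  also have "\<dots> \<longleftrightarrow> ?g = - ln (det B) - real CARD('p) \<and> ?q = 0"
    using g(1) q by linarith
  also have "?q = 0 \<longleftrightarrow> ?d = 0"
  proof (cases "?d = 0")
    case False
    then have "?q > 0" by (rule pos_def_pos[OF L])
    then show ?thesis using False by (metis less_irrefl)
  qed simp
  also have "?g = - ln (det B) - real CARD('p) \<longleftrightarrow> L = matrix_inv B" by (rule g(2))
  also have "L = matrix_inv B \<and> ?d = 0 \<longleftrightarrow> L = matrix_inv B \<and> \<xi> = matrix_inv B *v m"
  proof -
    have dL: "det L \<noteq> 0" using pos_def_det_pos[OF L] by simp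
    have "?d = 0 \<longleftrightarrow> \<xi> = L *v m"
    proof
      assume "?d = 0"
      then have "L *v (matrix_inv L *v \<xi>) = L *v m" by simp
      then show "\<xi> = L *v m" by (simp add: matrix_vector_mul_assoc matrix_inv_mult dL)
    qed (simp add: matrix_vector_mul_assoc matrix_inv_mult dL)
    then show ?thesis by blast
  qed
  finally show "group_loglik n m (n *\<^sub>R B) \<xi> L = - n / 2 * (ln (det B) + real CARD('p)) \<longleftrightarrow>
      L = matrix_inv B \<and> \<xi> = matrix_inv B *v m" unfolding eq .
qed

text \<open>Canonical coordinates of normal laws with means \<open>m i\<close> and covariance
  matrices \<open>B i\<close>.\<close>

definition estimate :: "('k::finite \<Rightarrow> real^'p::finite) \<Rightarrow> ('k \<Rightarrow> real^'p^'p) \<Rightarrow> real^('k \<times> ('p + 'p uprod))" where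
  "estimate m B = param (\<lambda>i. matrix_inv (B i) *v m i) (\<lambda>i. matrix_inv (B i))"

lemma xi_of_estimate [simp]: "xi_of (estimate m B) i = matrix_inv (B i) *v m i"
  by (simp add: estimate_def)

lemma conc_of_estimate: "pos_def_matrix (B i) \<Longrightarrow> conc_of (estimate m B) i = matrix_inv (B i)"
  unfolding estimate_def by (rule conc_of_param) (simp add: pos_def_matrix_inv pos_def_transpose)

lemma estimate_in_normal_params:
  assumes "\<And>i. pos_def_matrix (B i)"
  shows "estimate m B \<in> normal_params"
  using assms by (simp add: normal_params_def conc_of_estimate pos_def_matrix_inv)

lemma loglik_estimate:
  fixes B :: "'k::finite \<Rightarrow> real^'p::finite^'p"
  assumes n: "\<And>i. n i > 0" and B: "\<And>i. pos_def_matrix (B i)"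
  shows "loglik n m (\<lambda>i. real (n i) *\<^sub>R B i) (estimate m B) = (\<Sum>i\<in>UNIV. - real (n i) / 2 * (ln (det (B i)) + real CARD('p)))"
  unfolding loglik_def
proof (rule sum.cong[OF refl])
  fix i
  show "group_loglik (real (n i)) (m i) (real (n i) *\<^sub>R B i) (xi_of (estimate m B) i) (conc_of (estimate m B) i) =
     - real (n i) / 2 * (ln (det (B i)) + real CARD('p))"
    by (rule group_loglik_le(2)[THEN iffD2]) (use n[of i] B in \<open>auto simp: conc_of_estimate pos_def_matrix_inv\<close>)
qed

lemma mle_loglik:
  fixes B :: "'k::finite \<Rightarrow> real^'p::finite^'p"
  assumes n: "\<And>i. n i > 0" and B: "\<And>i. pos_def_matrix (B i)"
  shows "mle_exists normal_params (loglik n m (\<lambda>i. real (n i) *\<^sub>R B i))"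
    and "mle normal_params (loglik n m (\<lambda>i. real (n i) *\<^sub>R B i)) = estimate m B"
proof -
  let ?l = "loglik n m (\<lambda>i. real (n i) *\<^sub>R B i)"
  let ?t = "\<lambda>\<psi> i. group_loglik (real (n i)) (m i) (real (n i) *\<^sub>R B i) (xi_of \<psi> i) (conc_of \<psi> i)"
  let ?b = "\<lambda>i. - real (n i) / 2 * (ln (det (B i)) + real CARD('p))"
  have le: "?t \<psi> i \<le> ?b i" if "\<psi> \<in> normal_params" for \<psi> i
    using that n[of i] B by (intro group_loglik_le(1)) (auto simp: normal_params_def)
  have 1: "?l \<psi> \<le> ?l (estimate m B)" if "\<psi> \<in> normal_params" for \<psi>
    unfolding loglik_estimate[OF n B] unfolding loglik_def by (intro sum_mono le that)
  have 2: "\<psi> = estimate m B" if \<psi>: "\<psi> \<in> normal_params" "?l \<psi> = ?l (estimate m B)" for \<psi>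
  proof -
    have "(\<Sum>i\<in>UNIV. ?t \<psi> i) = (\<Sum>i\<in>UNIV. ?b i)"
      using \<psi>(2) unfolding loglik_estimate[OF n B] unfolding loglik_def .
    then have "?t \<psi> i = ?b i" for i
      using sum_mono_inv[of "?t \<psi>" UNIV ?b i] le[OF \<psi>(1)] by simp
    then have "conc_of \<psi> i = matrix_inv (B i) \<and> xi_of \<psi> i = matrix_inv (B i) *v m i" for i
      using group_loglik_le(2)[of "real (n i)" "conc_of \<psi> i" "B i" "m i" "xi_of \<psi> i"] n[of i] B \<psi>(1)
      by (simp add: normal_params_def)
    then show ?thesis by (intro param_eqI) (auto simp: conc_of_estimate B)
  qed
  have e: "estimate m B \<in> normal_params" by (rule estimate_in_normal_params[OF B])
  show "mle_exists normal_params ?l"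
    by (rule mle_eqI(1)[where l = ?l, OF e 1 2])
  show "mle normal_params ?l = estimate m B"
    by (rule mle_eqI(2)[where l = ?l, OF e 1 2])
qed

lemma det_rank_one_update:
  fixes L :: "real^'p::finite^'p"
  assumes L: "pos_def_matrix L" and v: "v \<noteq> 0"
  shows "pos_def_matrix (L + outer v)" "det (L + outer v) > det L"
proof -
  show pd: "pos_def_matrix (L + outer v)"
    unfolding pos_def_matrix_def
  proof (intro conjI allI impI)
    show "transpose (L + outer v) = L + outer v"
      using pos_def_transpose[OF L] by (simp add: transpose_def vec_eq_iff outer_def mult.commute)
    fix u :: "real^'p" assume "u \<noteq> 0"
    from pos_def_pos[OF L this] show "0 < u \<bullet> ((L + outer v) *v u)"
      by (simp add: matrix_vector_mult_add_rdistrib inner_add_right outer_mult_vec inner_commute add_pos_nonneg)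
  qed
  text \<open>With \<open>B = (L + v v\<^sup>T)\<^sup>-\<^sup>1\<close> the extremal property of \<open>L + v v\<^sup>T\<close> gives
    \<open>ln det L - trace (L B) < ln det (L + v v\<^sup>T) - p\<close>, while \<open>trace (L B) < p\<close>.\<close>
  let ?M = "L + outer v" let ?B = "matrix_inv ?M"
  have B: "pos_def_matrix ?B" by (rule pos_def_matrix_inv[OF pd])
  have dM: "det ?M > 0" by (rule pos_def_det_pos[OF pd])
  have "trace (?M ** ?B) = real CARD('p)" using dM by (simp add: matrix_inv_mult trace_I)
  then have "trace (L ** ?B) = real CARD('p) - v \<bullet> (?B *v v)"
    using trace_mul_sym[of "outer v" ?B] by (simp add: matrix_add_rdistrib' trace_add trace_mult_outer)
  moreover have "v \<bullet> (?B *v v) > 0" by (rule pos_def_pos[OF B v])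
  moreover have "ln (det L) - trace (L ** ?B) \<le> - ln (det ?B) - real CARD('p)"
    by (rule ln_det_minus_trace(1)[OF L B])
  moreover have "ln (det ?B) = - ln (det ?M)" using dM by (simp add: det_matrix_inv ln_inverse)
  ultimately have "ln (det L) < ln (det ?M)" by linarith
  then show "det ?M > det L" using dM pos_def_det_pos[OF L] by simp
qed

text \<open>Choose v nonzero with v^T B v \<le> 0. Adding v v^T to the concentration matrix of any
  candidate raises the log-determinant and does not raise the trace term, so every candidate can be
  strictly improved.\<close>

lemma not_mle_exists:
  fixes B :: "'k::finite \<Rightarrow> real^'p::finite^'p"
  assumes n: "\<And>i. n i > 0" and sym: "\<And>i. transpose (B i) = B i" and B: "\<not> pos_def_matrix (B i0)"
  shows "\<not> mle_exists normal_params (loglik n m (\<lambda>i. real (n i) *\<^sub>R B i))"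
proof
  let ?l = "loglik n m (\<lambda>i. real (n i) *\<^sub>R B i)"
  let ?g = "\<lambda>i. group_loglik (real (n i)) (m i) (real (n i) *\<^sub>R B i)"
  assume "mle_exists normal_params ?l"
  then obtain \<phi> where \<phi>: "\<phi> \<in> normal_params" and max: "\<And>\<psi>. \<psi> \<in> normal_params \<Longrightarrow> ?l \<psi> \<le> ?l \<phi>"
    by (auto simp: mle_exists_def is_arg_max_def not_less)
  obtain v where v: "v \<noteq> 0" "v \<bullet> (B i0 *v v) \<le> 0"
    using B sym[of i0] by (auto simp: pos_def_matrix_def not_less)
  let ?L = "conc_of \<phi> i0"
  have L: "pos_def_matrix ?L" using \<phi> by (simp add: normal_params_def)
  let ?M = "?L + outer v"
  note M = det_rank_one_update[OF L v(1)]
  \<comment> \<open>Adjusting \<xi> along with the concentration matrix places the mean at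
    \<open>m i0\<close>, where the square term vanishes.\<close>
  let ?\<psi> = "param (\<lambda>i. if i = i0 then ?M *v m i else xi_of \<phi> i) (\<lambda>i. if i = i0 then ?M else conc_of \<phi> i)"
  have c: "conc_of ?\<psi> i = (if i = i0 then ?M else conc_of \<phi> i)" for i
    by (rule conc_of_param) (use pos_def_transpose[OF M(1)] in auto)
  have \<psi>: "?\<psi> \<in> normal_params" using \<phi> M(1) by (auto simp: normal_params_def c)
  have lt: "?g i0 (xi_of ?\<psi> i0) (conc_of ?\<psi> i0) > ?g i0 (xi_of \<phi> i0) (conc_of \<phi> i0)"
  proof -
    let ?n = "real (n i0)"
    have n0: "?n > 0" using n by simp
    have inv: "matrix_inv ?M *v (?M *v m i0) = m i0"
      using pos_def_det_pos[OF M(1)] by (simp add: matrix_vector_mul_assoc matrix_inv_mult)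
    have 1: "?g i0 (?M *v m i0) ?M = ?n / 2 * (ln (det ?M) - trace (?M ** B i0))"
      unfolding group_loglik_complete_square[OF M(1)] inv
      by (simp add: matrix_scaleR_right trace_scaleR algebra_simps)
    let ?d = "matrix_inv ?L *v xi_of \<phi> i0 - m i0"
    have 2: "?g i0 (xi_of \<phi> i0) ?L = ?n / 2 * (ln (det ?L) - trace (?L ** B i0) - ?d \<bullet> (?L *v ?d))"
      unfolding group_loglik_complete_square[OF L]
      by (simp add: matrix_scaleR_right trace_scaleR algebra_simps)
    have "trace (outer v ** B i0) = v \<bullet> (B i0 *v v)"
      by (simp add: trace_mul_sym[of "outer v"] trace_mult_outer)
    then have "trace (?M ** B i0) \<le> trace (?L ** B i0)"
      using v(2) by (simp add: matrix_add_rdistrib' trace_add)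
    moreover have "ln (det ?L) < ln (det ?M)" using M(2) pos_def_det_pos[OF L] by simp
    moreover have "0 \<le> ?d \<bullet> (?L *v ?d)" by (rule pos_def_psd[OF L])
    ultimately have "ln (det ?L) - trace (?L ** B i0) - ?d \<bullet> (?L *v ?d) < ln (det ?M) - trace (?M ** B i0)"
      by linarith
    then have "?g i0 (xi_of \<phi> i0) ?L < ?g i0 (?M *v m i0) ?M"
      unfolding 1 2 using n0 by (intro mult_strict_left_mono) auto
    then show ?thesis by (simp add: c)
  qed
  have eq: "?g i (xi_of ?\<psi> i) (conc_of ?\<psi> i) = ?g i (xi_of \<phi> i) (conc_of \<phi> i)" if "i \<noteq> i0" for i
    using that by (simp add: c)
  have "?l \<phi> < ?l ?\<psi>"
    unfolding loglik_def
  proof (rule sum_strict_mono_ex1)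
    show "\<forall>i\<in>UNIV. ?g i (xi_of \<phi> i) (conc_of \<phi> i) \<le> ?g i (xi_of ?\<psi> i) (conc_of ?\<psi> i)"
    proof
      fix i
      show "?g i (xi_of \<phi> i) (conc_of \<phi> i) \<le> ?g i (xi_of ?\<psi> i) (conc_of ?\<psi> i)"
      proof (cases "i = i0")
        case True
        show ?thesis unfolding True by (rule less_imp_le[OF lt])
      next
        case False
        show ?thesis by (rule eq_refl[OF eq[OF False, symmetric]])
      qed
    qed
    show "\<exists>i\<in>UNIV. ?g i (xi_of \<phi> i) (conc_of \<phi> i) < ?g i (xi_of ?\<psi> i) (conc_of ?\<psi> i)"
      by (intro bexI[where x = i0] lt) simp
  qed simp
  with max[OF \<psi>] show False by simp
qed

text \<open>With a common L the scatter matrices enter only through the trace of L times their sum,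
  so each may be replaced by its share n_i B of that sum. This reduces the constrained maximization
  to the unconstrained one.\<close>

lemma loglik_equal_conc:
  fixes A :: "'k::finite \<Rightarrow> real^'p::finite^'p"
  assumes n: "\<And>i. n i > 0" and \<phi>: "\<phi> \<in> equal_conc_params"
    and A: "(\<Sum>i\<in>UNIV. A i) = (\<Sum>i\<in>UNIV. real (n i)) *\<^sub>R B"
  shows "loglik n m A \<phi> = loglik n m (\<lambda>i. real (n i) *\<^sub>R B) \<phi>"
proof -
  obtain L where L: "\<And>i. conc_of \<phi> i = L" using \<phi> by (auto simp: equal_conc_params_def)
  have "loglik n m A \<phi> - loglik n m (\<lambda>i. real (n i) *\<^sub>R B) \<phi> = (\<Sum>i\<in>UNIV. trace (L ** (real (n i) *\<^sub>R B)) / 2 - trace (L ** A i) / 2)"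
    unfolding loglik_def sum_subtractf[symmetric]
    by (intro sum.cong refl) (simp add: group_loglik_def L matrix_add_ldistrib trace_add field_simps)
  also have "\<dots> = (trace (L ** ((\<Sum>i\<in>UNIV. real (n i)) *\<^sub>R B)) - trace (L ** (\<Sum>i\<in>UNIV. A i))) / 2"
    by (simp add: sum_subtractf sum_divide_distrib[symmetric] trace_sum[symmetric] matrix_mult_sum_right[symmetric]
        scaleR_left.sum[symmetric] diff_divide_distrib)
  also have "\<dots> = 0" by (simp add: A)
  finally show ?thesis by simp
qed

lemma mle_equal_conc:
  fixes A :: "'k::finite \<Rightarrow> real^'p::finite^'p"
  assumes n: "\<And>i. n i > 0" and B: "pos_def_matrix B"
    and A: "(\<Sum>i\<in>UNIV. A i) = (\<Sum>i\<in>UNIV. real (n i)) *\<^sub>R B"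
  shows "mle equal_conc_params (loglik n m A) = estimate m (\<lambda>_. B)"
proof (rule mle_eqI(2))
  let ?e = "estimate m (\<lambda>_. B)" and ?l = "loglik n m (\<lambda>i. real (n i) *\<^sub>R B)"
  show e: "?e \<in> equal_conc_params"
    using estimate_in_normal_params[of "\<lambda>_. B" m] B by (simp add: equal_conc_params_def conc_of_estimate)
  have mm: "is_arg_max ?l (\<lambda>x. x \<in> normal_params) ?e"
    using mle_loglik[of n "\<lambda>_. B" m, OF n B]
    unfolding mle_exists_def mle_def arg_max_on_def arg_max_def by (metis someI_ex)
  fix \<psi> assume \<psi>: "\<psi> \<in> (equal_conc_params :: (real^('k \<times> ('p + 'p uprod))) set)"
  then have \<psi>': "\<psi> \<in> normal_params" by (simp add: equal_conc_params_def)
  note eq = loglik_equal_conc[OF n \<psi> A, of m] loglik_equal_conc[OF n e A, of m]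
  show "loglik n m A \<psi> \<le> loglik n m A ?e"
    unfolding eq using mm \<psi>' by (auto simp: is_arg_max_def not_less)
  assume "loglik n m A \<psi> = loglik n m A ?e"
  then have "?l \<psi> = ?l ?e" unfolding eq .
  then have "is_arg_max ?l (\<lambda>x. x \<in> normal_params) \<psi>"
    using mm \<psi>' by (auto simp: is_arg_max_def)
  then show "\<psi> = ?e"
  proof -
    have "conc_of \<psi> i = matrix_inv B \<and> xi_of \<psi> i = matrix_inv B *v m i" for i
    proof -
      let ?t = "\<lambda>i. group_loglik (real (n i)) (m i) (real (n i) *\<^sub>R B) (xi_of \<psi> i) (conc_of \<psi> i)"
      let ?b = "\<lambda>i. - real (n i) / 2 * (ln (det B) + real CARD('p))"
      have pd: "pos_def_matrix (conc_of \<psi> i)" for i using \<psi>' by (simp add: normal_params_def)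
      have "(\<Sum>i\<in>UNIV. ?t i) = (\<Sum>i\<in>UNIV. ?b i)"
        using \<open>?l \<psi> = ?l ?e\<close> unfolding loglik_estimate[of n "\<lambda>_. B" m, OF n B] unfolding loglik_def .
      then have "?t i = ?b i"
        using sum_mono_inv[of ?t UNIV ?b i] group_loglik_le(1)[OF _ pd B] n by simp
      then show ?thesis using group_loglik_le(2)[OF _ pd B] n by simp
    qed
    then show ?thesis by (intro param_eqI) (auto simp: conc_of_estimate B)
  qed
qed

section \<open>Gradient and Hessian\<close>

definition dgroup_loglik :: "real \<Rightarrow> real^'p \<Rightarrow> real^'p^'p \<Rightarrow> real^'p \<Rightarrow> real^'p^'p \<Rightarrow> real^'p \<Rightarrow> real^'p::finite^'p \<Rightarrow> real" where
  "dgroup_loglik n m A \<xi> L x H = n * (x \<bullet> m) - trace (H ** (A + n *\<^sub>R outer m)) / 2 + n / 2 * trace (matrix_inv L ** H)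
     - n * (x \<bullet> (matrix_inv L *v \<xi>)) + n / 2 * ((matrix_inv L *v \<xi>) \<bullet> (H *v (matrix_inv L *v \<xi>)))"

text \<open>\<open>S\<close> is the covariance L^-1 and \<mu> the mean at the point of
  differentiation. As in every exponential family in canonical parameters, the data do not enter the
  second derivative.\<close>

definition d2group_loglik :: "real \<Rightarrow> real^'p^'p \<Rightarrow> real^'p \<Rightarrow> real^'p \<Rightarrow> real^'p^'p \<Rightarrow> real^'p \<Rightarrow> real^'p::finite^'p \<Rightarrow> real" where
  "d2group_loglik n S \<mu> x' H' x H = - n / 2 * trace (S ** H' ** S ** H)
     - n * ((x - H *v \<mu>) \<bullet> (S *v (x' - H' *v \<mu>)))"

context
  fixes \<phi> :: "real^('k::finite \<times> ('p::finite + 'p uprod))" and i :: 'k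
  assumes pd: "pos_def_matrix (conc_of \<phi> i)"
begin

abbreviation (input) "S0 \<equiv> matrix_inv (conc_of \<phi> i)"
abbreviation (input) "\<mu>0 \<equiv> matrix_inv (conc_of \<phi> i) *v xi_of \<phi> i"

lemma has_derivative_xi_of: "((\<lambda>\<phi>. xi_of \<phi> i) has_derivative (\<lambda>\<psi>. xi_of \<psi> i)) (at \<phi>)"
  by (rule bounded_linear_imp_has_derivative[OF bounded_linear_xi_of])

lemma has_derivative_conc_of: "((\<lambda>\<phi>. conc_of \<phi> i) has_derivative (\<lambda>\<psi>. conc_of \<psi> i)) (at \<phi>)"
  by (rule bounded_linear_imp_has_derivative[OF bounded_linear_conc_of])

lemma has_derivative_inv_conc_of:
  "((\<lambda>\<phi>. matrix_inv (conc_of \<phi> i)) has_derivative (\<lambda>\<psi>. - (S0 ** conc_of \<psi> i ** S0))) (at \<phi>)"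
  by (rule has_derivative_compose[OF has_derivative_conc_of has_derivative_matrix_inv_at])
    (use pos_def_det_pos[OF pd] in simp)

lemma has_derivative_mean:
  "((\<lambda>\<phi>. matrix_inv (conc_of \<phi> i) *v xi_of \<phi> i) has_derivative
    (\<lambda>\<psi>. S0 *v (xi_of \<psi> i - conc_of \<psi> i *v \<mu>0))) (at \<phi>)"
proof -
  have "((\<lambda>\<phi>. matrix_inv (conc_of \<phi> i) *v xi_of \<phi> i) has_derivative
    (\<lambda>\<psi>. S0 *v xi_of \<psi> i + (- (S0 ** conc_of \<psi> i ** S0)) *v xi_of \<phi> i)) (at \<phi>)"
    by (rule bounded_bilinear.FDERIV[OF bounded_bilinear_matrix_vector_mult has_derivative_inv_conc_of has_derivative_xi_of])
  moreover have "S0 *v xi_of \<psi> i + (- (S0 ** conc_of \<psi> i ** S0)) *v xi_of \<phi> i = S0 *v (xi_of \<psi> i - conc_of \<psi> i *v \<mu>0)" for \<psi>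
  proof -
    have "(- (S0 ** conc_of \<psi> i ** S0)) *v xi_of \<phi> i = - (S0 *v (conc_of \<psi> i *v \<mu>0))"
      by (simp only: matrix_vector_mult_minus_left matrix_vector_mul_assoc matrix_mul_assoc)
    then show ?thesis by (simp only: matrix_vector_mult_diff_distrib) simp
  qed
  ultimately show ?thesis by simp
qed

lemma has_derivative_group_loglik:
  "((\<lambda>\<phi>. group_loglik n m A (xi_of \<phi> i) (conc_of \<phi> i)) has_derivative
    (\<lambda>\<psi>. dgroup_loglik n m A (xi_of \<phi> i) (conc_of \<phi> i) (xi_of \<psi> i) (conc_of \<psi> i))) (at \<phi>)"
proof -
  let ?C = "A + n *\<^sub>R outer m"
  have bt: "bounded_linear (\<lambda>X. trace (X ** ?C))"
    by (rule bounded_linear_compose[OF bounded_linear_trace bounded_bilinear.bounded_linear_left[OF bounded_bilinear_matrix_mult]])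
  have 1: "((\<lambda>\<phi>. n * (xi_of \<phi> i \<bullet> m)) has_derivative (\<lambda>\<psi>. n * (xi_of \<psi> i \<bullet> m))) (at \<phi>)"
    by (intro has_derivative_mult_right has_derivative_inner_left has_derivative_xi_of)
  have 2: "((\<lambda>\<phi>. trace (conc_of \<phi> i ** ?C) / 2) has_derivative (\<lambda>\<psi>. trace (conc_of \<psi> i ** ?C) / 2)) (at \<phi>)"
    by (intro bounded_linear_imp_has_derivative bounded_linear_divide[THEN bounded_linear_compose]
        bounded_linear_compose[OF bt bounded_linear_conc_of])
  have 3: "((\<lambda>\<phi>. n / 2 * ln (det (conc_of \<phi> i))) has_derivative (\<lambda>\<psi>. n / 2 * trace (S0 ** conc_of \<psi> i))) (at \<phi>)"
    by (intro has_derivative_mult_right has_derivative_compose[OF has_derivative_conc_of has_derivative_ln_det_at] pos_def_det_pos pd)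
  have 4: "((\<lambda>\<phi>. n / 2 * (xi_of \<phi> i \<bullet> (matrix_inv (conc_of \<phi> i) *v xi_of \<phi> i))) has_derivative
    (\<lambda>\<psi>. n / 2 * (xi_of \<phi> i \<bullet> (S0 *v (xi_of \<psi> i - conc_of \<psi> i *v \<mu>0)) + xi_of \<psi> i \<bullet> \<mu>0))) (at \<phi>)"
    by (intro has_derivative_mult_right bounded_bilinear.FDERIV[OF bounded_bilinear_inner has_derivative_xi_of has_derivative_mean])
  have eq: "n * (xi_of \<psi> i \<bullet> m) - trace (conc_of \<psi> i ** ?C) / 2 + n / 2 * trace (S0 ** conc_of \<psi> i)
      - n / 2 * (xi_of \<phi> i \<bullet> (S0 *v (xi_of \<psi> i - conc_of \<psi> i *v \<mu>0)) + xi_of \<psi> i \<bullet> \<mu>0)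
      = dgroup_loglik n m A (xi_of \<phi> i) (conc_of \<phi> i) (xi_of \<psi> i) (conc_of \<psi> i)" for \<psi>
  proof -
    have "xi_of \<phi> i \<bullet> (S0 *v (xi_of \<psi> i - conc_of \<psi> i *v \<mu>0)) = \<mu>0 \<bullet> (xi_of \<psi> i - conc_of \<psi> i *v \<mu>0)"
      using matrix_self_adjoint[OF pos_def_transpose[OF pos_def_matrix_inv[OF pd]]] by simp
    also have "\<dots> = xi_of \<psi> i \<bullet> \<mu>0 - \<mu>0 \<bullet> (conc_of \<psi> i *v \<mu>0)"
      by (simp only: inner_diff_right) (simp only: inner_commute)
    finally show ?thesis by (simp only: dgroup_loglik_def) (simp add: field_simps)
  qed
  have "((\<lambda>\<phi>. n * (xi_of \<phi> i \<bullet> m) - trace (conc_of \<phi> i ** ?C) / 2 + n / 2 * ln (det (conc_of \<phi> i))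
      - n / 2 * (xi_of \<phi> i \<bullet> (matrix_inv (conc_of \<phi> i) *v xi_of \<phi> i))) has_derivative
    (\<lambda>\<psi>. n * (xi_of \<psi> i \<bullet> m) - trace (conc_of \<psi> i ** ?C) / 2 + n / 2 * trace (S0 ** conc_of \<psi> i)
      - n / 2 * (xi_of \<phi> i \<bullet> (S0 *v (xi_of \<psi> i - conc_of \<psi> i *v \<mu>0)) + xi_of \<psi> i \<bullet> \<mu>0))) (at \<phi>)"
    by (rule has_derivative_diff[OF has_derivative_add[OF has_derivative_diff[OF 1 2] 3] 4])
  then show ?thesis unfolding eq group_loglik_def .
qed

lemma has_derivative_dgroup_loglik:
  assumes H: "transpose H = H"
  shows "((\<lambda>\<phi>. dgroup_loglik n m A (xi_of \<phi> i) (conc_of \<phi> i) x H) has_derivative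
    (\<lambda>\<psi>. d2group_loglik n S0 \<mu>0 (xi_of \<psi> i) (conc_of \<psi> i) x H)) (at \<phi>)"
proof -
  let ?dm = "\<lambda>\<psi>. S0 *v (xi_of \<psi> i - conc_of \<psi> i *v \<mu>0)"
  have bt: "bounded_linear (\<lambda>X. trace (X ** H))"
    by (rule bounded_linear_compose[OF bounded_linear_trace bounded_bilinear.bounded_linear_left[OF bounded_bilinear_matrix_mult]])
  have bH: "bounded_linear (\<lambda>v. H *v v)"
    by (rule bounded_bilinear.bounded_linear_right[OF bounded_bilinear_matrix_vector_mult])
  have 1: "((\<lambda>\<phi>. n / 2 * trace (matrix_inv (conc_of \<phi> i) ** H)) has_derivative
    (\<lambda>\<psi>. n / 2 * trace (- (S0 ** conc_of \<psi> i ** S0) ** H))) (at \<phi>)"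
    by (intro has_derivative_mult_right has_derivative_compose[OF has_derivative_inv_conc_of bounded_linear_imp_has_derivative[OF bt]])
  have 2: "((\<lambda>\<phi>. n * (x \<bullet> (matrix_inv (conc_of \<phi> i) *v xi_of \<phi> i))) has_derivative (\<lambda>\<psi>. n * (x \<bullet> ?dm \<psi>))) (at \<phi>)"
    by (intro has_derivative_mult_right has_derivative_inner_right has_derivative_mean)
  have 3: "((\<lambda>\<phi>. H *v (matrix_inv (conc_of \<phi> i) *v xi_of \<phi> i)) has_derivative (\<lambda>\<psi>. H *v ?dm \<psi>)) (at \<phi>)"
    by (rule bounded_linear.has_derivative[OF bH has_derivative_mean])
  have 4: "((\<lambda>\<phi>. n / 2 * ((matrix_inv (conc_of \<phi> i) *v xi_of \<phi> i) \<bullet> (H *v (matrix_inv (conc_of \<phi> i) *v xi_of \<phi> i)))) has_derivative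
    (\<lambda>\<psi>. n / 2 * (\<mu>0 \<bullet> (H *v ?dm \<psi>) + ?dm \<psi> \<bullet> (H *v \<mu>0)))) (at \<phi>)"
    by (intro has_derivative_mult_right bounded_bilinear.FDERIV[OF bounded_bilinear_inner has_derivative_mean 3])
  have "((\<lambda>\<phi>. (n * (x \<bullet> m) - trace (H ** (A + n *\<^sub>R outer m)) / 2) + n / 2 * trace (matrix_inv (conc_of \<phi> i) ** H)
      - n * (x \<bullet> (matrix_inv (conc_of \<phi> i) *v xi_of \<phi> i))
      + n / 2 * ((matrix_inv (conc_of \<phi> i) *v xi_of \<phi> i) \<bullet> (H *v (matrix_inv (conc_of \<phi> i) *v xi_of \<phi> i)))) has_derivative
    (\<lambda>\<psi>. 0 + n / 2 * trace (- (S0 ** conc_of \<psi> i ** S0) ** H) - n * (x \<bullet> ?dm \<psi>)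
      + n / 2 * (\<mu>0 \<bullet> (H *v ?dm \<psi>) + ?dm \<psi> \<bullet> (H *v \<mu>0)))) (at \<phi>)"
    by (rule has_derivative_add[OF has_derivative_diff[OF has_derivative_add[OF has_derivative_const 1] 2] 4])
  moreover have "0 + n / 2 * trace (- (S0 ** conc_of \<psi> i ** S0) ** H) - n * (x \<bullet> ?dm \<psi>)
      + n / 2 * (\<mu>0 \<bullet> (H *v ?dm \<psi>) + ?dm \<psi> \<bullet> (H *v \<mu>0)) = d2group_loglik n S0 \<mu>0 (xi_of \<psi> i) (conc_of \<psi> i) x H" for \<psi>
  proof -
    have a: "\<mu>0 \<bullet> (H *v ?dm \<psi>) = (H *v \<mu>0) \<bullet> ?dm \<psi>"
      by (rule matrix_self_adjoint[OF H, symmetric])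
    have b: "trace ((- (S0 ** conc_of \<psi> i ** S0)) ** H) = - trace (S0 ** conc_of \<psi> i ** S0 ** H)"
      by (simp only: matrix_mult_minus_left trace_minus)
    show ?thesis
      unfolding a b inner_commute[of "?dm \<psi>" "H *v \<mu>0"] d2group_loglik_def inner_diff_left
      by (simp add: field_simps)
  qed
  ultimately show ?thesis unfolding dgroup_loglik_def by simp
qed

end

text \<open>The gradient formula is available on this set, and openness allows it to be
  differentiated again. \<open>conc_of\<close> takes symmetric values only, so openness among
  symmetric matrices suffices.\<close>

lemma open_normal_params: "open (normal_params :: (real^('k::finite \<times> ('p::finite + 'p uprod))) set)"
proof -
  have "open {\<phi> :: real^('k \<times> ('p + 'p uprod)). pos_def_matrix (conc_of \<phi> i)}" for i
  proof (subst open_subopen, intro ballI)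
    fix \<phi> :: "real^('k \<times> ('p + 'p uprod))" assume "\<phi> \<in> {\<phi>. pos_def_matrix (conc_of \<phi> i)}"
    then have "pos_def_matrix (conc_of \<phi> i)" by simp
    from pos_def_perturb[OF this] obtain e where e: "e > 0"
      "\<And>B. transpose B = B \<Longrightarrow> norm (B - conc_of \<phi> i) < e \<Longrightarrow> pos_def_matrix B" by blast
    have "open {\<psi>. norm (conc_of \<psi> i - conc_of \<phi> i) < e}"
      by (intro open_Collect_less continuous_intros linear_continuous_on bounded_linear_conc_of)
    then show "\<exists>T. open T \<and> \<phi> \<in> T \<and> T \<subseteq> {\<phi>. pos_def_matrix (conc_of \<phi> i)}"
      using e by (intro exI[of _ "{\<psi>. norm (conc_of \<psi> i - conc_of \<phi> i) < e}"]) auto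
  qed
  then have "open (\<Inter>i\<in>UNIV. {\<phi> :: real^('k \<times> ('p + 'p uprod)). pos_def_matrix (conc_of \<phi> i)})"
    by (intro open_INT) auto
  moreover have "normal_params = (\<Inter>i\<in>UNIV. {\<phi> :: real^('k \<times> ('p + 'p uprod)). pos_def_matrix (conc_of \<phi> i)})"
    by (auto simp: normal_params_def)
  ultimately show ?thesis by simp
qed

lemma linear_eq_inner_axis:
  fixes f :: "real^'m::finite \<Rightarrow> real"
  assumes "linear f"
  shows "v \<bullet> (\<chi> j. f (axis j 1)) = f v"
proof -
  have "f v = f (\<Sum>j\<in>UNIV. v $ j *\<^sub>R axis j 1)"
    using basis_expansion[of v] by (simp add: scalar_mult_eq_scaleR)
  also have "\<dots> = (\<Sum>j\<in>UNIV. v $ j * f (axis j 1))"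
    by (simp add: linear_sum[OF assms] linear_scale[OF assms])
  finally show ?thesis by (simp add: inner_vec_def)
qed

lemma grad_eq:
  fixes f :: "real^'m::finite \<Rightarrow> real"
  assumes "(f has_derivative f') (at x)"
  shows "grad f x = (\<chi> j. f' (axis j 1))"
  using frechet_derivative_at[OF assms] by (simp add: grad_def)

definition dloglik where
  "dloglik n m A \<phi> \<psi> = (\<Sum>i\<in>UNIV. dgroup_loglik (real (n i)) (m i) (A i) (xi_of \<phi> i) (conc_of \<phi> i) (xi_of \<psi> i) (conc_of \<psi> i))"

lemma has_derivative_loglik:
  assumes "\<phi> \<in> normal_params"
  shows "(loglik n m A has_derivative dloglik n m A \<phi>) (at \<phi>)"
  unfolding loglik_def[abs_def] dloglik_def[abs_def]
  using assms by (intro has_derivative_sum has_derivative_group_loglik) (auto simp: normal_params_def)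

lemma grad_loglik:
  assumes "\<phi> \<in> normal_params"
  shows "grad (loglik n m A) \<phi> = (\<chi> j. dloglik n m A \<phi> (axis j 1))"
    and "\<psi> \<bullet> grad (loglik n m A) \<phi> = dloglik n m A \<phi> \<psi>"
proof -
  note d = has_derivative_loglik[OF assms, of n m A]
  show 1: "grad (loglik n m A) \<phi> = (\<chi> j. dloglik n m A \<phi> (axis j 1))" by (rule grad_eq[OF d])
  show "\<psi> \<bullet> grad (loglik n m A) \<phi> = dloglik n m A \<phi> \<psi>"
    unfolding 1 by (rule linear_eq_inner_axis[OF has_derivative_linear[OF d]])
qed

definition d2loglik where
  "d2loglik n \<phi> \<psi> v = (\<Sum>i\<in>UNIV. d2group_loglik (real (n i)) (matrix_inv (conc_of \<phi> i)) (matrix_inv (conc_of \<phi> i) *v xi_of \<phi> i)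
     (xi_of \<psi> i) (conc_of \<psi> i) (xi_of v i) (conc_of v i))"

lemma d2group_loglik_linear:
  "d2group_loglik n S \<mu> x' H' (x + y) (H + K) = d2group_loglik n S \<mu> x' H' x H + d2group_loglik n S \<mu> x' H' y K"
  "d2group_loglik n S \<mu> x' H' (c *\<^sub>R x) (c *\<^sub>R H) = c * d2group_loglik n S \<mu> x' H' x H"
proof -
  have "(x + y) - (H + K) *v \<mu> = (x - H *v \<mu>) + (y - K *v \<mu>)"
    by (simp add: matrix_vector_mult_add_rdistrib)
  then show "d2group_loglik n S \<mu> x' H' (x + y) (H + K) = d2group_loglik n S \<mu> x' H' x H + d2group_loglik n S \<mu> x' H' y K"
    unfolding d2group_loglik_def by (simp only: matrix_add_ldistrib trace_add inner_add_left distrib_left)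
  have "c *\<^sub>R x - (c *\<^sub>R H) *v \<mu> = c *\<^sub>R (x - H *v \<mu>)"
    by (simp add: scaleR_matrix_vector_assoc[symmetric] scaleR_diff_right)
  then show "d2group_loglik n S \<mu> x' H' (c *\<^sub>R x) (c *\<^sub>R H) = c * d2group_loglik n S \<mu> x' H' x H"
    unfolding d2group_loglik_def by (simp only: matrix_scaleR_right trace_scaleR inner_scaleR_left) (simp add: algebra_simps)
qed

lemma linear_d2loglik: "linear (d2loglik n \<phi> \<psi>)"
  by (rule linearI)
    (simp_all add: d2loglik_def xi_of_linear conc_of_linear d2group_loglik_linear sum.distrib sum_distrib_left)

text \<open>Stating the Hessian as a bilinear form lets the later change of variables be made on
  directions (x, H) instead of matrix entries.\<close>

lemma hessian_loglik:
  fixes \<phi> :: "real^('k::finite \<times> ('p::finite + 'p uprod))"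
  assumes \<phi>: "\<phi> \<in> normal_params"
  shows "v \<bullet> (hessian (loglik n m A) \<phi> *v \<psi>) = d2loglik n \<phi> \<psi> v"
proof -
  let ?G = "\<lambda>\<psi>. \<chi> j. d2loglik n \<phi> \<psi> (axis j 1)"
  have "((\<lambda>\<phi>. dloglik n m A \<phi> u) has_derivative (\<lambda>\<psi>. d2loglik n \<phi> \<psi> u)) (at \<phi>)" for u
    unfolding dloglik_def d2loglik_def
    using \<phi> by (intro has_derivative_sum has_derivative_dgroup_loglik) (auto simp: normal_params_def)
  then have "((\<lambda>\<phi>. \<chi> j. dloglik n m A \<phi> (axis j 1)) has_derivative ?G) (at \<phi>)"
    by (intro has_derivative_vec) simp
  then have G: "(grad (loglik n m A) has_derivative ?G) (at \<phi>)"
    by (rule has_derivative_transform_within_open[OF _ open_normal_params \<phi>]) (simp add: grad_loglik(1))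
  have "hessian (loglik n m A) \<phi> = matrix ?G"
    unfolding hessian_def jacobian_def using frechet_derivative_at[OF G] by simp
  then have "hessian (loglik n m A) \<phi> *v \<psi> = ?G \<psi>"
    using matrix_mult_vec_linear[OF has_derivative_linear[OF G], of \<psi>] by simp
  then show ?thesis using linear_eq_inner_axis[OF linear_d2loglik] by simp
qed

section \<open>Determinant of the observed information\<close>

definition conc_vec :: "real^('k::finite \<times> ('p::finite + 'p uprod)) \<Rightarrow> 'k \<Rightarrow> real^('p uprod)" where
  "conc_vec \<psi> i = (\<chi> u. \<psi> $ (i, Inr u))"

lemma sym_of_conc_vec: "sym_of (conc_vec \<psi> i) = conc_of \<psi> i"
  by (simp add: conc_vec_def sym_of_def conc_of_def)

lemma conc_vec_linear: "conc_vec (\<phi> + \<psi>) i = conc_vec \<phi> i + conc_vec \<psi> i" "conc_vec (c *\<^sub>R \<phi>) i = c *\<^sub>R conc_vec \<phi> i"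
  by (simp_all add: conc_vec_def vec_eq_iff)

definition pack :: "('k::finite \<Rightarrow> real^'p::finite) \<Rightarrow> ('k \<Rightarrow> real^('p uprod)) \<Rightarrow> real^('k \<times> ('p + 'p uprod))" where
  "pack x v = (\<chi> j. case snd j of Inl a \<Rightarrow> x (fst j) $ a | Inr u \<Rightarrow> v (fst j) $ u)"

lemma xi_of_pack [simp]: "xi_of (pack x v) i = x i"
  by (simp add: xi_of_def pack_def vec_eq_iff)

lemma conc_vec_pack [simp]: "conc_vec (pack x v) i = v i"
  by (simp add: conc_vec_def pack_def vec_eq_iff)

lemma conc_of_pack [simp]: "conc_of (pack x v) i = sym_of (v i)"
  by (metis sym_of_conc_vec conc_vec_pack)

lemma pack_eqI: "(\<And>i. xi_of \<phi> i = xi_of \<psi> i) \<Longrightarrow> (\<And>i. conc_vec \<phi> i = conc_vec \<psi> i) \<Longrightarrow> \<phi> = \<psi>"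
  by (rule param_eqI) (simp_all add: sym_of_conc_vec[symmetric])

definition block_act :: "('k::finite \<Rightarrow> real^'p::finite^'p) \<Rightarrow> real^('k \<times> ('p + 'p uprod)) \<Rightarrow> real^('k \<times> ('p + 'p uprod))" where
  "block_act g \<psi> = pack (\<lambda>i. g i *v xi_of \<psi> i) (\<lambda>i. sym_cong (g i) (conc_vec \<psi> i))"

lemma linear_block_act: "linear (block_act g)"
  by (rule linearI; rule pack_eqI)
    (simp_all add: block_act_def xi_of_linear conc_vec_linear matrix_vector_right_distrib matrix_vector_mult_scaleR
      linear_add[OF linear_sym_cong] linear_scale[OF linear_sym_cong])

lemma block_act_mult: "block_act (\<lambda>i. g i ** h i) \<psi> = block_act g (block_act h \<psi>)"
  by (rule pack_eqI) (simp_all add: block_act_def sym_cong_mult matrix_vector_mul_assoc)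

lemma sym_cong_1: "sym_cong (mat 1) v = v"
  by (simp add: sym_cong_def)

text \<open>The exponent is 1 from the action on \<xi> plus p + 1 from the congruence on the
  symmetric part; this is the origin of p + 2 in the saddlepoint exponent. With one active group the
  map is multiplicative in a single matrix, so the criterion for powers of determinants
  applies.\<close>

lemma abs_det_block_act_single:
  fixes A :: "real^'p::finite^'p" and i :: "'k::finite"
  shows "\<bar>det (matrix (block_act (\<lambda>j. if j = i then A else mat 1)))\<bar> = \<bar>det A\<bar> ^ (CARD('p) + 2)"
proof (rule multiplicative_eq_abs_det_power)
  let ?B = "\<lambda>A j. if j = i then A else mat 1 :: real^'p^'p"
  fix A B :: "real^'p^'p"
  have "?B (A ** B) = (\<lambda>j. ?B A j ** ?B B j)" by (simp add: fun_eq_iff)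
  then have "block_act (?B (A ** B)) = (\<lambda>\<psi>. block_act (?B A) (block_act (?B B) \<psi>))"
    by (simp add: block_act_mult[symmetric] fun_eq_iff)
  then show "\<bar>det (matrix (block_act (?B (A ** B))))\<bar> = \<bar>det (matrix (block_act (?B A)))\<bar> * \<bar>det (matrix (block_act (?B B)))\<bar>"
    using det_matrix_compose[OF linear_block_act linear_block_act, of "?B A" "?B B"] by (simp add: abs_mult)
next
  let ?B = "\<lambda>A j. if j = i then A else mat 1 :: real^'p^'p"
  fix d :: "'p \<Rightarrow> real"
  define e where "e u = sym_cong (diag_matrix d) 1 $ u" for u
  have sc: "sym_cong (diag_matrix d) v $ u = e u * v $ u" for v u
    by (cases u) (simp add: e_def sym_cong_diag)
  have "\<bar>\<Prod>u\<in>UNIV. e u\<bar> = \<bar>det (matrix (sym_cong (diag_matrix d)))\<bar>"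
    by (subst det_matrix_diag[where c = e]) (auto simp: sc)
  then have pe: "\<bar>\<Prod>u\<in>UNIV. e u\<bar> = \<bar>\<Prod>a\<in>UNIV. d a\<bar> ^ (CARD('p) + 1)"
    by (simp add: abs_det_sym_cong)
  define c where "c j = (if fst j = i then (case snd j of Inl a \<Rightarrow> d a | Inr u \<Rightarrow> e u) else 1)" for j :: "'k \<times> ('p + 'p uprod)"
  have "block_act (?B (diag_matrix d)) v $ j = c j * v $ j" for v :: "real^('k \<times> ('p + 'p uprod))" and j
  proof -
    obtain i' z where j: "j = (i', z)" by (cases j)
    show ?thesis
      by (cases z) (auto simp: j c_def block_act_def pack_def sc sym_cong_1 diag_matrix_mult_vec xi_of_def conc_vec_def)
  qed
  then have "det (matrix (block_act (?B (diag_matrix d)))) = (\<Prod>j\<in>UNIV. c j)"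
    by (intro det_matrix_diag)
  also have "\<dots> = (\<Prod>i'\<in>UNIV. \<Prod>z\<in>UNIV. c (i', z))"
    by (simp only: prod.cartesian_product UNIV_Times_UNIV split_def prod.collapse)
  also have "\<dots> = (\<Prod>z\<in>UNIV. c (i, z)) * (\<Prod>i'\<in>UNIV - {i}. \<Prod>z\<in>UNIV. c (i', z))"
    by (simp add: prod.remove[of UNIV i])
  also have "(\<Prod>i'\<in>UNIV - {i}. \<Prod>z\<in>UNIV. c (i', z)) = 1"
    by (intro prod.neutral ballI) (simp add: c_def)
  also have "(\<Prod>z\<in>UNIV. c (i, z)) = (\<Prod>a\<in>UNIV. d a) * (\<Prod>u\<in>UNIV. e u)"
    by (simp only: UNIV_Plus_UNIV[symmetric], subst prod.Plus) (simp_all add: c_def)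
  finally show "\<bar>det (matrix (block_act (?B (diag_matrix d))))\<bar> = \<bar>\<Prod>i\<in>UNIV. d i\<bar> ^ (CARD('p) + 2)"
    by (simp add: abs_mult pe)
qed auto

lemma abs_det_block_act:
  fixes g :: "'k::finite \<Rightarrow> real^'p::finite^'p"
  shows "\<bar>det (matrix (block_act g))\<bar> = (\<Prod>i\<in>UNIV. \<bar>det (g i)\<bar> ^ (CARD('p) + 2))"
proof -
  let ?g = "\<lambda>I i. if i \<in> I then g i else mat 1"
  have "\<bar>det (matrix (block_act (?g I)))\<bar> = (\<Prod>i\<in>I. \<bar>det (g i)\<bar> ^ (CARD('p) + 2))" if "finite I" for I
    using that
  proof (induction I rule: finite_induct)
    case empty
    have "block_act (\<lambda>i::'k. mat 1 :: real^'p^'p) = (\<lambda>\<psi>. \<psi>)"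
      by (rule ext, rule pack_eqI) (simp_all add: block_act_def sym_cong_1)
    then have "det (matrix (block_act (\<lambda>i::'k. mat 1 :: real^'p^'p))) = 1"
      using det_matrix_diag[of "\<lambda>\<psi> :: real^('k \<times> ('p + 'p uprod)). \<psi>" "\<lambda>_. 1"] by simp
    then show ?case by simp
  next
    case (insert i I)
    let ?s = "\<lambda>j. if j = i then g i else mat 1"
    have "?g (insert i I) = (\<lambda>j. ?s j ** ?g I j)" using insert.hyps by (auto simp: fun_eq_iff)
    then have "block_act (?g (insert i I)) = (\<lambda>\<psi>. block_act ?s (block_act (?g I) \<psi>))"
      by (simp only: block_act_mult[symmetric] fun_eq_iff) simp
    then have "\<bar>det (matrix (block_act (?g (insert i I))))\<bar> = \<bar>det (matrix (block_act ?s))\<bar> * \<bar>det (matrix (block_act (?g I)))\<bar>"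
      using det_matrix_compose[OF linear_block_act linear_block_act, of ?s "?g I"] by (simp only: abs_mult)
    then show ?case by (simp only: abs_det_block_act_single insert.IH prod.insert[OF insert.hyps])
  qed
  from this[of UNIV] show ?thesis by simp
qed

definition shear :: "('k::finite \<Rightarrow> real^'p::finite) \<Rightarrow> real^('k \<times> ('p + 'p uprod)) \<Rightarrow> real^('k \<times> ('p + 'p uprod))" where
  "shear m \<psi> = pack (\<lambda>i. xi_of \<psi> i - conc_of \<psi> i *v m i) (conc_vec \<psi>)"

lemma linear_shear: "linear (shear m)"
  by (rule linearI; rule pack_eqI)
    (simp_all add: shear_def xi_of_linear conc_of_linear conc_vec_linear matrix_vector_mult_add_rdistrib
      scaleR_matrix_vector_assoc[symmetric] scaleR_diff_right)

text \<open>The shear depends only on the means, which stay fixed along the line, so its determinant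
  goes into the constant factor.\<close>

lemma det_shear_nz: "det (matrix (shear m)) \<noteq> 0"
proof -
  have "inj (shear m)"
  proof (rule linear_injective_0[OF linear_shear, THEN iffD2], intro allI impI)
    fix \<psi> assume z: "shear m \<psi> = 0"
    have zero: "conc_vec (0 :: real^('a \<times> ('b + 'b uprod))) i = 0" "xi_of (0 :: real^('a \<times> ('b + 'b uprod))) i = 0" for i
      by (simp_all add: conc_vec_def xi_of_def vec_eq_iff)
    have c0: "conc_vec \<psi> i = 0" for i
      using arg_cong[OF z, of "\<lambda>\<psi>. conc_vec \<psi> i"] by (simp add: shear_def zero)
    then have "conc_of \<psi> i = 0" for i by (simp add: sym_of_conc_vec[symmetric])
    then have "xi_of \<psi> i = 0" for i
      using arg_cong[OF z, of "\<lambda>\<psi>. xi_of \<psi> i"] by (simp add: shear_def zero)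
    then show "\<psi> = 0" using c0 by (intro pack_eqI) (simp_all add: zero)
  qed
  then show ?thesis using det_nz_iff_inj[OF linear_shear] by blast
qed

text \<open>The observed information at means zero and identity covariance matrices.\<close>

definition unit_form :: "('k::finite \<Rightarrow> nat) \<Rightarrow> real^('k \<times> ('p::finite + 'p uprod)) \<Rightarrow> real^('k \<times> ('p + 'p uprod)) \<Rightarrow> real" where
  "unit_form n \<psi> v = (\<Sum>i\<in>UNIV. real (n i) / 2 * trace (conc_of \<psi> i ** conc_of v i) + real (n i) * (xi_of v i \<bullet> xi_of \<psi> i))"

lemma unit_form_matrix:
  fixes n :: "'k::finite \<Rightarrow> nat"
  assumes n: "\<And>i. n i > 0"
  obtains J :: "real^('k \<times> ('p::finite + 'p uprod))^('k \<times> ('p + 'p uprod))"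
  where "det J > 0" "\<And>\<psi> v. v \<bullet> (J *v \<psi>) = unit_form n \<psi> v"
proof -
  let ?Q = "unit_form n :: real^('k \<times> ('p + 'p uprod)) \<Rightarrow> _"
  have lin2: "linear (?Q \<psi>)" for \<psi>
    by (rule linearI)
      (simp_all add: unit_form_def xi_of_linear conc_of_linear matrix_add_ldistrib trace_add inner_add_left
        matrix_scaleR_right trace_scaleR sum.distrib[symmetric] sum_distrib_left algebra_simps)
  have sym: "?Q \<psi> v = ?Q v \<psi>" for \<psi> v
    unfolding unit_form_def by (intro sum.cong refl) (simp add: trace_mul_sym[of "conc_of \<psi> _"] inner_commute)
  have lin1: "linear (\<lambda>\<psi>. ?Q \<psi> v)" for v
    using lin2[of v] by (simp add: sym[of _ v])
  define J :: "real^('k \<times> ('p + 'p uprod))^('k \<times> ('p + 'p uprod))" where "J = (\<chi> a b. ?Q (axis b 1) (axis a 1))"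
  have J: "v \<bullet> (J *v \<psi>) = ?Q \<psi> v" for \<psi> v
  proof -
    have "(J *v \<psi>) $ a = ?Q \<psi> (axis a 1)" for a
      using linear_eq_inner_axis[OF lin1, of \<psi> "axis a 1"]
      by (simp add: J_def matrix_vector_mult_def inner_vec_def mult.commute)
    then have "J *v \<psi> = (\<chi> a. ?Q \<psi> (axis a 1))" by (simp add: vec_eq_iff)
    then show ?thesis using linear_eq_inner_axis[OF lin2] by simp
  qed
  have trsq: "trace (H ** H) = (\<Sum>a\<in>UNIV. \<Sum>b\<in>UNIV. (H $ a $ b)\<^sup>2)" if "transpose H = H" for H :: "real^'p^'p"
  proof -
    have "H $ b $ a = H $ a $ b" for a b using that by (metis transpose_def vec_lambda_beta)
    then show ?thesis by (simp add: trace_def matrix_matrix_mult_def power2_eq_square)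
  qed
  have tr0: "trace (conc_of \<psi> i ** conc_of \<psi> i) \<ge> 0" for \<psi> :: "real^('k \<times> ('p + 'p uprod))" and i
    by (simp add: trsq sum_nonneg)
  have "pos_def_matrix J"
    unfolding pos_def_matrix_def
  proof (intro conjI allI impI)
    show "transpose J = J" using sym by (simp add: J_def transpose_def vec_eq_iff)
    fix \<psi> :: "real^('k \<times> ('p + 'p uprod))" assume "\<psi> \<noteq> 0"
    have nn: "real (n i) / 2 * trace (conc_of \<psi> i ** conc_of \<psi> i) + real (n i) * (xi_of \<psi> i \<bullet> xi_of \<psi> i) \<ge> 0" for i
      using tr0 by (intro add_nonneg_nonneg mult_nonneg_nonneg) auto
    have "?Q \<psi> \<psi> \<noteq> 0"
    proof
      assume "?Q \<psi> \<psi> = 0"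
      then have z: "real (n i) / 2 * trace (conc_of \<psi> i ** conc_of \<psi> i) + real (n i) * (xi_of \<psi> i \<bullet> xi_of \<psi> i) = 0" for i
        using nn unfolding unit_form_def by (subst (asm) sum_nonneg_eq_0_iff) auto
      have "trace (conc_of \<psi> i ** conc_of \<psi> i) = 0 \<and> xi_of \<psi> i \<bullet> xi_of \<psi> i = 0" for i
        using z[of i] n[of i] tr0[of \<psi> i]
        by (smt (verit) divide_pos_pos inner_ge_zero mult_nonneg_nonneg mult_pos_pos of_nat_0_less_iff)
      then have "trace (conc_of \<psi> i ** conc_of \<psi> i) = 0" "xi_of \<psi> i = 0" for i by auto
      then have "conc_of \<psi> i = 0" "xi_of \<psi> i = 0" for i
        by (simp_all add: trsq sum_nonneg_eq_0_iff sum_nonneg vec_eq_iff)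
      then have "\<psi> = 0" by (intro param_eqI) (simp_all add: xi_of_def conc_of_def zero_vec_def)
      then show False using \<open>\<psi> \<noteq> 0\<close> by simp
    qed
    moreover have "?Q \<psi> \<psi> \<ge> 0" unfolding unit_form_def by (intro sum_nonneg nn)
    ultimately show "\<psi> \<bullet> (J *v \<psi>) > 0" by (simp add: J)
  qed
  then have "det J > 0" by (rule pos_def_det_pos)
  then show ?thesis using J by (rule that)
qed

text \<open>With \<open>B = S S\<^sup>T\<close>, the observed information at the estimate is the fixed form \<open>unit_form\<close> after
  the substitution \<open>(x, H) \<mapsto> (S\<^sup>T (x - H m), S\<^sup>T H S)\<close>.\<close>

lemma det_information:
  fixes n :: "'k::finite \<Rightarrow> nat" and m :: "'k \<Rightarrow> real^'p::finite"
  assumes n: "\<And>i. n i > 0"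
  shows "\<exists>\<kappa>>0. \<forall>A B. (\<forall>i. pos_def_matrix (B i)) \<longrightarrow>
    det (- hessian (loglik n m A) (estimate m B)) = \<kappa> * (\<Prod>i\<in>UNIV. det (B i) ^ (CARD('p) + 2))"
proof -
  obtain J :: "real^('k \<times> ('p + 'p uprod))^('k \<times> ('p + 'p uprod))"
    where J: "det J > 0" "\<And>\<psi> v. v \<bullet> (J *v \<psi>) = unit_form n \<psi> v"
    using unit_form_matrix[of n] n by blast
  let ?s = "det (matrix (shear m))"
  show ?thesis
  proof (intro exI[of _ "det J * ?s\<^sup>2"] conjI allI impI)
    show "det J * ?s\<^sup>2 > 0" using J(1) det_shear_nz[of m] by simp
    fix A B :: "'k \<Rightarrow> real^'p^'p" assume B: "\<forall>i. pos_def_matrix (B i)"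
    have "\<exists>S :: real^'p^'p. B i = S ** transpose S" for i
    proof -
      have "pos_def_matrix (B i)" using B by simp
      from pos_def_factorization[OF this] obtain S where "B i = S ** transpose S" "det S \<noteq> 0" .
      then show ?thesis by blast
    qed
    then have "\<forall>i. \<exists>S :: real^'p^'p. B i = S ** transpose S" ..
    from choice[OF this] obtain S :: "'k \<Rightarrow> real^'p^'p" where S: "\<And>i. B i = S i ** transpose (S i)" by blast
    let ?g = "\<lambda>i. transpose (S i)"
    let ?T = "\<lambda>\<psi>. block_act ?g (shear m \<psi>)"
    let ?h = "hessian (loglik n m A) (estimate m B)"
    have lT: "linear ?T" using linear_compose[OF linear_shear linear_block_act] by (simp add: comp_def)
    have inv: "matrix_inv (matrix_inv (B i)) = B i" for i by (rule matrix_inv_inv_pos_def) (use B in simp)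
    have mu: "B i *v (matrix_inv (B i) *v m i) = m i" for i
      using pos_def_det_pos[of "B i"] B by (simp add: matrix_vector_mul_assoc matrix_inv_mult)
    have form: "v \<bullet> ((- ?h) *v \<psi>) = unit_form n (?T \<psi>) (?T v)" for v \<psi>
    proof -
      have "v \<bullet> ((- ?h) *v \<psi>) = - d2loglik n (estimate m B) \<psi> v"
        using hessian_loglik[OF estimate_in_normal_params, of B v n m A m \<psi>] B
        by (simp add: matrix_vector_mult_minus_left)
      also have "\<dots> = (\<Sum>i\<in>UNIV. - d2group_loglik (real (n i)) (B i) (m i) (xi_of \<psi> i) (conc_of \<psi> i) (xi_of v i) (conc_of v i))"
        using B by (simp add: d2loglik_def conc_of_estimate inv mu sum_negf)
      also have "\<dots> = unit_form n (?T \<psi>) (?T v)"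
        unfolding unit_form_def
      proof (rule sum.cong[OF refl])
        fix i
        have c: "conc_of (?T \<psi>) i = transpose (S i) ** conc_of \<psi> i ** S i" for \<psi>
          by (simp add: block_act_def shear_def sym_of_sym_cong sym_of_conc_vec)
        have x: "xi_of (?T \<psi>) i = transpose (S i) *v (xi_of \<psi> i - conc_of \<psi> i *v m i)" for \<psi>
          by (simp add: block_act_def shear_def del: transpose_matrix_vector)
        have "trace (B i ** conc_of \<psi> i ** B i ** conc_of v i) =
          trace (S i ** (transpose (S i) ** conc_of \<psi> i ** S i ** transpose (S i) ** conc_of v i))"
          by (simp add: S matrix_mul_assoc)
        also have "\<dots> = trace ((transpose (S i) ** conc_of \<psi> i ** S i) ** (transpose (S i) ** conc_of v i ** S i))"
          by (subst trace_mul_sym) (simp add: matrix_mul_assoc)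
        finally have t: "trace (B i ** conc_of \<psi> i ** B i ** conc_of v i) = trace (conc_of (?T \<psi>) i ** conc_of (?T v) i)"
          by (simp only: c)
        have "y \<bullet> (B i *v z) = (transpose (S i) *v y) \<bullet> (transpose (S i) *v z)" for y z
          by (simp only: S matrix_vector_mul_assoc[symmetric]) (metis dot_lmul_matrix transpose_matrix_vector)
        then show "- d2group_loglik (real (n i)) (B i) (m i) (xi_of \<psi> i) (conc_of \<psi> i) (xi_of v i) (conc_of v i) =
          real (n i) / 2 * trace (conc_of (?T \<psi>) i ** conc_of (?T v) i) + real (n i) * (xi_of (?T v) i \<bullet> xi_of (?T \<psi>) i)"
          unfolding x t[symmetric] d2group_loglik_def by simp
      qed
      finally show ?thesis .
    qed
    have "(- ?h) *v \<psi> = (transpose (matrix ?T) ** J ** matrix ?T) *v \<psi>" for \<psi>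
    proof (rule vector_eq_ldot[THEN iffD1], rule allI)
      fix v
      have "v \<bullet> ((transpose (matrix ?T) ** J ** matrix ?T) *v \<psi>) = (matrix ?T *v v) \<bullet> (J *v (matrix ?T *v \<psi>))"
        by (simp only: matrix_vector_mul_assoc[symmetric] inner_transpose)
      also have "\<dots> = unit_form n (?T \<psi>) (?T v)"
        by (simp only: matrix_mult_vec_linear[OF lT] J(2))
      finally show "v \<bullet> ((- ?h) *v \<psi>) = v \<bullet> ((transpose (matrix ?T) ** J ** matrix ?T) *v \<psi>)"
        by (simp only: form)
    qed
    then have "- ?h = transpose (matrix ?T) ** J ** matrix ?T" by (intro matrix_eq[THEN iffD2] allI)
    \<comment> \<open>The square of \<open>det (S i)\<close> is \<open>det (B i)\<close>, so the
      squared determinant of the block action yields the powers p + 2.\<close>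
    then have "det (- ?h) = det J * (det (matrix ?T))\<^sup>2"
      by (simp only: det_mul det_transpose) (simp add: power2_eq_square)
    also have "det (matrix ?T) = det (matrix (block_act ?g)) * ?s"
      by (rule det_matrix_compose[OF linear_block_act linear_shear])
    also have "(det (matrix (block_act ?g)) * ?s)\<^sup>2 = ?s\<^sup>2 * \<bar>det (matrix (block_act ?g))\<bar>\<^sup>2"
      by (simp add: power_mult_distrib)
    also have "\<bar>det (matrix (block_act ?g))\<bar>\<^sup>2 = (\<Prod>i\<in>UNIV. det (B i) ^ (CARD('p) + 2))"
    proof -
      have e: "(\<bar>det (S i)\<bar> ^ (CARD('p) + 2))\<^sup>2 = det (B i) ^ (CARD('p) + 2)" for i
      proof -
        have "(\<bar>det (S i)\<bar> ^ (CARD('p) + 2))\<^sup>2 = (\<bar>det (S i)\<bar>\<^sup>2) ^ (CARD('p) + 2)"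
          by (simp only: power_mult[symmetric] mult.commute)
        then show ?thesis by (simp add: S det_mul power2_eq_square)
      qed
      then show ?thesis unfolding abs_det_block_act det_transpose
        by (subst prod_power_distrib) (intro prod.cong refl e)
    qed
    finally show "det (- ?h) = det J * ?s\<^sup>2 * (\<Prod>i\<in>UNIV. det (B i) ^ (CARD('p) + 2))"
      by (simp only: mult.assoc)
  qed
qed

section \<open>The directional p-value\<close>

lemma det_scaleR:
  fixes A :: "real^'p::finite^'p"
  shows "det (c *\<^sub>R A) = c ^ CARD('p) * det A"
proof -
  have "c *\<^sub>R A = diag_matrix (\<lambda>_. c) ** A"
    by (simp add: diag_matrix_const matrix_scaleR_left)
  then show ?thesis by (simp add: det_mul)
qed

context
  fixes n :: "'k::finite \<Rightarrow> nat" and y :: "'k \<Rightarrow> nat \<Rightarrow> real^'p::finite"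
begin

definition ntot :: real where "ntot = (\<Sum>i\<in>UNIV. real (n i))"

definition pooled :: "real^'p^'p" where "pooled = (\<Sum>i\<in>UNIV. scatter (n i) (y i)) /\<^sub>R ntot"

text \<open>n_i times the covariance estimate of group i at parameter t; t = 1 gives the observed
  scatter matrix, and t = 0 gives n_i times the pooled covariance matrix.\<close>

definition line_scatter :: "real \<Rightarrow> 'k \<Rightarrow> real^'p^'p" where
  "line_scatter t i = t *\<^sub>R scatter (n i) (y i) + ((1 - t) * real (n i)) *\<^sub>R pooled"

lemma ntot_pos:
  assumes "\<And>i. n i > 0"
  shows "ntot > 0"
  unfolding ntot_def using assms by (intro sum_pos) auto

context
  assumes n: "\<And>i. n i > 0" and pd: "\<And>i. pos_def_matrix (scatter (n i) (y i))"
begin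

abbreviation (input) "mean i \<equiv> sample_mean (n i) (y i)"

abbreviation (input) "l0 \<equiv> normal_loglik n y"

lemma pooled_pos_def: "pos_def_matrix pooled"
  unfolding pooled_def using ntot_pos[OF n] pd by (intro pos_def_scaleR pos_def_sum) auto

lemma sum_scatter: "(\<Sum>i\<in>UNIV. scatter (n i) (y i)) = ntot *\<^sub>R pooled"
  using ntot_pos[OF n] by (simp add: pooled_def)

lemma transpose_line_scatter: "transpose (line_scatter t i) = line_scatter t i"
proof -
  have "transpose (a *\<^sub>R A + b *\<^sub>R B) = a *\<^sub>R transpose A + b *\<^sub>R transpose B" for a b and A B :: "real^'p^'p"
    by (simp add: transpose_def vec_eq_iff)
  then show ?thesis by (simp add: line_scatter_def pos_def_transpose[OF pooled_pos_def])
qed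

lemma mle_null: "mle equal_conc_params l0 = estimate mean (\<lambda>_. pooled)"
  unfolding normal_loglik_eq[OF n]
  by (rule mle_equal_conc[OF n pooled_pos_def]) (simp add: sum_scatter ntot_def)

text \<open>At the constrained estimate the gradient has no \<xi> component, because the means
  already agree with the sample means. Its action on a direction H in the concentration matrix of
  group i is half of tr(H (n_i pooled - A_i)). Tilting by -(1 - t) times the gradient thus replaces
  A_i by t A_i + (1 - t) n_i pooled.\<close>

lemma tilted_loglik_eq:
  "tilted_loglik l0 (s_line equal_conc_params l0 t) = loglik n mean (line_scatter t)"
proof
  fix \<phi>
  let ?e = "estimate mean (\<lambda>_. pooled) :: real^('k \<times> ('p + 'p uprod))"
  let ?A = "\<lambda>i. scatter (n i) (y i)"
  have e: "?e \<in> normal_params" by (rule estimate_in_normal_params) (rule pooled_pos_def)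
  have inv: "matrix_inv (matrix_inv pooled) = pooled" by (rule matrix_inv_inv_pos_def[OF pooled_pos_def])
  have mu: "pooled *v (matrix_inv pooled *v v) = v" for v
    using pos_def_det_pos[OF pooled_pos_def] by (simp add: matrix_vector_mul_assoc matrix_inv_mult)
  have "\<phi> \<bullet> s_line equal_conc_params l0 t = - (1 - t) * dloglik n mean ?A ?e \<phi>"
    unfolding s_line_def mle_null unfolding normal_loglik_eq[OF n]
    using grad_loglik(2)[OF e, of \<phi> n mean ?A] by (simp add: algebra_simps)
  also have "dloglik n mean ?A ?e \<phi> = (\<Sum>i\<in>UNIV. (real (n i) * trace (conc_of \<phi> i ** pooled) - trace (conc_of \<phi> i ** ?A i)) / 2)"
    unfolding dloglik_def
  proof (rule sum.cong[OF refl])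
    fix i
    have "trace (pooled ** conc_of \<phi> i) = trace (conc_of \<phi> i ** pooled)" by (rule trace_mul_sym)
    then show "dgroup_loglik (real (n i)) (mean i) (?A i) (xi_of ?e i) (conc_of ?e i) (xi_of \<phi> i) (conc_of \<phi> i) =
      (real (n i) * trace (conc_of \<phi> i ** pooled) - trace (conc_of \<phi> i ** ?A i)) / 2"
      by (simp add: dgroup_loglik_def conc_of_estimate[OF pooled_pos_def] inv mu matrix_add_ldistrib trace_add
          matrix_scaleR_right trace_scaleR trace_mult_outer field_simps)
  qed
  finally have s: "\<phi> \<bullet> s_line equal_conc_params l0 t =
    (\<Sum>i\<in>UNIV. - (1 - t) * ((real (n i) * trace (conc_of \<phi> i ** pooled) - trace (conc_of \<phi> i ** ?A i)) / 2))"
    by (simp only: sum_distrib_left)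
  show "tilted_loglik l0 (s_line equal_conc_params l0 t) \<phi> = loglik n mean (line_scatter t) \<phi>"
    unfolding tilted_loglik_def s unfolding normal_loglik_eq[OF n] loglik_def sum.distrib[symmetric]
  proof (rule sum.cong[OF refl])
    fix i
    let ?tr = "\<lambda>X. trace (conc_of \<phi> i ** X)"
    have a: "?tr (?A i + real (n i) *\<^sub>R outer (mean i)) = ?tr (?A i) + real (n i) * ?tr (outer (mean i))"
      by (simp add: matrix_add_ldistrib trace_add matrix_scaleR_right trace_scaleR)
    have b: "?tr (line_scatter t i + real (n i) *\<^sub>R outer (mean i)) =
        t * ?tr (?A i) + (1 - t) * real (n i) * ?tr pooled + real (n i) * ?tr (outer (mean i))"
      by (simp add: line_scatter_def matrix_add_ldistrib trace_add matrix_scaleR_right trace_scaleR)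
    show "- (1 - t) * ((real (n i) * ?tr pooled - ?tr (?A i)) / 2) +
        group_loglik (real (n i)) (mean i) (?A i) (xi_of \<phi> i) (conc_of \<phi> i) =
      group_loglik (real (n i)) (mean i) (line_scatter t i) (xi_of \<phi> i) (conc_of \<phi> i)"
      unfolding group_loglik_def a b by (simp add: field_simps)
  qed
qed

lemma line_scatter_scaled: "line_scatter t = (\<lambda>i. real (n i) *\<^sub>R (line_scatter t i /\<^sub>R real (n i)))"
  using n by (simp add: fun_eq_iff)

lemma pos_def_scaled_iff: "pos_def_matrix (line_scatter t i /\<^sub>R real (n i)) \<longleftrightarrow> pos_def_matrix (line_scatter t i)"
proof
  have i: "inverse (real (n i)) > 0" using n[of i] by simp
  show "pos_def_matrix (line_scatter t i) \<Longrightarrow> pos_def_matrix (line_scatter t i /\<^sub>R real (n i))"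
    using i by (rule pos_def_scaleR[rotated])
  assume "pos_def_matrix (line_scatter t i /\<^sub>R real (n i))"
  then have "pos_def_matrix (real (n i) *\<^sub>R (line_scatter t i /\<^sub>R real (n i)))"
    by (rule pos_def_scaleR) (use n[of i] in simp)
  then show "pos_def_matrix (line_scatter t i)" using n[of i] by simp
qed

lemma mle_exists_iff:
  "mle_exists normal_params (tilted_loglik l0 (s_line equal_conc_params l0 t)) \<longleftrightarrow> (\<forall>i. pos_def_matrix (line_scatter t i))"
proof
  assume ex: "mle_exists normal_params (tilted_loglik l0 (s_line equal_conc_params l0 t))"
  show "\<forall>i. pos_def_matrix (line_scatter t i)"
  proof (rule ccontr)
    assume "\<not> ?thesis"
    then obtain i where i: "\<not> pos_def_matrix (line_scatter t i /\<^sub>R real (n i))" unfolding pos_def_scaled_iff by blast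
    have "transpose (line_scatter t i /\<^sub>R real (n i)) = line_scatter t i /\<^sub>R real (n i)" for i
      using transpose_line_scatter[of t i] by (simp add: transpose_def vec_eq_iff)
    from not_mle_exists[where n = n and B = "\<lambda>i. line_scatter t i /\<^sub>R real (n i)", OF n this i, where m = mean] show False
      using ex unfolding tilted_loglik_eq line_scatter_scaled[symmetric] by blast
  qed
next
  assume "\<forall>i. pos_def_matrix (line_scatter t i)"
  then have "\<And>i. pos_def_matrix (line_scatter t i /\<^sub>R real (n i))" unfolding pos_def_scaled_iff by blast
  from mle_loglik(1)[where n = n and B = "\<lambda>i. line_scatter t i /\<^sub>R real (n i)", OF n this, where m = mean]
  show "mle_exists normal_params (tilted_loglik l0 (s_line equal_conc_params l0 t))"
    unfolding tilted_loglik_eq line_scatter_scaled[symmetric] .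
qed

lemma sum_line_scatter: "(\<Sum>i\<in>UNIV. line_scatter t i) = ntot *\<^sub>R pooled"
proof -
  have "(\<Sum>i\<in>UNIV. line_scatter t i) = t *\<^sub>R (\<Sum>i\<in>UNIV. scatter (n i) (y i)) + ((1 - t) * ntot) *\<^sub>R pooled"
    by (simp add: line_scatter_def sum.distrib scaleR_sum_right scaleR_left.sum[symmetric] sum_distrib_left ntot_def)
  moreover have "t * ntot + (1 - t) * ntot = ntot" by (simp add: algebra_simps)
  ultimately show ?thesis by (simp only: sum_scatter scaleR_scaleR scaleR_left_distrib[symmetric])
qed

text \<open>The maximized log-likelihood contributes the power n_i/2 of each determinant and the
  information the power -(p + 2)/2. Everything that does not depend on t is collected in one
  positive constant.\<close>

lemma saddlepoint_line:
  assumes c: "c > 0"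
  shows "\<exists>C>0. \<forall>t. (\<forall>i. pos_def_matrix (line_scatter t i)) \<longrightarrow>
    saddlepoint c normal_params equal_conc_params l0 (s_line equal_conc_params l0 t) =
    C * (\<Prod>i\<in>UNIV. det (line_scatter t i) powr ((real (n i) - real CARD('p) - 2) / 2))"
proof -
  let ?p = "real CARD('p)"
  from det_information[OF n, where m = mean] obtain \<kappa> where \<kappa>': "\<kappa> > 0 \<and> (\<forall>A B. (\<forall>i. pos_def_matrix (B i)) \<longrightarrow>
    det (- hessian (loglik n mean A) (estimate mean B)) = \<kappa> * (\<Prod>i\<in>UNIV. det (B i) ^ (CARD('p) + 2)))" ..
  have \<kappa>: "\<kappa> > 0" using \<kappa>' by (rule conjunct1)
  have info: "det (- hessian (loglik n mean A) (estimate mean B)) = \<kappa> * (\<Prod>i\<in>UNIV. det (B i) ^ (CARD('p) + 2))"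
    if "\<forall>i. pos_def_matrix (B i)" for A B
    by (rule mp[OF spec[OF spec[OF conjunct2[OF \<kappa>'], of A], of B] that])
  define C0 where "C0 = (\<Sum>i\<in>UNIV. real (n i) / 2 * ln (det (matrix_inv pooled)))"
  \<comment> \<open>Arises from passing from the covariance estimate to n_i times it: scaling a
    matrix of size p scales its determinant by a p-th power.\<close>
  define D where "D = (\<Prod>i\<in>UNIV. (inverse (real (n i)) ^ CARD('p)) powr ((real (n i) - ?p - 2) / 2))"
  let ?C = "c * exp C0 * \<kappa> powr (- 1 / 2) * D"
  show ?thesis
  proof (intro exI[of _ ?C] conjI allI impI)
    show "?C > 0" unfolding D_def using c \<kappa> n by (intro mult_pos_pos prod_pos) auto
    fix t assume pdt: "\<forall>i. pos_def_matrix (line_scatter t i)"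
    define B where "B i = line_scatter t i /\<^sub>R real (n i)" for i
    have B: "pos_def_matrix (B i)" for i unfolding B_def pos_def_scaled_iff using pdt by blast
    have dB: "det (B i) > 0" for i by (rule pos_def_det_pos[OF B])
    let ?l = "loglik n mean (line_scatter t)"
    have LB: "line_scatter t = (\<lambda>i. real (n i) *\<^sub>R B i)" unfolding B_def by (rule line_scatter_scaled)
    have hat: "mle normal_params ?l = estimate mean B" unfolding LB by (rule mle_loglik(2)[OF n B])
    have lhat: "?l (estimate mean B) = (\<Sum>i\<in>UNIV. - real (n i) / 2 * (ln (det (B i)) + ?p))"
      unfolding LB by (rule loglik_estimate[OF n B])
    let ?e = "estimate mean (\<lambda>_. pooled) :: real^('k \<times> ('p + 'p uprod))"
    \<comment> \<open>The matrices on the line have a sum that does not depend on t, so neither does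
      the log-likelihood at the constrained estimate.\<close>
    have "?l ?e = loglik n mean (\<lambda>i. real (n i) *\<^sub>R pooled) ?e"
    proof (rule loglik_equal_conc[OF n])
      show "?e \<in> equal_conc_params"
        using estimate_in_normal_params[of "\<lambda>_. pooled" mean] pooled_pos_def
        by (simp add: equal_conc_params_def conc_of_estimate)
      show "(\<Sum>i\<in>UNIV. line_scatter t i) = (\<Sum>i\<in>UNIV. real (n i)) *\<^sub>R pooled"
        using sum_line_scatter unfolding ntot_def .
    qed
    also have "\<dots> = (\<Sum>i\<in>UNIV. - real (n i) / 2 * (ln (det pooled) + ?p))"
      by (rule loglik_estimate[OF n pooled_pos_def])
    also have "ln (det pooled) = - ln (det (matrix_inv pooled))"
      using pos_def_det_pos[OF pooled_pos_def] by (simp add: det_matrix_inv ln_inverse)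
    finally have le: "?l ?e = (\<Sum>i\<in>UNIV. - real (n i) / 2 * (- ln (det (matrix_inv pooled)) + ?p))" .
    have diff: "?l ?e - ?l (estimate mean B) = C0 + (\<Sum>i\<in>UNIV. real (n i) / 2 * ln (det (B i)))"
      unfolding le lhat C0_def sum_subtractf[symmetric] sum.distrib[symmetric]
      by (intro sum.cong refl) (simp add: field_simps)
    have E: "exp (?l ?e - ?l (estimate mean B)) = exp C0 * (\<Prod>i\<in>UNIV. det (B i) powr (real (n i) / 2))"
      unfolding diff exp_add using dB by (simp add: exp_sum powr_def) (rule prod.cong, auto simp: less_imp_neq[symmetric])
    have "det (- hessian ?l (estimate mean B)) = \<kappa> * (\<Prod>i\<in>UNIV. det (B i) powr (?p + 2))"
    proof -
      have "det (B i) ^ (CARD('p) + 2) = det (B i) powr (?p + 2)" for i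
        by (simp only: powr_realpow[OF dB, symmetric] of_nat_add of_nat_numeral)
      then show ?thesis using info[of B "line_scatter t"] B by simp
    qed
    then have I: "det (- hessian ?l (estimate mean B)) powr (- 1 / 2) = \<kappa> powr (- 1 / 2) * (\<Prod>i\<in>UNIV. det (B i) powr (- (?p + 2) / 2))"
    proof -
      have "(\<Prod>i\<in>UNIV. det (B i) powr (?p + 2)) powr (- 1 / 2) = (\<Prod>i\<in>UNIV. (det (B i) powr (?p + 2)) powr (- 1 / 2))"
        by (rule prod_powr_distrib)
      also have "\<dots> = (\<Prod>i\<in>UNIV. det (B i) powr (- (?p + 2) / 2))"
        by (intro prod.cong refl, simp only: powr_powr) (rule arg_cong[where f = "(powr) _"], simp add: field_simps)
      finally have "(\<Prod>i\<in>UNIV. det (B i) powr (?p + 2)) powr (- 1 / 2) = (\<Prod>i\<in>UNIV. det (B i) powr (- (?p + 2) / 2))" .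
      then show ?thesis
        unfolding \<open>det (- hessian ?l (estimate mean B)) = _\<close> using \<kappa> by (subst powr_mult) (auto simp: prod_nonneg)
    qed
    have "saddlepoint c normal_params equal_conc_params l0 (s_line equal_conc_params l0 t) =
      c * exp (?l ?e - ?l (estimate mean B)) * det (- hessian ?l (estimate mean B)) powr (- 1 / 2)"
      unfolding saddlepoint_def Let_def tilted_loglik_eq mle_null hat by simp
    also have "\<dots> = c * exp C0 * \<kappa> powr (- 1 / 2) * (\<Prod>i\<in>UNIV. det (B i) powr (real (n i) / 2) * det (B i) powr (- (?p + 2) / 2))"
      unfolding E I by (simp add: prod.distrib)
    also have "(\<Prod>i\<in>UNIV. det (B i) powr (real (n i) / 2) * det (B i) powr (- (?p + 2) / 2)) =
      (\<Prod>i\<in>UNIV. (inverse (real (n i)) ^ CARD('p)) powr ((real (n i) - ?p - 2) / 2) * det (line_scatter t i) powr ((real (n i) - ?p - 2) / 2))"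
    proof (rule prod.cong[OF refl])
      fix i
      have "real (n i) / 2 + - (?p + 2) / 2 = (real (n i) - ?p - 2) / 2" by (simp add: field_simps)
      then have "det (B i) powr (real (n i) / 2) * det (B i) powr (- (?p + 2) / 2) = det (B i) powr ((real (n i) - ?p - 2) / 2)"
        by (simp only: powr_add[symmetric])
      also have "\<dots> = (inverse (real (n i)) ^ CARD('p) * det (line_scatter t i)) powr ((real (n i) - ?p - 2) / 2)"
        unfolding B_def by (simp only: det_scaleR)
      also have "\<dots> =
        (inverse (real (n i)) ^ CARD('p)) powr ((real (n i) - ?p - 2) / 2) * det (line_scatter t i) powr ((real (n i) - ?p - 2) / 2)"
        by (rule powr_mult)
      finally show "det (B i) powr (real (n i) / 2) * det (B i) powr (- (?p + 2) / 2) =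
        (inverse (real (n i)) ^ CARD('p)) powr ((real (n i) - ?p - 2) / 2) * det (line_scatter t i) powr ((real (n i) - ?p - 2) / 2)" .
    qed
    also have "\<dots> = D * (\<Prod>i\<in>UNIV. det (line_scatter t i) powr ((real (n i) - ?p - 2) / 2))"
      unfolding D_def by (rule prod.distrib)
    finally show "saddlepoint c normal_params equal_conc_params l0 (s_line equal_conc_params l0 t) =
      ?C * (\<Prod>i\<in>UNIV. det (line_scatter t i) powr ((real (n i) - ?p - 2) / 2))"
      by (simp only: mult.assoc)
  qed
qed

end

end

section \<open>Distribution of the p-value\<close>

definition scatter_vec :: "('k \<Rightarrow> nat) \<Rightarrow> ('k \<Rightarrow> nat \<Rightarrow> real^'p) \<Rightarrow> real^('k::finite \<times> 'p::finite uprod)" where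
  "scatter_vec n y = (\<chi> j. vec_of_sym (scatter (n (fst j)) (y (fst j))) $ snd j)"

lemma block_scatter_vec: "block (scatter_vec n y) i = vec_of_sym (scatter (n i) (y i))"
  by (simp add: vec_eq_iff scatter_vec_def)

lemma sym_of_block_scatter_vec: "sym_of (block (scatter_vec n y) i) = scatter (n i) (y i)"
  by (simp add: block_scatter_vec sym_of_vec_of_sym)

lemma sym_of_block_dilate_scatter_vec:
  fixes y :: "'k::finite \<Rightarrow> nat \<Rightarrow> real^'p::finite"
  assumes n: "\<And>i. n i > 0"
  shows "sym_of (block (dilate (\<lambda>i. real (n i) / ntot n) t (scatter_vec n y)) i) = line_scatter n y t i"
proof -
  have nt: "ntot n > 0" by (rule ntot_pos[OF n])
  have "sym_of (block_sum (scatter_vec n y)) = (\<Sum>i\<in>UNIV. scatter (n i) (y i))"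
    by (simp add: block_sum_def sym_of_sum sym_of_block_scatter_vec)
  also have "\<dots> = ntot n *\<^sub>R pooled n y" using nt by (simp add: pooled_def)
  finally have "sym_of (block_sum (scatter_vec n y)) = ntot n *\<^sub>R pooled n y" .
  then show ?thesis
    using nt by (simp add: block_dilate sym_of_add sym_of_scaleR sym_of_block_scatter_vec line_scatter_def)
qed

text \<open>The line is affine in t and the cone is convex, so the admissible t form an
  interval.\<close>

lemma line_scatter_convex:
  fixes y :: "'k::finite \<Rightarrow> nat \<Rightarrow> real^'p::finite"
  assumes "pos_def_matrix (line_scatter n y r i)" "pos_def_matrix (line_scatter n y t i)" "r < s" "s < t"
  shows "pos_def_matrix (line_scatter n y s i)"
proof -
  let ?a = "(t - s) / (t - r)" and ?b = "(s - r) / (t - r)"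
  have "?a * r + ?b * t = (s * (t - r)) / (t - r)"
    unfolding times_divide_eq_left add_divide_distrib[symmetric] by (rule arg_cong[where f = "\<lambda>x. x / (t - r)"]) (simp add: algebra_simps)
  moreover have "?a + ?b = (t - r) / (t - r)" unfolding add_divide_distrib[symmetric] by simp
  ultimately have ab: "?a > 0" "?b > 0" "?a + ?b = 1" "?a * r + ?b * t = s"
    using assms(3,4) by simp_all
  have "?a *\<^sub>R line_scatter n y r i + ?b *\<^sub>R line_scatter n y t i =
      (?a * r + ?b * t) *\<^sub>R scatter (n i) (y i) + (((?a + ?b) - (?a * r + ?b * t)) * real (n i)) *\<^sub>R pooled n y"
    by (simp add: line_scatter_def scaleR_add_right scaleR_left_distrib[symmetric] algebra_simps del: scaleR_left_distrib)
  also have "\<dots> = line_scatter n y s i" unfolding ab by (simp add: line_scatter_def)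
  finally show ?thesis using pos_def_add[OF pos_def_scaleR[OF assms(1) ab(1)] pos_def_scaleR[OF assms(2) ab(2)]] by simp
qed

text \<open>Below \<open>t_sup\<close> the integrand is a constant times the ray density, and above
  it the ray density is zero. So the integrals up to \<open>t_sup\<close>, finite or not, are the
  tails of the ray at 1 and 0, and the constant cancels in the quotient.\<close>

lemma p_value_eq_ray_p_value:
  fixes y :: "'k::finite \<Rightarrow> nat \<Rightarrow> real^'p::finite"
  assumes k: "CARD('k) \<ge> 2" and n: "\<And>i. n i > 0" and pd: "\<And>i. pos_def_matrix (scatter (n i) (y i))"
    and c: "c > 0"
  shows "equal_conc_p_value c n y = dilation_group.ray_p_value (dilate (\<lambda>i. real (n i) / ntot n))
    ((CARD('k) - 1) * CARD('p uprod)) (block_density n) (scatter_vec n y)"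
proof -
  let ?w = "\<lambda>i. real (n i) / ntot n" and ?d = "(CARD('k) - 1) * CARD('p uprod)"
  let ?a = "scatter_vec n y :: real^('k \<times> 'p uprod)"
  have nt: "ntot n > 0" by (rule ntot_pos[OF n])
  have w: "sum ?w UNIV = 1" "\<And>i. ?w i > 0"
    using nt n by (auto simp: sum_divide_distrib[symmetric] ntot_def)
  \<comment> \<open>\<open>ray_p_value\<close> is the same function for every exponential factor, so
    the identity can stand for the unknown concentration matrix.\<close>
  interpret dg: dilation_group "dilate ?w :: real \<Rightarrow> real^('k \<times> 'p uprod) \<Rightarrow> _" ?d "\<lambda>a. norm (a - dilate ?w 0 a)" "block_density n"
    "\<lambda>a. exp (- trace (mat 1 ** sym_of (block_sum a)) / 2)"
    by (rule dilation_group_dilate[OF w k])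
  let ?T = "{t. \<forall>i. pos_def_matrix (line_scatter n y t i)}"
  let ?l0 = "normal_loglik n y"
  define ts where "ts = t_sup normal_params equal_conc_params ?l0"
  have ts: "ts = (SUP t\<in>?T. ereal t)"
    unfolding ts_def t_sup_def by (simp only: mle_exists_iff[where n = n and y = y, OF n pd])
  have d: "CARD('p) * (CARD('p) + 1) * (CARD('k) - 1) div 2 = ?d"
  proof -
    have "CARD('p) * (CARD('p) + 1) * (CARD('k) - 1) = 2 * ?d"
      using card_uprod[where 'n='p] by (metis mult.assoc mult.commute)
    then show ?thesis by (metis nonzero_mult_div_cancel_left zero_neq_numeral)
  qed
  obtain C where C: "C > 0" "\<And>t. t \<in> ?T \<Longrightarrow>
    saddlepoint c normal_params equal_conc_params ?l0 (s_line equal_conc_params ?l0 t) =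
    C * (\<Prod>i\<in>UNIV. det (line_scatter n y t i) powr ((real (n i) - real CARD('p) - 2) / 2))"
    using saddlepoint_line[where n = n and y = y, OF n pd c] by auto
  let ?sp = "\<lambda>t. saddlepoint c normal_params equal_conc_params ?l0 (s_line equal_conc_params ?l0 t)"
  let ?bd = "\<lambda>t. block_density n (dilate ?w t ?a)"
  have bd: "?bd t = (if t \<in> ?T then \<Prod>i\<in>UNIV. det (line_scatter n y t i) powr ((real (n i) - real CARD('p) - 2) / 2) else 0)" for t
  proof (cases "t \<in> ?T")
    case True
    then show ?thesis by (simp add: block_density_def sym_of_block_dilate_scatter_vec[where n = n, OF n])
  next
    case False
    then obtain i where "\<not> pos_def_matrix (line_scatter n y t i)" by auto
    then show ?thesis using False
      unfolding block_density_def sym_of_block_dilate_scatter_vec[where n = n, OF n] by (auto intro!: prod_zero bexI[of _ i])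
  qed
  have sp: "?sp t = C * ?bd t" if "t \<in> ?T" for t using C(2)[OF that] that by (simp add: bd)
  have bdm [measurable]: "?bd \<in> borel_measurable borel"
    by measurable
  have int: "(LBINT t=ereal r..ts. t ^ (?d - 1) * ?sp t) = C * enn2real (dg.ray_tail ?a r)" if r: "r \<in> ?T" "r \<ge> 0" for r
  proof -
    have le: "ereal r \<le> ts" unfolding ts using r by (intro SUP_upper) auto
    \<comment> \<open>A point below the supremum lies below some admissible t, and convexity of the
      cone makes it admissible.\<close>
    have inT: "x \<in> ?T" if x: "x \<in> einterval (ereal r) ts" for x
    proof -
      have "ereal r < ereal x" "ereal x < ts" using x by (auto simp: einterval_def)
      then obtain t where t: "t \<in> ?T" "x < t" unfolding ts by (auto simp: less_SUP_iff)
      then show ?thesis using r(1) \<open>ereal r < ereal x\<close> line_scatter_convex[of n y r _ t x] by auto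
    qed
    let ?g = "\<lambda>x. indicator (einterval (ereal r) ts) x * (C * (x ^ (?d - 1) * ?bd x))"
    have gnn: "?g x \<ge> 0" for x
      using C(1) r(2) block_density_nonneg[of n "dilate ?w x ?a"]
      by (auto simp: indicator_def einterval_def intro!: mult_nonneg_nonneg)
    have "(LBINT t=ereal r..ts. t ^ (?d - 1) * ?sp t) = (LINT x|lborel. ?g x)"
      unfolding interval_lebesgue_integral_def set_lebesgue_integral_def using le
      by (auto intro!: Bochner_Integration.integral_cong simp: indicator_def sp[OF inT])
    also have "\<dots> = enn2real (\<integral>\<^sup>+x. ennreal (?g x) \<partial>lborel)"
      using gnn by (intro integral_eq_nn_integral) auto
    also have "(\<integral>\<^sup>+x. ennreal (?g x) \<partial>lborel) = (\<integral>\<^sup>+x. ennreal C * (ennreal (x ^ (?d - 1) * ?bd x) * indicator {r<..} x) \<partial>lborel)"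
    proof (rule nn_integral_cong_AE)
      \<comment> \<open>Only at the end point \<open>ts\<close> can the two integrands differ. For
        infinite \<open>ts\<close> the excluded point is a harmless default.\<close>
      show "AE x in lborel. ennreal (?g x) = ennreal C * (ennreal (x ^ (?d - 1) * ?bd x) * indicator {r<..} x)"
        using AE_lborel_singleton[of "real_of_ereal ts"]
      proof eventually_elim
        case (elim x)
        show ?case
        proof (cases "x \<in> einterval (ereal r) ts")
          case True
          then show ?thesis using C(1) by (auto simp: einterval_def ennreal_mult')
        next
          case False
          have "?bd x = 0" if xr: "x > r"
          proof -
            have "x \<notin> ?T"
            proof
              assume "x \<in> ?T"
              then have "ereal x \<le> ts" unfolding ts by (intro SUP_upper) auto
              moreover have "ereal x \<noteq> ts" using elim by auto
              ultimately show False using False xr by (auto simp: einterval_def)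
            qed
            then show ?thesis by (auto simp: bd)
          qed
          then show ?thesis using False by (auto simp: indicator_def)
        qed
      qed
    qed
    also have "\<dots> = ennreal C * dg.ray_tail ?a r"
      unfolding dg.ray_tail_def by (rule nn_integral_cmult) measurable
    finally show ?thesis using C(1) by (simp add: enn2real_mult)
  qed
  \<comment> \<open>Both lower limits are admissible: the observed matrices at 1 and multiples of
    the pooled matrix at 0 are positive definite.\<close>
  have "1 \<in> ?T" using pd by (simp add: line_scatter_def)
  have "line_scatter n y 0 i = real (n i) *\<^sub>R pooled n y" for i by (simp add: line_scatter_def)
  then have "0 \<in> ?T" using pooled_pos_def[where n = n and y = y, OF n pd] n by (auto intro: pos_def_scaleR)
  have "equal_conc_p_value c n y = (C * enn2real (dg.ray_tail ?a 1)) / (C * enn2real (dg.ray_tail ?a 0))"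
    unfolding equal_conc_p_value_def directional_p_value_def ts_def[symmetric] d
    using int[OF \<open>1 \<in> ?T\<close>] int[OF \<open>0 \<in> ?T\<close>] by (simp add: one_ereal_def zero_ereal_def)
  also have "\<dots> = dg.ray_p_value ?a" unfolding dg.ray_p_value_def using C(1) by simp
  finally show ?thesis .
qed

section \<open>Transfer along null sets, uniform laws and the joint law of the scatter
  matrices\<close>

lemma borel_measurable_vec_of_sym [measurable (raw)]:
  fixes f :: "'a \<Rightarrow> real^'p::finite^'p"
  assumes [measurable]: "f \<in> borel_measurable M"
  shows "(\<lambda>x. vec_of_sym (f x)) \<in> borel_measurable M"
  unfolding vec_of_sym_def by measurable

text \<open>On the exceptional null set f is arbitrary, so its preimages are sets of M modified by
  subsets of null sets; these are measurable in the completion.\<close>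

lemma borel_measurable_completion_AE_eq:
  fixes f g :: "'a \<Rightarrow> 'b::topological_space"
  assumes g: "g \<in> borel_measurable M" and eq: "AE x in M. f x = g x"
  shows "f \<in> borel_measurable (completion M)" "distr (completion M) borel f = distr M borel g"
proof -
  show f: "f \<in> borel_measurable (completion M)"
  proof (rule measurableI)
    fix A :: "'b set" assume A: "A \<in> sets borel"
    have 1: "Measurable.pred (completion M) (\<lambda>x. g x \<in> A)"
      using measurable_sets[OF measurable_completion[OF g] A] by (simp add: pred_def vimage_def Int_def conj_commute)
    have 2: "Measurable.pred (completion M) (\<lambda>x. f x \<noteq> g x)"
      by (rule sets_completion_AE) (use eq in auto)
    have 3: "Measurable.pred (completion M) (\<lambda>x. f x \<in> A \<and> f x \<noteq> g x)"
      by (rule sets_completion_AE) (use eq in \<open>auto elim: eventually_mono\<close>)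
    have "Measurable.pred (completion M) (\<lambda>x. (g x \<in> A \<and> \<not> f x \<noteq> g x) \<or> (f x \<in> A \<and> f x \<noteq> g x))"
      using 1 2 3 by measurable
    moreover have "f -` A \<inter> space (completion M) =
      {x \<in> space (completion M). (g x \<in> A \<and> \<not> f x \<noteq> g x) \<or> (f x \<in> A \<and> f x \<noteq> g x)}" by auto
    ultimately show "f -` A \<inter> space (completion M) \<in> sets (completion M)" by (simp add: pred_def)
  qed simp
  show "distr (completion M) borel f = distr M borel g"
  proof (rule measure_eqI)
    fix A assume "A \<in> sets (distr (completion M) borel f)"
    then have A: "A \<in> sets borel" by simp
    have "emeasure (distr (completion M) borel f) A = emeasure (completion M) (f -` A \<inter> space M)"
      using f A by (simp add: emeasure_distr)
    also have "\<dots> = emeasure (completion M) (g -` A \<inter> space M)"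
    proof (rule emeasure_eq_AE)
      show "AE x in completion M. x \<in> f -` A \<inter> space M \<longleftrightarrow> x \<in> g -` A \<inter> space M"
        using AE_completion[OF eq] by eventually_elim auto
      show "f -` A \<inter> space M \<in> sets (completion M)" using measurable_sets[OF f A] by simp
      show "g -` A \<inter> space M \<in> sets (completion M)" using measurable_sets[OF g A] by simp
    qed
    also have "\<dots> = emeasure M (g -` A \<inter> space M)"
      using measurable_sets[OF g A] by simp
    also have "\<dots> = emeasure (distr M borel g) A" using g A by (simp add: emeasure_distr)
    finally show "emeasure (distr (completion M) borel f) A = emeasure (distr M borel g) A" .
  qed simp
qed

text \<open>The distribution function is prescribed on the open interval only; monotonicity and the
  bounds 0 and 1 force its values outside.\<close>

lemma distr_eq_uniform:
  fixes X :: "'a \<Rightarrow> real"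
  assumes M: "prob_space M" and X [measurable]: "X \<in> borel_measurable M"
    and cdf: "\<And>x. 0 < x \<Longrightarrow> x < 1 \<Longrightarrow> emeasure M {\<omega> \<in> space M. X \<omega> \<le> x} = ennreal x"
  shows "distr M borel X = uniform_measure lborel {0<..<1}"
proof -
  interpret prob_space M by fact
  interpret D: real_distribution "distr M borel X" by (rule real_distribution_distr) simp
  have pu: "prob_space (uniform_measure lborel {0<..<1::real})"
    by (rule prob_space_uniform_measure) auto
  interpret U: real_distribution "uniform_measure lborel {0<..<1::real}"
    by (intro real_distribution.intro pu real_distribution_axioms.intro) auto
  have c: "cdf (distr M borel X) x = x" if "0 < x" "x < 1" for x
  proof -
    have "emeasure (distr M borel X) {..x} = emeasure M {\<omega> \<in> space M. X \<omega> \<le> x}"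
      by (simp add: emeasure_distr) (rule arg_cong[where f = "emeasure M"], auto)
    then show ?thesis using cdf[OF that] that by (simp add: cdf_def measure_def)
  qed
  have "cdf (distr M borel X) x = cdf (uniform_measure lborel {0<..<1}) x" for x
  proof -
    have u: "cdf (uniform_measure lborel {0<..<1}) x = measure lborel ({0<..<1} \<inter> {..x})"
      by (simp add: cdf_def measure_uniform_measure)
    consider "x \<le> 0" | "0 < x" "x < 1" | "x \<ge> 1" by linarith
    then show ?thesis
    proof cases
      case 1
      have "cdf (distr M borel X) x \<le> e" if "e > 0" for e
      proof -
        have "cdf (distr M borel X) x \<le> cdf (distr M borel X) (min e (1/2))"
          using 1 that by (intro D.cdf_nondecreasing) auto
        also have "\<dots> = min e (1/2)" using that by (intro c) auto
        finally show ?thesis by simp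
      qed
      then have "cdf (distr M borel X) x \<le> 0" by (meson field_le_epsilon add_0 dense_ge)
      moreover have "{0<..<1} \<inter> {..x} = {}" using 1 by auto
      ultimately show ?thesis unfolding u using D.cdf_nonneg[of x] by simp
    next
      case 2
      have "{0<..<1} \<inter> {..x} = {0<..x}" using 2 by auto
      then show ?thesis unfolding u using 2 c[of x] by simp
    next
      case 3
      have "1 - e \<le> cdf (distr M borel X) x" if "e > 0" for e
      proof -
        have "1 - e \<le> max (1 - e) (1/2)" by simp
        also have "\<dots> = cdf (distr M borel X) (max (1 - e) (1/2))" using that by (intro c[symmetric]) auto
        also have "\<dots> \<le> cdf (distr M borel X) x" using 3 that by (intro D.cdf_nondecreasing) auto
        finally show ?thesis .
      qed
      then have "1 \<le> cdf (distr M borel X) x" by (metis add.commute diff_le_eq field_le_epsilon)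
      moreover have "{0<..<1} \<inter> {..x} = {0<..<1}" using 3 by auto
      ultimately show ?thesis unfolding u using D.cdf_bounded_prob[of x] by simp
    qed
  qed
  then show ?thesis
    by (intro cdf_unique D.real_distribution_axioms U.real_distribution_axioms ext)
qed

text \<open>The scatter matrices are functions of disjoint groups of independent observations, so
  they are independent and their Wishart densities multiply. All constants are gathered in the
  product of the \<open>K i\<close>.\<close>

lemma scatter_vec_law:
  fixes M :: "'a measure" and n :: "'k::finite \<Rightarrow> nat" and Y :: "'k \<Rightarrow> nat \<Rightarrow> 'a \<Rightarrow> real^'p::finite"
    and \<mu> :: "'k \<Rightarrow> real^'p" and L :: "real^'p^'p"
  assumes M: "prob_space M" and L: "pos_def_matrix L" and n: "\<And>i. n i \<ge> CARD('p) + 2"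
    and indep: "prob_space.indep_vars M (\<lambda>_. borel) (\<lambda>p. Y (fst p) (snd p)) (SIGMA i:UNIV. {..<n i})"
    and Y: "\<And>i j. j < n i \<Longrightarrow> distributed M lborel (Y i j) (\<lambda>x. ennreal (mvnormal_density (\<mu> i) (matrix_inv L) x))"
  shows "(\<lambda>\<omega>. scatter_vec n (\<lambda>i j. Y i j \<omega>)) \<in> borel_measurable M"
    and "AE \<omega> in M. \<forall>i. pos_def_matrix (scatter (n i) (\<lambda>j. Y i j \<omega>))"
    and "\<exists>K. \<forall>G\<in>borel_measurable borel. (\<integral>\<^sup>+\<omega>. G (scatter_vec n (\<lambda>i j. Y i j \<omega>)) \<partial>M) =
      K * (\<integral>\<^sup>+a. ennreal (block_density n a * exp (- trace (L ** sym_of (block_sum a)) / 2)) * G a \<partial>lborel)"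
proof -
  interpret prob_space M by fact
  define I where "I = (SIGMA i:(UNIV::'k set). {..<n i})"
  have X: "indep_vars (\<lambda>_. borel) (\<lambda>p. Y (fst p) (snd p)) I" using indep by (simp add: I_def)
  have n0: "n i > 0" for i using n[of i] by simp
  have rv: "Y i j \<in> borel_measurable M" if "j < n i" for i j
    using distributed_measurable[OF Y[OF that]] by simp
  let ?f = "\<lambda>i. density lborel (\<lambda>x. ennreal (mvnormal_density (\<mu> i) (matrix_inv L) x))"
  have dY: "distr M borel (Y i j) = ?f i" if "j < n i" for i j
  proof -
    have "distr M lborel (Y i j) = ?f i" by (rule distributed_distr_eq_density[OF Y[OF that]])
    moreover have "distr M lborel (Y i j) = distr M borel (Y i j)" by (rule distr_cong) auto
    ultimately show ?thesis by simp
  qed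
  \<comment> \<open>That the normal density has total mass one is read off from its being the law of
    an observation, which exists since \<open>n i > 0\<close>; no Gaussian integral is
    computed.\<close>
  have pf: "prob_space (?f i)" for i
    using prob_space_distr[OF rv[OF n0[of i]]] dY[OF n0[of i]] by simp
  let ?F = "\<lambda>\<omega>. \<lambda>p\<in>I. Y (fst p) (snd p) \<omega>"
  have In: "I \<noteq> {}" using n0 by (auto simp: I_def)
  have rvI: "Y (fst p) (snd p) \<in> borel_measurable M" if "p \<in> I" for p
    using that rv by (auto simp: I_def)
  have full: "distr M (PiM I (\<lambda>_. borel)) ?F = PiM I (\<lambda>p. distr M borel (Y (fst p) (snd p)))"
    using indep_vars_iff_distr_eq_PiM'[OF In, of "\<lambda>p. Y (fst p) (snd p)" "\<lambda>_. borel"] rvI X by auto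
  have grp: "distr M (PiM {..<n i} (\<lambda>_. borel)) (\<lambda>\<omega>. \<lambda>j\<in>{..<n i}. Y i j \<omega>) = PiM {..<n i} (\<lambda>_. ?f i)" for i
  proof -
    let ?R = "\<lambda>z. \<lambda>j\<in>{..<n i}. z (i, j)"
    have iI: "(i, j) \<in> I" if "j < n i" for j using that by (simp add: I_def)
    have mR: "?R \<in> measurable (PiM I (\<lambda>_. borel :: (real^'p) measure)) (PiM {..<n i} (\<lambda>_. borel))"
      by (intro measurable_restrict measurable_component_singleton iI) simp
    have mF: "?F \<in> measurable M (PiM I (\<lambda>_. borel))" by (intro measurable_restrict rvI)
    have "distr M (PiM {..<n i} (\<lambda>_. borel)) (\<lambda>\<omega>. \<lambda>j\<in>{..<n i}. Y i j \<omega>) =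
      distr M (PiM {..<n i} (\<lambda>_. borel)) (?R \<circ> ?F)"
      by (intro distr_cong refl) (auto simp: fun_eq_iff restrict_def iI)
    also have "\<dots> = distr (distr M (PiM I (\<lambda>_. borel)) ?F) (PiM {..<n i} (\<lambda>_. borel)) ?R"
      by (rule distr_distr[OF mR mF, symmetric])
    also have "\<dots> = distr (PiM I (\<lambda>p. distr M borel (Y (fst p) (snd p)))) (PiM {..<n i} (\<lambda>j. distr M borel (Y (fst (i, j)) (snd (i, j))))) ?R"
      unfolding full by (intro distr_cong refl sets_PiM_cong) simp_all
    also have "\<dots> = PiM {..<n i} (\<lambda>j. distr M borel (Y (fst (i, j)) (snd (i, j))))"
      by (rule distr_PiM_reindex) (auto simp: inj_on_def iI intro: prob_space_distr rvI)
    also have "\<dots> = PiM {..<n i} (\<lambda>_. ?f i)" by (intro PiM_cong refl) (simp add: dY)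
    finally show ?thesis .
  qed
  have "\<exists>K. \<forall>F\<in>borel_measurable borel. (\<integral>\<^sup>+\<omega>. F (scatter (n i) (\<lambda>j. Y i j \<omega>)) \<partial>M) =
    K * (\<integral>\<^sup>+v. ennreal (wishart_weight (n i) L v) * F (sym_of v) \<partial>lborel)" for i
    using n[of i] by (intro scatter_law[OF L _ rv pf grp]) auto
  then have "\<exists>K. \<forall>i. \<forall>F\<in>borel_measurable borel. (\<integral>\<^sup>+\<omega>. F (scatter (n i) (\<lambda>j. Y i j \<omega>)) \<partial>M) =
    K i * (\<integral>\<^sup>+v. ennreal (wishart_weight (n i) L v) * F (sym_of v) \<partial>lborel)"
    by (intro choice allI)
  then obtain K where K: "\<And>i F. F \<in> borel_measurable borel \<Longrightarrow> (\<integral>\<^sup>+\<omega>. F (scatter (n i) (\<lambda>j. Y i j \<omega>)) \<partial>M) =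
    K i * (\<integral>\<^sup>+v. ennreal (wishart_weight (n i) L v) * F (sym_of v) \<partial>lborel)" by blast
  have ms [measurable]: "(\<lambda>\<omega>. scatter (n i) (\<lambda>j. Y i j \<omega>)) \<in> borel_measurable M" for i
    by (intro borel_measurable_scatter rv)
  show mV [measurable]: "(\<lambda>\<omega>. scatter_vec n (\<lambda>i j. Y i j \<omega>)) \<in> borel_measurable M"
    unfolding scatter_vec_def by measurable
  have "AE \<omega> in M. pos_def_matrix (scatter (n i) (\<lambda>j. Y i j \<omega>))" for i
  proof -
    \<comment> \<open>The density lives on the cone, so the law gives mass zero to the complement;
      in \<open>ennreal\<close> this holds even before \<open>K i\<close> is known to be
      finite.\<close>
    let ?F = "\<lambda>A::real^'p^'p. if pos_def_matrix A then 0 else 1 :: ennreal"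
    have "(\<integral>\<^sup>+\<omega>. ?F (scatter (n i) (\<lambda>j. Y i j \<omega>)) \<partial>M) =
      K i * (\<integral>\<^sup>+v. ennreal (wishart_weight (n i) L v) * ?F (sym_of v) \<partial>lborel)"
      by (rule K) measurable
    also have "(\<lambda>v. ennreal (wishart_weight (n i) L v) * ?F (sym_of v)) = (\<lambda>v. 0)"
      by (auto simp: wishart_weight_def fun_eq_iff)
    finally have "(\<integral>\<^sup>+\<omega>. ?F (scatter (n i) (\<lambda>j. Y i j \<omega>)) \<partial>M) = 0" by simp
    moreover have "(\<lambda>\<omega>. ?F (scatter (n i) (\<lambda>j. Y i j \<omega>))) \<in> borel_measurable M" by measurable
    ultimately have "AE \<omega> in M. ?F (scatter (n i) (\<lambda>j. Y i j \<omega>)) = 0" using nn_integral_0_iff_AE by blast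
    then show ?thesis by eventually_elim (auto split: if_splits)
  qed
  then show "AE \<omega> in M. \<forall>i. pos_def_matrix (scatter (n i) (\<lambda>j. Y i j \<omega>))" by (simp add: AE_all_countable)
  define V where "V i \<omega> = vec_of_sym (scatter (n i) (\<lambda>j. Y i j \<omega>))" for i \<omega>
  have mVi [measurable]: "V i \<in> borel_measurable M" for i unfolding V_def by measurable
  \<comment> \<open>The index set splits into the disjoint groups {i} x {..<n i}; restrictions of an
    independent family to disjoint index sets are independent.\<close>
  have R: "indep_vars (\<lambda>i. PiM ({i} \<times> {..<n i}) (\<lambda>_. borel)) (\<lambda>i \<omega>. restrict (\<lambda>p. Y (fst p) (snd p) \<omega>) ({i} \<times> {..<n i})) UNIV"
    by (rule indep_vars_restrict[OF X]) (auto simp: disjoint_family_on_def I_def)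
  have "indep_vars (\<lambda>_. borel) (\<lambda>i \<omega>. vec_of_sym (scatter (n i) (\<lambda>j. restrict (\<lambda>p. Y (fst p) (snd p) \<omega>) ({i} \<times> {..<n i}) (i, j)))) UNIV"
  proof (rule indep_vars_compose2[OF R, where Y = "\<lambda>i z. vec_of_sym (scatter (n i) (\<lambda>j. z (i, j)))"])
    fix i
    show "(\<lambda>z. vec_of_sym (scatter (n i) (\<lambda>j. z (i, j)))) \<in> measurable (PiM ({i} \<times> {..<n i}) (\<lambda>_. borel :: (real^'p) measure)) borel"
      by (intro borel_measurable_vec_of_sym borel_measurable_scatter measurable_component_singleton) simp
  qed
  moreover have "vec_of_sym (scatter (n i) (\<lambda>j. restrict (\<lambda>p. Y (fst p) (snd p) \<omega>) ({i} \<times> {..<n i}) (i, j))) = V i \<omega>" for i \<omega>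
    unfolding V_def by (intro arg_cong[where f = vec_of_sym] scatter_cong) simp
  ultimately have iV: "indep_vars (\<lambda>_. borel) V UNIV" by simp
  let ?g = "\<lambda>i v. K i * ennreal (wishart_weight (n i) L v)"
  have dV: "distr M borel (V i) = density lborel (?g i)" for i
  proof (rule measure_eqI)
    fix A assume "A \<in> sets (distr M borel (V i))"
    then have A [measurable]: "A \<in> sets borel" by simp
    have "emeasure (distr M borel (V i)) A = (\<integral>\<^sup>+\<omega>. indicator A (V i \<omega>) \<partial>M)"
      using nn_integral_distr[of "V i" M borel "indicator A"] by simp
    also have "\<dots> = K i * (\<integral>\<^sup>+v. ennreal (wishart_weight (n i) L v) * indicator A (vec_of_sym (sym_of v)) \<partial>lborel)"
      unfolding V_def by (rule K[of "\<lambda>B. indicator A (vec_of_sym B)"]) measurable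
    also have "\<dots> = (\<integral>\<^sup>+v. ?g i v * indicator A v \<partial>lborel)"
      by (subst nn_integral_cmult[symmetric]) (auto simp: mult.assoc)
    also have "\<dots> = emeasure (density lborel (?g i)) A" by (rule emeasure_density[symmetric]) auto
    finally show "emeasure (distr M borel (V i)) A = emeasure (density lborel (?g i)) A" .
  qed simp
  \<comment> \<open>Finiteness of \<open>K i\<close> has not been established, so sigma-finiteness
    is taken from these densities being the laws of the \<open>V i\<close>.\<close>
  have psf: "product_sigma_finite (\<lambda>i. density lborel (?g i))"
    unfolding product_sigma_finite_def dV[symmetric]
    by (auto intro!: prob_space_imp_sigma_finite prob_space_distr)
  have jV: "distr M (PiM UNIV (\<lambda>_. borel)) (\<lambda>\<omega>. \<lambda>i\<in>UNIV. V i \<omega>) = density (PiM UNIV (\<lambda>_. lborel)) (\<lambda>x. \<Prod>i\<in>UNIV. ?g i (x i))"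
  proof -
    have "distr M (PiM UNIV (\<lambda>_. borel)) (\<lambda>\<omega>. \<lambda>i\<in>UNIV. V i \<omega>) = PiM UNIV (\<lambda>i. distr M borel (V i))"
      using indep_vars_iff_distr_eq_PiM[of UNIV V "\<lambda>_. borel"] iV by simp
    also have "\<dots> = density (PiM UNIV (\<lambda>_. lborel)) (\<lambda>x. \<Prod>i\<in>UNIV. ?g i (x i))"
      unfolding dV by (rule PiM_density[OF product_sigma_finite_lborel _ _ psf]) auto
    finally show ?thesis .
  qed
  show "\<exists>K. \<forall>G\<in>borel_measurable borel. (\<integral>\<^sup>+\<omega>. G (scatter_vec n (\<lambda>i j. Y i j \<omega>)) \<partial>M) =
      K * (\<integral>\<^sup>+a. ennreal (block_density n a * exp (- trace (L ** sym_of (block_sum a)) / 2)) * G a \<partial>lborel)"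
  proof (intro exI[of _ "\<Prod>i\<in>UNIV. K i"] ballI)
    fix G :: "real^('k \<times> 'p uprod) \<Rightarrow> ennreal" assume G [measurable]: "G \<in> borel_measurable borel"
    let ?T = "\<lambda>f :: 'k \<Rightarrow> real^('p uprod). (\<chi> j. f (fst j) $ snd j) :: real^('k \<times> 'p uprod)"
    have sP: "sets (PiM UNIV (\<lambda>_::'k. lborel :: (real^('p uprod)) measure)) = sets (PiM UNIV (\<lambda>_. borel))"
      by (intro sets_PiM_cong) auto
    have mT: "?T \<in> borel_measurable (PiM UNIV (\<lambda>_. borel))" by measurable
    have mT' [measurable]: "?T \<in> borel_measurable (PiM UNIV (\<lambda>_. lborel))" by measurable
    have mW: "(\<lambda>\<omega>. \<lambda>i\<in>UNIV. V i \<omega>) \<in> measurable M (PiM UNIV (\<lambda>_. borel))"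
      by (intro measurable_restrict) simp
    have "(\<integral>\<^sup>+\<omega>. G (scatter_vec n (\<lambda>i j. Y i j \<omega>)) \<partial>M) = (\<integral>\<^sup>+\<omega>. G (?T (\<lambda>i\<in>UNIV. V i \<omega>)) \<partial>M)"
      by (simp add: scatter_vec_def V_def)
    also have "\<dots> = (\<integral>\<^sup>+f. G (?T f) \<partial>distr M (PiM UNIV (\<lambda>_. borel)) (\<lambda>\<omega>. \<lambda>i\<in>UNIV. V i \<omega>))"
      by (rule nn_integral_distr[OF mW, symmetric]) (simp add: measurable_compose[OF mT G])
    also have "\<dots> = (\<integral>\<^sup>+f. (\<Prod>i\<in>UNIV. ?g i (f i)) * G (?T f) \<partial>PiM UNIV (\<lambda>_. lborel))"
      unfolding jV by (rule nn_integral_density) measurable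
    also have "\<dots> = (\<integral>\<^sup>+f. (\<Prod>i\<in>UNIV. ?g i (block (?T f) i)) * G (?T f) \<partial>PiM UNIV (\<lambda>_. lborel))"
      by (simp add: block_def)
    also have "\<dots> = (\<integral>\<^sup>+a. (\<Prod>i\<in>UNIV. ?g i (block a i)) * G a \<partial>distr (PiM UNIV (\<lambda>_. lborel)) borel ?T)"
      by (rule nn_integral_distr[OF mT', symmetric]) measurable
    also have "distr (PiM UNIV (\<lambda>_. lborel)) borel ?T = lborel" by (rule lborel_eq_distr_PiM_prod[symmetric])
    also have "(\<integral>\<^sup>+a. (\<Prod>i\<in>UNIV. ?g i (block a i)) * G a \<partial>lborel) =
      (\<integral>\<^sup>+a. (\<Prod>i\<in>UNIV. K i) * (ennreal (block_density n a * exp (- trace (L ** sym_of (block_sum a)) / 2)) * G a) \<partial>lborel)"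
    proof (rule nn_integral_cong)
      fix a :: "real^('k \<times> 'p uprod)"
      have "(\<Prod>i\<in>UNIV. ennreal (wishart_weight (n i) L (block a i))) = ennreal (\<Prod>i\<in>UNIV. wishart_weight (n i) L (block a i))"
        by (rule prod_ennreal) (simp add: wishart_weight_def)
      then show "(\<Prod>i\<in>UNIV. ?g i (block a i)) * G a =
        (\<Prod>i\<in>UNIV. K i) * (ennreal (block_density n a * exp (- trace (L ** sym_of (block_sum a)) / 2)) * G a)"
        by (simp only: prod.distrib prod_wishart_weight mult.assoc)
    qed
    also have "\<dots> = (\<Prod>i\<in>UNIV. K i) * (\<integral>\<^sup>+a. ennreal (block_density n a * exp (- trace (L ** sym_of (block_sum a)) / 2)) * G a \<partial>lborel)"
      by (rule nn_integral_cmult) measurable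
    finally show "(\<integral>\<^sup>+\<omega>. G (scatter_vec n (\<lambda>i j. Y i j \<omega>)) \<partial>M) =
      (\<Prod>i\<in>UNIV. K i) * (\<integral>\<^sup>+a. ennreal (block_density n a * exp (- trace (L ** sym_of (block_sum a)) / 2)) * G a \<partial>lborel)" .
  qed
qed

theorem theorem1:
  fixes M :: "'a measure"
    and n :: "'k::finite \<Rightarrow> nat"
    and Y :: "'k \<Rightarrow> nat \<Rightarrow> 'a \<Rightarrow> real^'p::finite"
    and \<mu> :: "'k \<Rightarrow> real^'p"
    and \<Lambda> :: "'k \<Rightarrow> real^'p^'p"
    and c :: real
  assumes "prob_space M"
    and "CARD('k) \<ge> 2"
    and "\<And>i. n i \<ge> 3"
    and "\<And>i. n i \<ge> CARD('p) + 2"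
    and "\<And>i. pos_def_matrix (\<Lambda> i)"
    and "prob_space.indep_vars M (\<lambda>_. borel) (\<lambda>(i, j). Y i j) (SIGMA i:UNIV. {..<n i})"
    and "\<And>i j. j < n i \<Longrightarrow>
           distributed M lborel (Y i j) (\<lambda>x. ennreal (mvnormal_density (\<mu> i) (matrix_inv (\<Lambda> i)) x))"
    and H_psi: "\<And>i i'. \<Lambda> i = \<Lambda> i'"
    and "c > 0"
  defines "P \<equiv> \<lambda>\<omega>. equal_conc_p_value c n (\<lambda>i j. Y i j \<omega>)"
  shows "P \<in> borel_measurable (completion M) \<and>
         distr (completion M) borel P = uniform_measure lborel {0<..<1}"
proof -
  interpret prob_space M by fact
  obtain i0 :: 'k where True by blast
  define L where "L = \<Lambda> i0"
  have \<Lambda>: "\<Lambda> i = L" for i unfolding L_def by (rule H_psi)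
  have L: "pos_def_matrix L" unfolding L_def by (rule assms(5))
  have n0: "n i > 0" for i using assms(3)[of i] by simp
  have indep: "indep_vars (\<lambda>_. borel) (\<lambda>p. Y (fst p) (snd p)) (SIGMA i:UNIV. {..<n i})"
    using assms(6) by (simp add: case_prod_beta')
  note law = scatter_vec_law[of M L n Y \<mu>, OF assms(1) L assms(4) indep]
  have Yd: "distributed M lborel (Y i j) (\<lambda>x. ennreal (mvnormal_density (\<mu> i) (matrix_inv L) x))" if "j < n i" for i j
    using assms(7)[OF that] unfolding \<Lambda> .
  let ?w = "\<lambda>i. real (n i) / ntot n" and ?d = "(CARD('k) - 1) * CARD('p uprod)"
  have nt: "ntot n > 0" by (rule ntot_pos[OF n0])
  have w: "sum ?w UNIV = 1" "\<And>i. ?w i > 0"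
    using nt n0 by (auto simp: sum_divide_distrib[symmetric] ntot_def)
  interpret dg: dilation_group "dilate ?w :: real \<Rightarrow> real^('k \<times> 'p uprod) \<Rightarrow> _" ?d "\<lambda>a. norm (a - dilate ?w 0 a)" "block_density n"
    "\<lambda>a. exp (- trace (L ** sym_of (block_sum a)) / 2)"
    by (rule dilation_group_dilate[OF w assms(2)])
  define V where "V \<omega> = scatter_vec n (\<lambda>i j. Y i j \<omega>)" for \<omega>
  have V [measurable]: "V \<in> borel_measurable M" unfolding V_def by (rule law(1)[OF Yd])
  obtain K where K: "\<And>G. G \<in> borel_measurable borel \<Longrightarrow> (\<integral>\<^sup>+\<omega>. G (V \<omega>) \<partial>M) =
      K * (\<integral>\<^sup>+a. ennreal (block_density n a * exp (- trace (L ** sym_of (block_sum a)) / 2)) * G a \<partial>lborel)"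
    using law(3)[OF Yd] unfolding V_def by blast
  let ?X = "\<lambda>\<omega>. dg.ray_p_value (V \<omega>)"
  have fin: "dg.ray_tail u 0 < \<infinity>" if "norm (u - dilate ?w 0 u) > 0" for u :: "real^('k \<times> 'p uprod)"
    unfolding dg.ray_tail_def by (rule block_density_ray_finite[OF w(1) assms(4)]) (use that in auto)
  have cdf: "emeasure M {\<omega> \<in> space M. ?X \<omega> \<le> x} = ennreal x" if x: "0 < x" "x < 1" for x
  proof -
    let ?D = "\<lambda>a :: real^('k \<times> 'p uprod). ennreal (block_density n a * exp (- trace (L ** sym_of (block_sum a)) / 2))"
    have "emeasure M {\<omega> \<in> space M. ?X \<omega> \<le> x} = (\<integral>\<^sup>+\<omega>. indicator {\<omega> \<in> space M. ?X \<omega> \<le> x} \<omega> \<partial>M)"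
      by (rule nn_integral_indicator[symmetric]) measurable
    also have "\<dots> = (\<integral>\<^sup>+\<omega>. (if dg.ray_p_value (V \<omega>) \<le> x then 1 else 0) \<partial>M)"
      by (intro nn_integral_cong) (auto simp: indicator_def)
    also have "\<dots> = K * (\<integral>\<^sup>+a. ?D a * (if dg.ray_p_value a \<le> x then 1 else 0) \<partial>lborel)"
      by (rule K) measurable
    also have "(\<integral>\<^sup>+a. ?D a * (if dg.ray_p_value a \<le> x then 1 else 0) \<partial>lborel) = ennreal x * (\<integral>\<^sup>+a. ?D a \<partial>lborel)"
      by (rule dg.ray_p_value_uniform[OF x fin])
    also have "K * \<dots> = ennreal x * (K * (\<integral>\<^sup>+a. ?D a \<partial>lborel))" by (rule mult.left_commute)
    \<comment> \<open>The constant test function 1 identifies \<open>K\<close> times the total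
      integral with the mass of M, which removes the unknown constant.\<close>
    also have "K * (\<integral>\<^sup>+a. ?D a \<partial>lborel) = (\<integral>\<^sup>+\<omega>. 1 \<partial>M)"
      using K[of "\<lambda>_. 1"] by simp
    also have "\<dots> = 1" by (simp add: emeasure_space_1)
    finally show ?thesis by simp
  qed
  have X [measurable]: "?X \<in> borel_measurable M" by measurable
  have AE_pd: "AE \<omega> in M. \<forall>i. pos_def_matrix (scatter (n i) (\<lambda>j. Y i j \<omega>))" by (rule law(2)[OF Yd])
  have "AE \<omega> in M. P \<omega> = ?X \<omega>"
    using AE_pd
  proof eventually_elim
    case (elim \<omega>)
    then show ?case
      unfolding P_def V_def
      by (intro p_value_eq_ray_p_value[OF assms(2) n0 _ \<open>c > 0\<close>]) auto
  qed
  from borel_measurable_completion_AE_eq[OF X this] distr_eq_uniform[OF assms(1) X cdf]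
  show ?thesis by simp
qed

end
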